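(* Adopt Assumptions 1 and 2 with $\rho_k>0$, fix $\gamma\ge1$, let $t$ be a positive integer, and let $\mathcal G_0\supseteq\mathcal G_1\supseteq\cdots$ be good events satisfying condition (CR) for all $i\in[t]$. Let $\varepsilon_i=2\eta_iM(1+\gamma)$ and suppose that for all $i\in[t]$, $$\varepsilon_i\le\tfrac12,\qquad \eta_i\|\mathbf M\|\le\tfrac12,\qquad \mathrm e^{-\eta_i\rho_k/4}\le\frac{\varepsilon_i}{\varepsilon_{i-1}}\ \ (\text{the last only for } i\ge2).$$ Then for every $p\ge2$, $$\|W_t\mathbb 1_t\|_{p,p}^2\le\|W_t\mathbb 1_{t-1}\|_{p,p}^2\le \mathrm e^{-s_t\rho_k}\|W_0\mathbb 1_0\|_{p,p}^2+21\,p\,\varepsilon_t^2\sum_{i=0}^{t-1}\|W_i\mathbb 1_i\|_{p,p}^2+5\,p\,k^{2/p}\varepsilon_t^2\,t,$$ where $s_t=\sum_{i=1}^t\eta_i$. If moreover $p\varepsilon_i^2\le\eta_i\rho_k/50$ for all $i\in[t]$, then $$\|W_t\mathbb 1_t\|_{p,p}^2\le\|W_t\mathbb 1_{t-1}\|_{p,p}^2\le \mathrm e^{-s_t\rho_k/2}\|W_0\mathbb 1_0\|_{p,p}^2+5\,p\,k^{2/p}\varepsilon_t^2\,t.$$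
   Context: Let $d\ge2$, $1\le k<d$. $\mathrm P_A$ is a probability distribution on real symmetric $d\times d$ matrices and $A_1,A_2,\dots$ are i.i.d. samples from $\mathrm P_A$ with mean $\mathbf M=\mathbb E A_1$ (Assumption 1). Assumption 2: there is a scalar $M>0$ such that almost surely $\sup_P\|P^*(A_1-\mathbf M)\|_2\le M$, the supremum over all $d\times k$ matrices $P$ with orthonormal columns. $\lambda_1\ge\dots\ge\lambda_d$ are the eigenvalues of $\mathbf M$, $\rho_k=\lambda_k-\lambda_{k+1}$; $V\in\mathbb R^{d\times k}$ has as orthonormal columns the top $k$ eigenvectors of $\mathbf M$ and $U\in\mathbb R^{d\times(d-k)}$ the remaining eigenvectors. Oja's iterates: $Z_0\in\mathbb R^{d\times k}$ independent of the $A_i$, $Z_t=(I+\eta_tA_t)Z_{t-1}$ with step sizes $\eta_t>0$; $\mathcal F_t=\sigma(Z_0,A_1,\dots,A_t)$. Whenever $V^*Z_t$ is invertible, $W_t:=U^*Z_t(V^*Z_t)^{-1}$. Good events: a nested sequence $\mathcal G_0\supseteq\mathcal G_1\supseteq\cdots$ with $\mathcal G_i\in\mathcal F_i$ and $V^*Z_i$ invertible on $\mathcal G_i$; $\mathbb 1_i$ is the indicator of $\mathcal G_i$, and products such as $W_t\mathbb 1_{t-1}$ are defined to be $0$ outside $\mathcal G_{t-1}$. Condition (CR) at index $i\ge1$ (with parameter $\gamma$): $\|V^*(A_i-\mathbf M)UW_{i-1}\mathbb 1_{i-1}\|\le M\gamma$ almost surely. $\|\cdot\|$ is the spectral norm,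 $\|\cdot\|_p$ the Schatten $p$-norm, $\|X\|_{p,p}=(\mathbb E\|X\|_p^p)^{1/p}$. *)

theory Defs
  imports "HOL-Probability.Probability"
begin

definition spec_norm :: "real^'n^'m \<Rightarrow> real" where
  "spec_norm A = onorm (\<lambda>x. A *v x)"

definition diag_mat :: "('n::finite \<Rightarrow> real) \<Rightarrow> real^'n^'n" where
  "diag_mat f = (\<chi> i j. if i = j then f i else 0)"

text \<open>Singular values of X (indexed by the column index type, counted with
  multiplicity, zeros included): square roots of the eigenvalues of X^T X.\<close>
definition sing_vals :: "real^'n::finite^'m::finite \<Rightarrow> 'n \<Rightarrow> real" where
  "sing_vals X = (SOME s. (\<forall>j. 0 \<le> s j) \<and>
     (\<exists>Q::real^'n^'n. orthogonal_matrix Q \<and>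
        transpose X ** X = Q ** diag_mat (\<lambda>j. (s j)\<^sup>2) ** transpose Q))"

definition schatten :: "real \<Rightarrow> real^'n::finite^'m::finite \<Rightarrow> real" where
  "schatten p X = (\<Sum>j\<in>UNIV. sing_vals X j powr p) powr (1 / p)"

text \<open>Real power (a > 0) on extended nonnegative reals, top mapped to top.\<close>
definition ennpow :: "ennreal \<Rightarrow> real \<Rightarrow> ennreal" where
  "ennpow x a = (if x = top then top else ennreal (enn2real x powr a))"

definition pp_norm_sq :: "'a measure \<Rightarrow> real \<Rightarrow> ('a \<Rightarrow> real^'n::finite^'m::finite) \<Rightarrow> ennreal" where
  "pp_norm_sq P p X = ennpow (\<integral>\<^sup>+ \<omega>. ennreal (schatten p (X \<omega>) powr p) \<partial>P) (2 / p)"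

definition rv_sets :: "'a measure \<Rightarrow> ('a \<Rightarrow> 'b::topological_space) \<Rightarrow> 'a set set" where
  "rv_sets P X = {X -` B \<inter> space P | B. B \<in> sets borel}"

definition filt :: "'a measure \<Rightarrow> ('a \<Rightarrow> 'z::topological_space) \<Rightarrow> (nat \<Rightarrow> 'a \<Rightarrow> 'b::topological_space)
    \<Rightarrow> nat \<Rightarrow> 'a set set" where
  "filt P Z0 A t = sigma_sets (space P)
     (rv_sets P Z0 \<union> (\<Union>j\<in>{1..t}. rv_sets P (A j)))"

definition W_ind :: "real^'u^'d \<Rightarrow> real^'k^'d \<Rightarrow> (nat \<Rightarrow> 'a \<Rightarrow> real^'k^'d) \<Rightarrow> (nat \<Rightarrow> 'a set)
    \<Rightarrow> nat \<Rightarrow> nat \<Rightarrow> 'a \<Rightarrow> real^'k^'u" where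
  "W_ind U V Z G t s \<omega> =
     (if \<omega> \<in> G s then transpose U ** Z t \<omega> ** matrix_inv (transpose V ** Z t \<omega>) else 0)"

end

theory Submission
  imports Defs
begin

text \<open>
  Let \<open>N X = (norm of X in Schatten p) powr p\<close>. Since \<open>t powr (p/2)\<close> is convex, \<open>N X\<close> is the maximum of
  \<open>\<Sum>b. norm (X b) powr p\<close> over orthonormal bases, attained at right singular vectors. Applied to the self-adjoint
  dilation of \<open>X\<close>, Klein's trace inequality gives a linear functional \<open>g\<close> with
  \<open>0 \<le> N (X + Y) - N X - g Y \<le> p (p - 1) / 2 * (...)\<close>, the bracket being dominated by products
  \<open>norm ^ (p - 2) * norm ^ 2\<close>. Integrated against a conditionally centred \<open>Y\<close> this yields uniform smoothness of the
  \<open>L_p\<close> norm with constant \<open>4 (p - 1)\<close>.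

  One step of Oja's algorithm reads \<open>W' = (H + \<Theta>) (1 + \<Delta>)^(-1) = H + J - J \<Delta> (1 + \<Delta>)^(-1)\<close> with
  \<open>J = \<Theta> - H \<Delta>\<close>, where \<open>H\<close> contracts \<open>W\<close> by \<open>1 - 2 \<eta> \<rho> / 3\<close>, \<open>J\<close> is a martingale increment of size
  \<open>\<epsilon> (k powr (1/p) + 3 norm W) / 2\<close>, and the last term is smaller than \<open>J\<close> by the factor \<open>2 \<epsilon>\<close>. Smoothness for
  \<open>H + J\<close>, the triangle inequality for the last term, and unrolling give the theorem.
\<close>

subsection \<open>Scalar power inequalities\<close>

text \<open>Hoelder and Minkowski enter only through Young and convexity with free scales
  \<open>F\<close>, \<open>G\<close>: once these are set to bounds for the \<open>L_p\<close> norms,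
  integration collapses every majorant to a product or a sum of scales. Scales must be positive, so
  the step lemmas take any positive \<open>a\<close> whose \<open>p\<close>-th power bounds the
  moment, and the exact norm returns only when \<open>a\<close> decreases to it. The dilation is
  there because Klein's inequality compares two eigenbases, which rectangular matrices do not have;
  it merely doubles \<open>N\<close>. The functional \<open>g\<close> is built from an arbitrarily
  chosen eigenbasis, so its measurability in \<open>X\<close> is not visible from the formula; it
  follows once \<open>g\<close> is recognised as a limit of difference quotients, which the
  two-sided bound pins down. In the Oja step, \<open>(1 + \<Delta>)^(-1)\<close> spoils centring,
  since \<Delta> depends on the new sample. Peeling off \<open>H + J\<close> isolates the part that
  is affine in the new noise, with coefficients from the past; the rest is of second order in the
  noise and needs no centring. Outside the good event \<open>W\<close> is 0, and the
  \<open>V\<close> in the noise is switched off there too, so that one formula covers both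
  cases.\<close>

lemma powr_convex_on_nonneg:
  fixes p :: real
  assumes "1 \<le> p"
  shows "convex_on {0..} (\<lambda>x. x powr p)"
proof (rule convex_onI)
  fix t x y :: real
  assume t: "0 < t" "t < 1" and xy: "x \<in> {0..}" "y \<in> {0..}"
  \<comment> \<open>The endpoint 0 needs its own argument: with one point at zero the claim reduces
    to this inequality, which holds because \<open>u powr p\<close> is at most \<open>u\<close> on
    the unit interval.\<close>
  have *: "(u * z) powr p \<le> u * z powr p" if "0 \<le> z" "0 < u" "u < 1" for u z :: real
  proof -
    have "u powr p \<le> u powr 1"
      using that assms by (intro powr_mono') auto
    then show ?thesis
      using that by (simp add: powr_mult mult_right_mono)
  qed
  show "((1 - t) *\<^sub>R x + t *\<^sub>R y) powr p \<le> (1 - t) * x powr p + t * y powr p"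
  proof (cases "x = 0 \<or> y = 0")
    case True
    then show ?thesis
      using *[of y t] *[of x "1 - t"] t xy assms by auto
  next
    case False
    then show ?thesis
      using convex_onD[OF powr_convex[OF assms], of t x y] t xy by auto
  qed
qed simp

text \<open>Convexity at \<open>x / F\<close> and \<open>y / G\<close> with weights proportional to
  \<open>F\<close> and \<open>G\<close>. This is Minkowski's inequality before integration: if the
  moments of \<open>x\<close> and \<open>y\<close> are at most \<open>F powr p\<close> and
  \<open>G powr p\<close>, the right side averages to at most \<open>(F + G) powr p\<close>.\<close>

lemma powr_add_le_weighted:
  fixes p x y F G :: real
  assumes "1 \<le> p" "0 \<le> x" "0 \<le> y" "0 < F" "0 < G"
  shows "(x + y) powr p \<le> (F + G) powr p * (F / (F + G) * (x powr p / F powr p)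
           + G / (F + G) * (y powr p / G powr p))"
proof -
  let ?t = "G / (F + G)"
  have t: "1 - ?t = F / (F + G)" using assms by (simp add: field_simps)
  have "((1 - ?t) *\<^sub>R (x / F) + ?t *\<^sub>R (y / G)) powr p
      \<le> (1 - ?t) * (x / F) powr p + ?t * (y / G) powr p"
    using assms by (intro convex_onD[OF powr_convex_on_nonneg]) auto
  then have "((x + y) / (F + G)) powr p \<le> F / (F + G) * (x / F) powr p + ?t * (y / G) powr p"
    unfolding t using assms by (simp add: add_divide_distrib)
  then have "(x + y) powr p / (F + G) powr p
      \<le> F / (F + G) * (x powr p / F powr p) + ?t * (y powr p / G powr p)"
    using assms by (simp add: powr_divide)
  then show ?thesis
    using assms by (simp add: pos_divide_le_eq mult.commute)
qed

text \<open>Young's inequality with weights \<open>(p - 2) / p\<close> and \<open>2 / p\<close> for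
  the normalised quantities \<open>x / F\<close> and \<open>y / G\<close>; it plays the role of
  Hoelder's inequality once it is integrated.\<close>

lemma powr_mult_square_le:
  fixes p x y F G :: real
  assumes "2 \<le> p" "0 \<le> x" "0 \<le> y" "0 < F" "0 < G"
  shows "x powr (p - 2) * y\<^sup>2 \<le> F powr (p - 2) * G\<^sup>2 *
     ((p - 2) / p * (x powr p / F powr p) + 2 / p * (y powr p / G powr p))"
proof (cases "x = 0 \<or> y = 0")
  case True
  then show ?thesis using assms by auto
next
  case False
  then have pos: "0 < x / F" "0 < y / G" using assms by auto
  have e: "((x / F) powr p) powr ((p - 2) / p) = (x / F) powr (p - 2)"
          "((y / G) powr p) powr (2 / p) = (y / G)\<^sup>2"
    using assms pos by (simp_all add: powr_powr powr_numeral)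
  have "((x / F) powr p) powr ((p - 2) / p) * ((y / G) powr p) powr (2 / p)
      \<le> (p - 2) / p * ((x / F) powr p) + 2 / p * ((y / G) powr p)"
    using assms pos by (intro Youngs_inequality_0) (auto simp: field_simps)
  then have "(x / F) powr (p - 2) * (y / G)\<^sup>2
      \<le> (p - 2) / p * (x powr p / F powr p) + 2 / p * (y powr p / G powr p)"
    unfolding e using assms by (simp add: powr_divide)
  then have "F powr (p - 2) * G\<^sup>2 * ((x / F) powr (p - 2) * (y / G)\<^sup>2) \<le> F powr (p - 2) * G\<^sup>2 *
     ((p - 2) / p * (x powr p / F powr p) + 2 / p * (y powr p / G powr p))"
    by (intro mult_left_mono) auto
  moreover have "F powr (p - 2) * G\<^sup>2 * ((x / F) powr (p - 2) * (y / G)\<^sup>2) = x powr (p - 2) * y\<^sup>2"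
    using assms by (simp add: powr_divide power_divide)
  ultimately show ?thesis by simp
qed

text \<open>The derivative of \<open>\<bar>x\<bar> powr p\<close>.\<close>

definition dpow :: "real \<Rightarrow> real \<Rightarrow> real" where
  "dpow p x = p * sgn x * \<bar>x\<bar> powr (p - 1)"

lemma powr_taylor_pos:
  fixes a b p :: real
  assumes "2 \<le> p" "0 < a" "0 < b"
  obtains c where "0 < c" "c \<le> max a b"
    "b powr p = a powr p + p * a powr (p - 1) * (b - a) + p * (p - 1) / 2 * c powr (p - 2) * (b - a)\<^sup>2"
proof (cases "a = b")
  case True
  then show ?thesis using assms by (intro that[of a]) auto
next
  case False
  define diff where "diff m = (if m = 0 then (\<lambda>x. x powr p) else if m = 1 then (\<lambda>x. p * x powr (p - 1))
      else (\<lambda>x. p * (p - 1) * x powr (p - 2)))" for m :: nat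
  have "\<exists>c. (if b < a then b < c \<and> c < a else a < c \<and> c < b) \<and>
      b powr p = (\<Sum>m<2. (diff m a / fact m) * (b - a) ^ m) + (diff 2 c / fact 2) * (b - a) ^ 2"
  proof (rule Taylor)
    show "\<forall>m t. m < 2 \<and> min a b \<le> t \<and> t \<le> max a b \<longrightarrow> DERIV (diff m) t :> diff (Suc m) t"
    proof clarify
      fix m :: nat and t assume "m < 2" "min a b \<le> t" "t \<le> max a b"
      then have "0 < t" "m = 0 \<or> m = 1" using assms by auto
      then show "DERIV (diff m) t :> diff (Suc m) t"
        by (auto simp: diff_def intro!: derivative_eq_intros simp: algebra_simps)
    qed
  qed (use False in \<open>auto simp: diff_def\<close>)
  then obtain c where c: "(if b < a then b < c \<and> c < a else a < c \<and> c < b)"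
      "b powr p = (\<Sum>m<2. (diff m a / fact m) * (b - a) ^ m) + (diff 2 c / fact 2) * (b - a) ^ 2"
    by blast
  show ?thesis
  proof (rule that[of c])
    show "0 < c" "c \<le> max a b" using c(1) assms by (auto split: if_splits)
    show "b powr p = a powr p + p * a powr (p - 1) * (b - a) + p * (p - 1) / 2 * c powr (p - 2) * (b - a)\<^sup>2"
      using c(2) by (simp add: diff_def numeral_2_eq_2)
  qed
qed

text \<open>The remainder is bounded by a sum of a power of \<open>a\<close> and a power of
  \<open>b\<close>, not by a power of an intermediate point, so that in Klein's inequality each
  summand can be evaluated in a single eigenbasis. Negative \<open>a\<close> reduces to positive
  \<open>a\<close> by changing both signs.\<close>

lemma abs_powr_remainder:
  fixes a b p :: real
  assumes p: "2 \<le> p"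
  shows "\<bar>a\<bar> powr p + dpow p a * (b - a) \<le> \<bar>b\<bar> powr p"
    and "\<bar>b\<bar> powr p \<le> \<bar>a\<bar> powr p + dpow p a * (b - a)
           + p * (p - 1) / 2 * (\<bar>a\<bar> powr (p - 2) + \<bar>b\<bar> powr (p - 2)) * (b - a)\<^sup>2"
proof -
  let ?P = "\<lambda>a b. \<bar>a\<bar> powr p + dpow p a * (b - a) \<le> \<bar>b\<bar> powr p \<and>
     \<bar>b\<bar> powr p \<le> \<bar>a\<bar> powr p + dpow p a * (b - a)
           + p * (p - 1) / 2 * (\<bar>a\<bar> powr (p - 2) + \<bar>b\<bar> powr (p - 2)) * (b - a)\<^sup>2"
  \<comment> \<open>Coefficient comparisons for opposite signs, where the bound is checked term by
    term; the first one also settles \<open>a = 0\<close>.\<close>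
  have pp: "1 \<le> p * (p - 1) / 2" "p - 1 \<le> p * (p - 1) / 2" "p \<le> p * (p - 1)"
    using mult_mono[of 2 p 1 "p - 1"] mult_right_mono[of 2 p "p - 1"] mult_left_mono[of 1 "p - 1" p] p by auto
  have pos: "?P a b" if a: "0 < a" for a b :: real
  proof (cases "0 < b")
    case True
    obtain c where c: "0 < c" "c \<le> max a b" "b powr p = a powr p + p * a powr (p - 1) * (b - a)
        + p * (p - 1) / 2 * c powr (p - 2) * (b - a)\<^sup>2"
      using powr_taylor_pos[OF p a True] .
    have "c powr (p - 2) \<le> a powr (p - 2) + b powr (p - 2)"
    proof (cases "a \<le> b")
      case True
      then have "c powr (p - 2) \<le> b powr (p - 2)" using c p by (intro powr_mono2) auto
      then show ?thesis by (simp add: add_increasing)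
    next
      case False
      then have "c powr (p - 2) \<le> a powr (p - 2)" using c p by (intro powr_mono2) auto
      then show ?thesis by (simp add: add_increasing2)
    qed
    then have "p * (p - 1) / 2 * c powr (p - 2) * (b - a)\<^sup>2
        \<le> p * (p - 1) / 2 * (a powr (p - 2) + b powr (p - 2)) * (b - a)\<^sup>2"
      using pp by (intro mult_right_mono mult_left_mono) auto
    moreover have "0 \<le> p * (p - 1) / 2 * c powr (p - 2) * (b - a)\<^sup>2"
      using pp by auto
    ultimately show ?thesis
      using c(3) True a by (auto simp: dpow_def)
  next
    case False
    \<comment> \<open>Taylor's formula on the positive axis does not reach \<open>b = - c\<close>.
      Here \<open>(b - a)\<^sup>2\<close> equals \<open>(a + c)\<^sup>2\<close>, so all terms of the
      expanded bound are nonnegative, and the ones in \<open>a powr p\<close>,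
      \<open>a powr (p - 1) * c\<close> and \<open>c powr p\<close> suffice.\<close>
    define c where "c = - b"
    have c0: "0 \<le> c" using False by (simp add: c_def)
    have b: "b = - c" by (simp add: c_def)
    have ap: "a powr (p - 1) * a = a powr p" "a powr (p - 2) * a\<^sup>2 = a powr p"
        "a powr (p - 2) * a = a powr (p - 1)"
      using a powr_mult_base[of a "p - 1"] powr_mult_base[of a "p - 2"]
      by (simp_all add: mult.commute flip: powr_numeral powr_add)
    have cp: "c powr (p - 2) * c\<^sup>2 = c powr p"
      using c0 by (cases "c = 0") (simp_all flip: powr_numeral powr_add)
    have l: "a powr p + p * a powr (p - 1) * (b - a) \<le> c powr p"
    proof -
      have "a powr p + p * a powr (p - 1) * (b - a) = - (p - 1) * a powr p - p * a powr (p - 1) * c"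
        using ap(1) by (simp add: b algebra_simps)
      also have "\<dots> \<le> 0"
      proof -
        have "0 \<le> (p - 1) * a powr p" "0 \<le> p * a powr (p - 1) * c" using p c0 by auto
        then show ?thesis by linarith
      qed
      finally show ?thesis by (rule order_trans) simp
    qed
    have u: "c powr p \<le> a powr p + p * a powr (p - 1) * (b - a)
        + p * (p - 1) / 2 * (a powr (p - 2) + c powr (p - 2)) * (b - a)\<^sup>2"
    proof -
      have "(a powr (p - 2) + c powr (p - 2)) * (b - a)\<^sup>2
          = a powr p + 2 * a powr (p - 1) * c + a powr (p - 2) * c\<^sup>2 + c powr p
            + c powr (p - 2) * a * (2 * c + a)"
        unfolding b cp[symmetric] ap(2)[symmetric] ap(3)[symmetric]
        by (simp add: power2_eq_square algebra_simps)
      also have "\<dots> \<ge> a powr p + 2 * a powr (p - 1) * c + c powr p"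
        using a c0 by (intro add_increasing2 add_mono) auto
      finally have "p * (p - 1) / 2 * (a powr p + 2 * a powr (p - 1) * c + c powr p)
         \<le> p * (p - 1) / 2 * ((a powr (p - 2) + c powr (p - 2)) * (b - a)\<^sup>2)"
        using pp by (intro mult_left_mono) auto
      moreover have "c powr p + (p - 1) * a powr p + p * (a powr (p - 1) * c)
         \<le> p * (p - 1) / 2 * c powr p + p * (p - 1) / 2 * a powr p + p * (p - 1) * (a powr (p - 1) * c)"
        using mult_right_mono[OF pp(1), of "c powr p"] mult_right_mono[OF pp(2), of "a powr p"]
          mult_right_mono[OF pp(3), of "a powr (p - 1) * c"] c0 by auto
      moreover have "p * a powr (p - 1) * (b - a) = - (p * (a powr (p - 1) * c)) - p * a powr p"
        using ap(1) by (simp add: b algebra_simps)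
      moreover have "(p - 1) * a powr p = p * a powr p - a powr p"
        by (simp add: algebra_simps)
      moreover have "p * (p - 1) / 2 * (a powr p + 2 * a powr (p - 1) * c + c powr p)
          = p * (p - 1) / 2 * c powr p + p * (p - 1) / 2 * a powr p + p * (p - 1) * (a powr (p - 1) * c)"
        by (simp add: field_simps)
      ultimately show ?thesis
        by (simp only: mult.assoc)
    qed
    show ?thesis
      using l u False a by (auto simp: dpow_def b)
  qed
  have "?P a b"
  proof -
    consider "0 < a" | "a < 0" | "a = 0" by linarith
    then show ?thesis
    proof cases
      case 2
      then show ?thesis using pos[of "- a" "- b"] by (simp add: dpow_def power2_commute algebra_simps)
    next
      case 3
      have "\<bar>b\<bar> powr p = \<bar>b\<bar> powr (p - 2) * \<bar>b\<bar>\<^sup>2"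
        by (cases "b = 0") (simp_all only: powr_numeral[symmetric] powr_add[symmetric], simp_all)
      then show ?thesis
        using 3 mult_right_mono[OF pp(1), of "\<bar>b\<bar> powr p"] by (simp add: dpow_def algebra_simps)
    qed (rule pos)
  qed
  then show "\<bar>a\<bar> powr p + dpow p a * (b - a) \<le> \<bar>b\<bar> powr p"
    and "\<bar>b\<bar> powr p \<le> \<bar>a\<bar> powr p + dpow p a * (b - a)
           + p * (p - 1) / 2 * (\<bar>a\<bar> powr (p - 2) + \<bar>b\<bar> powr (p - 2)) * (b - a)\<^sup>2"
    by auto
qed

subsection \<open>Singular bases and Schatten norms\<close>

definition onb :: "'a::euclidean_space set \<Rightarrow> bool" where
  "onb B \<longleftrightarrow> finite B \<and> pairwise orthogonal B \<and> (\<forall>b\<in>B. norm b = 1) \<and> span B = UNIV"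

lemma orthonormal_Bessel:
  fixes x :: "'a::euclidean_space"
  assumes "finite C" "pairwise orthogonal C" "\<forall>c\<in>C. norm c = 1"
  shows "(\<Sum>c\<in>C. (x \<bullet> c)\<^sup>2) \<le> x \<bullet> x"
proof -
  let ?y = "\<Sum>c\<in>C. (x \<bullet> c) *\<^sub>R c"
  have 1: "x \<bullet> ?y = (\<Sum>c\<in>C. (x \<bullet> c)\<^sup>2)"
    by (simp add: inner_sum_right power2_eq_square)
  have "c \<bullet> ?y = x \<bullet> c" if "c \<in> C" for c
  proof -
    have "c \<bullet> ?y = (\<Sum>d\<in>C. if d = c then x \<bullet> c else 0)"
      unfolding inner_sum_right
    proof (rule sum.cong[OF refl])
      fix d assume "d \<in> C"
      then show "c \<bullet> (x \<bullet> d) *\<^sub>R d = (if d = c then x \<bullet> c else 0)"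
        using assms that by (auto simp: pairwise_def orthogonal_def norm_eq_1)
    qed
    then show ?thesis using assms that by simp
  qed
  then have 2: "?y \<bullet> ?y = (\<Sum>c\<in>C. (x \<bullet> c)\<^sup>2)"
    by (subst inner_sum_left) (simp add: power2_eq_square)
  have "0 \<le> (x - ?y) \<bullet> (x - ?y)" by simp
  also have "\<dots> = x \<bullet> x - (\<Sum>c\<in>C. (x \<bullet> c)\<^sup>2)"
    using 1 2 by (simp add: inner_diff_left inner_diff_right inner_commute)
  finally show ?thesis by simp
qed

lemma onb_expand:
  assumes "onb B"
  shows "(\<Sum>b\<in>B. (x \<bullet> b) *\<^sub>R b) = x"
  using assms by (intro orthonormal_basis_expand) (auto simp: onb_def)

lemma onb_parseval:
  assumes "onb B"
  shows "(\<Sum>b\<in>B. (x \<bullet> b) * (b \<bullet> y)) = x \<bullet> y"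
proof -
  have "x \<bullet> y = (\<Sum>b\<in>B. (x \<bullet> b) *\<^sub>R b) \<bullet> y"
    by (simp add: onb_expand[OF assms])
  then show ?thesis by (simp add: inner_sum_left)
qed

lemma onb_parseval_sq:
  assumes "onb B"
  shows "(\<Sum>b\<in>B. (x \<bullet> b)\<^sup>2) = x \<bullet> x"
  using onb_parseval[OF assms, of x x] by (simp add: power2_eq_square inner_commute)

text \<open>Maximise the quadratic form over the unit sphere of the subspace; first-order optimality makes
  the orthogonal complement of the maximiser conjugate to it.\<close>
lemma diagonalize_bilinear_on_subspace:
  fixes q :: "'a::euclidean_space \<Rightarrow> 'a \<Rightarrow> real"
  assumes q: "bilinear q" and sym: "\<And>x y. q x y = q y x"
  shows "subspace S \<Longrightarrow> dim S = n \<Longrightarrow>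
    \<exists>B. finite B \<and> B \<subseteq> S \<and> pairwise orthogonal B \<and> (\<forall>b\<in>B. norm b = 1) \<and> span B = S
      \<and> (\<forall>b\<in>B. \<forall>c\<in>B. b \<noteq> c \<longrightarrow> q b c = 0)"
proof (induction n arbitrary: S)
  case 0
  then have "S = {0}" using dim_eq_0 subspace_0 by blast
  then show ?case by (intro exI[of _ "{}"]) auto
next
  case (Suc n)
  let ?K = "S \<inter> sphere 0 1"
  obtain s where s: "s \<in> S" "s \<noteq> 0"
    using Suc.prems dim_eq_0[of S] by fastforce
  have "s /\<^sub>R norm s \<in> ?K" using s Suc.prems by (simp add: subspace_scale)
  then have ne: "?K \<noteq> {}" by blast
  have comp: "compact ?K"
    using closed_subspace[OF Suc.prems(1)] by (intro closed_Int_compact) auto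
  have "continuous_on ?K (\<lambda>x. q x x)"
    by (intro bilinear_continuous_on_compose[OF continuous_on_id continuous_on_id q])
  then obtain v where v: "v \<in> ?K" "\<And>x. x \<in> ?K \<Longrightarrow> q x x \<le> q v v"
    using continuous_attains_sup[OF comp ne] by blast
  have vS: "v \<in> S" and nv: "norm v = 1" using v(1) by auto
  have qle: "q x x \<le> q v v * (norm x)\<^sup>2" if "x \<in> S" for x
  proof (cases "x = 0")
    case True then show ?thesis using bilinear_lzero[OF q] by simp
  next
    case False
    have "q (x /\<^sub>R norm x) (x /\<^sub>R norm x) \<le> q v v"
      using False that Suc.prems by (intro v(2)) (auto simp: subspace_scale)
    then show ?thesis using False
      by (simp add: bilinear_lmul[OF q] bilinear_rmul[OF q] power2_eq_square field_simps)
  qed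
  have conj0: "q v w = 0" if w: "w \<in> S" "v \<bullet> w = 0" for w
  proof (rule ccontr)
    assume nz: "q v w \<noteq> 0"
    define C where "C = \<bar>q v v * (norm w)\<^sup>2 - q w w\<bar> + 1"
    have C: "0 < C" "q v v * (norm w)\<^sup>2 - q w w < C" unfolding C_def by linarith+
    define \<theta> where "\<theta> = q v w / C"
    have "q (v + \<theta> *\<^sub>R w) (v + \<theta> *\<^sub>R w) \<le> q v v * (norm (v + \<theta> *\<^sub>R w))\<^sup>2"
      using vS w Suc.prems by (intro qle) (simp add: subspace_add subspace_scale)
    moreover have "(norm (v + \<theta> *\<^sub>R w))\<^sup>2 = 1 + \<theta>\<^sup>2 * (norm w)\<^sup>2"
      unfolding power2_norm_eq_inner using w nv norm_eq_1[of v]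
      by (simp add: inner_add_left inner_add_right inner_commute power2_eq_square)
    moreover have "q (v + \<theta> *\<^sub>R w) (v + \<theta> *\<^sub>R w) = q v v + 2 * \<theta> * q v w + \<theta>\<^sup>2 * q w w"
      using sym[of w v] by (simp add: bilinear_ladd[OF q] bilinear_radd[OF q] bilinear_lmul[OF q]
          bilinear_rmul[OF q] power2_eq_square algebra_simps)
    ultimately have "2 * \<theta> * q v w \<le> \<theta>\<^sup>2 * (q v v * (norm w)\<^sup>2 - q w w)"
      by (simp add: algebra_simps)
    also have "\<dots> \<le> \<theta>\<^sup>2 * C" using C by (intro mult_left_mono) auto
    also have "\<dots> = \<theta> * q v w" using C(1) by (simp add: \<theta>_def power2_eq_square)
    finally have "\<theta> * q v w \<le> 0" by simp
    moreover have "\<theta> * q v w = (q v w)\<^sup>2 / C" by (simp add: \<theta>_def power2_eq_square)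
    ultimately show False using nz C(1) by (simp add: divide_le_0_iff)
  qed
  define S' where "S' = S \<inter> {w. v \<bullet> w = 0}"
  have sub': "subspace S'"
    unfolding S'_def by (intro subspace_inter Suc.prems subspace_hyperplane)
  have v0: "v \<noteq> 0" using nv by auto
  have decomp: "x = (x \<bullet> v) *\<^sub>R v + (x - (x \<bullet> v) *\<^sub>R v)" "x - (x \<bullet> v) *\<^sub>R v \<in> S'" if "x \<in> S" for x
    using that vS Suc.prems nv norm_eq_1[of v]
    by (auto simp: S'_def inner_diff_right inner_commute subspace_diff subspace_scale)
  have spanS: "S = span (insert v S')"
  proof
    show "S \<subseteq> span (insert v S')"
    proof
      fix x assume "x \<in> S"
      then show "x \<in> span (insert v S')"
        using decomp[of x] by (metis insert_iff span_add span_base span_scale)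
    qed
    show "span (insert v S') \<subseteq> S"
      using vS Suc.prems by (intro span_minimal) (auto simp: S'_def)
  qed
  have spS': "span S' = S'" using sub' by (rule span_eq_iff[THEN iffD2])
  have "v \<notin> S'" using nv norm_eq_1[of v] by (simp add: S'_def)
  then have "dim (insert v S') = Suc (dim S')" by (simp add: dim_insert spS')
  then have "dim S = Suc (dim S')" by (simp add: spanS)
  then have "dim S' = n" using Suc.prems by simp
  from Suc.IH[OF sub' this] obtain B where B: "finite B" "B \<subseteq> S'" "pairwise orthogonal B"
     "\<forall>b\<in>B. norm b = 1" "span B = S'" "\<forall>b\<in>B. \<forall>c\<in>B. b \<noteq> c \<longrightarrow> q b c = 0" by blast
  have vB: "v \<bullet> b = 0" "b \<bullet> v = 0" "q v b = 0" "q b v = 0" if "b \<in> B" for b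
    using B(2) that conj0[of b] sym[of b v] by (auto simp: S'_def inner_commute)
  have spn: "span (insert v B) = S"
  proof -
    have "span (insert v B) = span (insert v S')"
      using B(2,5) by (metis span_insert spS')
    then show ?thesis using spanS by simp
  qed
  show ?case
  proof (intro exI[of _ "insert v B"] conjI)
    show "finite (insert v B)" using B by simp
    show "insert v B \<subseteq> S" using B vS by (auto simp: S'_def)
    show "pairwise orthogonal (insert v B)"
      using B(3) vB by (auto simp: pairwise_insert orthogonal_def)
    show "\<forall>b\<in>insert v B. norm b = 1" using B nv by auto
    show "span (insert v B) = S" by (rule spn)
    show "\<forall>b\<in>insert v B. \<forall>c\<in>insert v B. b \<noteq> c \<longrightarrow> q b c = 0" using B(6) vB by auto
  qed
qed

section \<open>Orthonormal bases adapted to a linear map, and the variational formula\<close>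

lemma ex_onb_diagonalizing:
  fixes q :: "'a::euclidean_space \<Rightarrow> 'a \<Rightarrow> real"
  assumes "bilinear q" "\<And>x y. q x y = q y x"
  obtains B where "onb B" "\<And>b c. b \<in> B \<Longrightarrow> c \<in> B \<Longrightarrow> b \<noteq> c \<Longrightarrow> q b c = 0"
proof -
  obtain B where "finite B" "pairwise orthogonal B" "\<forall>b\<in>B. norm b = 1" "span B = UNIV"
      "\<forall>b\<in>B. \<forall>c\<in>B. b \<noteq> c \<longrightarrow> q b c = 0"
    using diagonalize_bilinear_on_subspace[OF assms subspace_UNIV refl] by (elim exE conjE) rule
  then show thesis by (intro that[of B]) (simp_all add: onb_def)
qed

text \<open>A basis of right singular vectors: the singular values are the norms of the images, so
  neither an order nor a matching basis of the target space has to be chosen.\<close>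

definition svd_basis :: "('a::euclidean_space \<Rightarrow> 'b::euclidean_space) \<Rightarrow> 'a set \<Rightarrow> bool" where
  "svd_basis f B \<longleftrightarrow> onb B \<and> (\<forall>b\<in>B. \<forall>c\<in>B. b \<noteq> c \<longrightarrow> f b \<bullet> f c = 0)"

text \<open>The symmetric form to diagonalise is the Gram form
  \<open>f x \<bullet> f y\<close>.\<close>

lemma ex_svd_basis:
  assumes "linear f"
  obtains B where "svd_basis f B"
proof -
  have "bilinear (\<lambda>x y. f x \<bullet> f y)"
    unfolding bilinear_def using assms
    by (auto intro!: linearI simp: linear_add linear_scale inner_add_left inner_add_right)
  from ex_onb_diagonalizing[OF this] that show ?thesis
    unfolding svd_basis_def by (metis inner_commute)
qed

text \<open>The form is \<open>T x \<bullet> y\<close>; once its off-diagonal entries vanish,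
  expanding \<open>T b\<close> in the basis leaves only the component along
  \<open>b\<close>.\<close>

lemma ex_eigenbasis:
  fixes T :: "'a::euclidean_space \<Rightarrow> 'a"
  assumes T: "linear T" and sa: "\<And>x y. T x \<bullet> y = x \<bullet> T y"
  obtains B where "onb B" "\<And>b. b \<in> B \<Longrightarrow> T b = (T b \<bullet> b) *\<^sub>R b"
proof -
  have "bilinear (\<lambda>x y. T x \<bullet> y)"
    unfolding bilinear_def using T
    by (auto intro!: linearI simp: linear_add linear_scale inner_add_left inner_add_right)
  from ex_onb_diagonalizing[OF this] obtain B where B: "onb B"
      "\<And>b c. b \<in> B \<Longrightarrow> c \<in> B \<Longrightarrow> b \<noteq> c \<Longrightarrow> T b \<bullet> c = 0"
    by (metis sa inner_commute)
  have "T b = (T b \<bullet> b) *\<^sub>R b" if "b \<in> B" for b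
  proof -
    have "T b = (\<Sum>c\<in>B. (T b \<bullet> c) *\<^sub>R c)" using onb_expand[OF B(1)] by simp
    also have "\<dots> = (\<Sum>c\<in>B. if c = b then (T b \<bullet> b) *\<^sub>R b else 0)"
      using B(2)[OF that] by (intro sum.cong) auto
    also have "\<dots> = (T b \<bullet> b) *\<^sub>R b" using that B(1) by (simp add: onb_def)
    finally show ?thesis .
  qed
  with B(1) that show ?thesis by blast
qed

lemma norm_sq_svd_basis:
  assumes f: "linear f" and B: "svd_basis f B"
  shows "(norm (f x))\<^sup>2 = (\<Sum>b\<in>B. (x \<bullet> b)\<^sup>2 * (norm (f b))\<^sup>2)"
proof -
  have o: "onb B" and fin: "finite B" using B by (auto simp: svd_basis_def onb_def)
  have "f x = f (\<Sum>b\<in>B. (x \<bullet> b) *\<^sub>R b)" by (simp add: onb_expand[OF o])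
  also have "\<dots> = (\<Sum>b\<in>B. (x \<bullet> b) *\<^sub>R f b)" by (simp add: linear_sum[OF f] linear_scale[OF f])
  finally have "(norm (f x))\<^sup>2 = (\<Sum>b\<in>B. \<Sum>c\<in>B. (x \<bullet> b) * (x \<bullet> c) * (f b \<bullet> f c))"
    by (simp add: power2_norm_eq_inner inner_sum_left inner_sum_right mult.assoc sum_distrib_left)
      (simp add: inner_commute)
  also have "\<dots> = (\<Sum>b\<in>B. \<Sum>c\<in>B. if c = b then (x \<bullet> b)\<^sup>2 * (norm (f b))\<^sup>2 else 0)"
    unfolding power2_norm_eq_inner
    using B by (intro sum.cong) (auto simp: svd_basis_def power2_eq_square)
  finally show ?thesis using fin by simp
qed

text \<open>The squared norm of \<open>f x\<close> is an average of the squared singular values with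
  weights \<open>(x \<bullet> b)\<^sup>2\<close> of total 1, so Jensen applies to the power
  \<open>p / 2\<close>, which is at least 1.\<close>

lemma norm_powr_le_svd_basis:
  fixes f :: "'a::euclidean_space \<Rightarrow> 'b::euclidean_space"
  assumes f: "linear f" and B: "svd_basis f B" and p: "2 \<le> p" and x: "norm x = 1"
  shows "norm (f x) powr p \<le> (\<Sum>b\<in>B. (x \<bullet> b)\<^sup>2 * norm (f b) powr p)"
proof -
  have o: "onb B" and fin: "finite B" using B by (auto simp: svd_basis_def onb_def)
  have one: "(\<Sum>b\<in>B. (x \<bullet> b)\<^sup>2) = 1" using onb_parseval_sq[OF o, of x] x norm_eq_1[of x] by simp
  then have ne: "B \<noteq> {}" by auto
  have e: "((norm z)\<^sup>2) powr (p / 2) = norm z powr p" for z :: 'b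
    by (cases "z = 0") (simp_all add: powr_powr flip: powr_numeral)
  have "norm (f x) powr p = (\<Sum>b\<in>B. (x \<bullet> b)\<^sup>2 *\<^sub>R (norm (f b))\<^sup>2) powr (p / 2)"
    using norm_sq_svd_basis[OF f B, of x] e[of "f x"] by simp
  also have "\<dots> \<le> (\<Sum>b\<in>B. (x \<bullet> b)\<^sup>2 * ((norm (f b))\<^sup>2) powr (p / 2))"
    using p one by (intro convex_on_sum[OF fin ne powr_convex_on_nonneg]) auto
  finally show ?thesis unfolding e .
qed

text \<open>After summing over \<open>C\<close> and exchanging the sums, Bessel's inequality bounds
  the total weight of each singular vector by 1. \<open>C\<close> may be incomplete; the passage to
  the transpose relies on this.\<close>

lemma sum_norm_powr_le_svd_basis:
  fixes f :: "'a::euclidean_space \<Rightarrow> 'b::euclidean_space"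
  assumes f: "linear f" and B: "svd_basis f B" and p: "2 \<le> p"
    and C: "finite C" "pairwise orthogonal C" "\<forall>c\<in>C. norm c = 1"
  shows "(\<Sum>c\<in>C. norm (f c) powr p) \<le> (\<Sum>b\<in>B. norm (f b) powr p)"
proof -
  have nB: "norm b = 1" if "b \<in> B" for b using B that by (auto simp: svd_basis_def onb_def)
  have "(\<Sum>c\<in>C. norm (f c) powr p) \<le> (\<Sum>c\<in>C. \<Sum>b\<in>B. (c \<bullet> b)\<^sup>2 * norm (f b) powr p)"
    using C by (intro sum_mono norm_powr_le_svd_basis[OF f B p]) auto
  also have "\<dots> = (\<Sum>b\<in>B. (\<Sum>c\<in>C. (b \<bullet> c)\<^sup>2) * norm (f b) powr p)"
    by (subst sum.swap) (simp add: sum_distrib_right inner_commute)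
  also have "\<dots> \<le> (\<Sum>b\<in>B. 1 * norm (f b) powr p)"
    using order_trans[OF orthonormal_Bessel[OF C]] nB by (intro sum_mono mult_right_mono) (auto simp: norm_eq_1)
  finally show ?thesis by simp
qed

text \<open>Stated for linear maps between Euclidean spaces, not for matrices, so that it also
  applies to the dilation on a product space. The choice of basis is immaterial because every
  singular basis attains the same maximum.\<close>

definition schatten_powr :: "real \<Rightarrow> ('a::euclidean_space \<Rightarrow> 'b::euclidean_space) \<Rightarrow> real" where
  "schatten_powr p f = (\<Sum>b\<in>(SOME B. svd_basis f B). norm (f b) powr p)"

lemma schatten_powr_eq:
  assumes f: "linear f" and B: "svd_basis f B" and p: "2 \<le> p"
  shows "schatten_powr p f = (\<Sum>b\<in>B. norm (f b) powr p)"
proof -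
  have C: "svd_basis f (SOME B. svd_basis f B)" using B by (rule someI)
  show ?thesis
    unfolding schatten_powr_def
  proof (rule antisym)
    show "(\<Sum>b\<in>(SOME B. svd_basis f B). norm (f b) powr p) \<le> (\<Sum>b\<in>B. norm (f b) powr p)"
      using C by (intro sum_norm_powr_le_svd_basis[OF f B p]) (auto simp: svd_basis_def onb_def)
    show "(\<Sum>b\<in>B. norm (f b) powr p) \<le> (\<Sum>b\<in>(SOME B. svd_basis f B). norm (f b) powr p)"
      using B by (intro sum_norm_powr_le_svd_basis[OF f C p]) (auto simp: svd_basis_def onb_def)
  qed
qed

lemma sum_norm_powr_le_schatten_powr:
  fixes f :: "'a::euclidean_space \<Rightarrow> 'b::euclidean_space"
  assumes f: "linear f" and p: "2 \<le> p"
    and C: "finite C" "pairwise orthogonal C" "\<forall>c\<in>C. norm c = 1"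
  shows "(\<Sum>c\<in>C. norm (f c) powr p) \<le> schatten_powr p f"
proof -
  obtain B where B: "svd_basis f B" using ex_svd_basis[OF f] .
  show ?thesis
    unfolding schatten_powr_eq[OF f B p] by (rule sum_norm_powr_le_svd_basis[OF f B p C])
qed

lemma schatten_powr_nonneg: "0 \<le> schatten_powr p f"
  unfolding schatten_powr_def by (intro sum_nonneg) simp

text \<open>The chosen basis is singular for the sum only; on it each summand stays below its own
  maximum, so the scalar inequality can be summed.\<close>

lemma schatten_powr_add:
  fixes f g :: "'a::euclidean_space \<Rightarrow> 'b::euclidean_space"
  assumes f: "linear f" and g: "linear g" and p: "2 \<le> p" and FG: "0 < F" "0 < G"
  shows "schatten_powr p (\<lambda>x. f x + g x) \<le> (F + G) powr p *
    (F / (F + G) * (schatten_powr p f / F powr p) + G / (F + G) * (schatten_powr p g / G powr p))"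
proof -
  have fg: "linear (\<lambda>x. f x + g x)" using f g by (rule linear_compose_add)
  obtain B where B: "svd_basis (\<lambda>x. f x + g x) B" using ex_svd_basis[OF fg] .
  have "schatten_powr p (\<lambda>x. f x + g x) \<le> (\<Sum>b\<in>B. (norm (f b) + norm (g b)) powr p)"
    unfolding schatten_powr_eq[OF fg B p] using p by (intro sum_mono powr_mono2 norm_triangle_ineq) auto
  also have "\<dots> \<le> (\<Sum>b\<in>B. (F + G) powr p *
    (F / (F + G) * (norm (f b) powr p / F powr p) + G / (F + G) * (norm (g b) powr p / G powr p)))"
    using p FG by (intro sum_mono powr_add_le_weighted) auto
  also have "\<dots> = (F + G) powr p * (F / (F + G) * ((\<Sum>b\<in>B. norm (f b) powr p) / F powr p)
      + G / (F + G) * ((\<Sum>b\<in>B. norm (g b) powr p) / G powr p))"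
    by (simp only: sum_distrib_left[symmetric] sum_divide_distrib[symmetric] sum.distrib)
  also have "\<dots> \<le> (F + G) powr p *
    (F / (F + G) * (schatten_powr p f / F powr p) + G / (F + G) * (schatten_powr p g / G powr p))"
    using FG B by (intro mult_left_mono add_mono divide_right_mono
        sum_norm_powr_le_schatten_powr[OF f p] sum_norm_powr_le_schatten_powr[OF g p])
      (auto simp: svd_basis_def onb_def)
  finally show ?thesis .
qed

subsection \<open>Klein's inequality and the self-adjoint dilation\<close>

lemma eigenbasis_svd_basis:
  assumes "onb B" "\<And>b. b \<in> B \<Longrightarrow> T b = (T b \<bullet> b) *\<^sub>R b"
  shows "svd_basis T B" "\<And>b. b \<in> B \<Longrightarrow> norm (T b) = \<bar>T b \<bullet> b\<bar>"
proof -
  have n: "norm b = 1" if "b \<in> B" for b using assms(1) that by (simp add: onb_def)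
  show "norm (T b) = \<bar>T b \<bullet> b\<bar>" if "b \<in> B" for b
  proof -
    have "norm (T b) = norm ((T b \<bullet> b) *\<^sub>R b)" using assms(2)[OF that] by simp
    then show ?thesis using n[OF that] by simp
  qed
  have "T b \<bullet> T c = 0" if "b \<in> B" "c \<in> B" "b \<noteq> c" for b c
  proof -
    have "b \<bullet> c = 0" using assms(1) that by (auto simp: onb_def pairwise_def orthogonal_def)
    then have "((T b \<bullet> b) *\<^sub>R b) \<bullet> ((T c \<bullet> c) *\<^sub>R c) = 0" by simp
    then show ?thesis using assms(2)[OF that(1)] assms(2)[OF that(2)] by simp
  qed
  then show "svd_basis T B" using assms(1) by (simp add: svd_basis_def)
qed

text \<open>In eigenbases of both operators, the trace of the first-order Taylor remainder
  is a nonnegative combination of scalar remainders.\<close>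
lemma schatten_powr_klein:
  fixes T S :: "'a::euclidean_space \<Rightarrow> 'a"
  assumes p: "2 \<le> p"
    and T: "linear T" "\<And>x y. T x \<bullet> y = x \<bullet> T y" and S: "linear S" "\<And>x y. S x \<bullet> y = x \<bullet> S y"
    and A: "onb A" "\<And>a. a \<in> A \<Longrightarrow> T a = (T a \<bullet> a) *\<^sub>R a"
    and B: "onb B" "\<And>b. b \<in> B \<Longrightarrow> S b = (S b \<bullet> b) *\<^sub>R b"
  shows "schatten_powr p T + (\<Sum>a\<in>A. dpow p (T a \<bullet> a) * (a \<bullet> (S a - T a))) \<le> schatten_powr p S"
    and "schatten_powr p S \<le> schatten_powr p T + (\<Sum>a\<in>A. dpow p (T a \<bullet> a) * (a \<bullet> (S a - T a)))
      + p * (p - 1) / 2 * ((\<Sum>a\<in>A. norm (T a) powr (p - 2) * (norm (S a - T a))\<^sup>2)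
                         + (\<Sum>b\<in>B. norm (S b) powr (p - 2) * (norm (S b - T b))\<^sup>2))"
proof -
  define \<alpha> where "\<alpha> a = T a \<bullet> a" for a
  define \<beta> where "\<beta> b = S b \<bullet> b" for b
  note sA = eigenbasis_svd_basis[of A T, OF A, folded \<alpha>_def]
  note sB = eigenbasis_svd_basis[of B S, OF B, folded \<beta>_def]
  have nA: "norm a = 1" if "a \<in> A" for a using A that by (simp add: onb_def)
  have nB: "norm b = 1" if "b \<in> B" for b using B that by (simp add: onb_def)
  have oneA: "(\<Sum>b\<in>B. (a \<bullet> b)\<^sup>2) = 1" if "a \<in> A" for a
    using onb_parseval_sq[OF B(1), of a] nA[OF that] by (simp add: norm_eq_1)
  have oneB: "(\<Sum>a\<in>A. (a \<bullet> b)\<^sup>2) = 1" if "b \<in> B" for b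
    using onb_parseval_sq[OF A(1), of b] nB[OF that] by (simp add: norm_eq_1 inner_commute)
  \<comment> \<open>The entries of \<open>S - T\<close> between the two eigenbases factor through
    the difference of eigenvalues. Hence all traces and squared norms below become double sums with
    the common weights \<open>(a \<bullet> b)\<^sup>2\<close>, and scalar inequalities can be
    applied entry by entry.\<close>
  have diff: "(S a - T a) \<bullet> b = (\<beta> b - \<alpha> a) * (a \<bullet> b)" "(S b - T b) \<bullet> a = (\<beta> b - \<alpha> a) * (a \<bullet> b)"
    if "a \<in> A" "b \<in> B" for a b
  proof -
    have Ta: "T a = \<alpha> a *\<^sub>R a" and Sb: "S b = \<beta> b *\<^sub>R b"
      using A(2)[OF that(1)] B(2)[OF that(2)] by (simp_all add: \<alpha>_def \<beta>_def)
    have "S a \<bullet> b = \<beta> b * (a \<bullet> b)" "T b \<bullet> a = \<alpha> a * (a \<bullet> b)"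
      using S(2)[of a b] T(2)[of b a] Ta Sb by (simp_all add: inner_commute)
    then show "(S a - T a) \<bullet> b = (\<beta> b - \<alpha> a) * (a \<bullet> b)" "(S b - T b) \<bullet> a = (\<beta> b - \<alpha> a) * (a \<bullet> b)"
      using Ta Sb by (simp_all add: inner_diff_left algebra_simps inner_commute)
  qed
  have lin: "(\<Sum>b\<in>B. (a \<bullet> b)\<^sup>2 * (\<beta> b - \<alpha> a)) = a \<bullet> (S a - T a)" if "a \<in> A" for a
  proof -
    have "(\<Sum>b\<in>B. (a \<bullet> b)\<^sup>2 * (\<beta> b - \<alpha> a)) = (\<Sum>b\<in>B. ((S a - T a) \<bullet> b) * (b \<bullet> a))"
      using inner_commute[of a] by (intro sum.cong) (auto simp: diff[OF that] power2_eq_square)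
    then show ?thesis using onb_parseval[OF B(1), of "S a - T a" a] by (simp add: inner_commute)
  qed
  have sqA: "(\<Sum>b\<in>B. (a \<bullet> b)\<^sup>2 * (\<beta> b - \<alpha> a)\<^sup>2) = (norm (S a - T a))\<^sup>2" if "a \<in> A" for a
  proof -
    have "(\<Sum>b\<in>B. (a \<bullet> b)\<^sup>2 * (\<beta> b - \<alpha> a)\<^sup>2) = (\<Sum>b\<in>B. ((S a - T a) \<bullet> b)\<^sup>2)"
      by (intro sum.cong) (auto simp: diff[OF that] power_mult_distrib)
    then show ?thesis by (simp add: onb_parseval_sq[OF B(1)] power2_norm_eq_inner)
  qed
  have sqB: "(\<Sum>a\<in>A. (a \<bullet> b)\<^sup>2 * (\<beta> b - \<alpha> a)\<^sup>2) = (norm (S b - T b))\<^sup>2" if "b \<in> B" for b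
  proof -
    have "(\<Sum>a\<in>A. (a \<bullet> b)\<^sup>2 * (\<beta> b - \<alpha> a)\<^sup>2) = (\<Sum>a\<in>A. ((S b - T b) \<bullet> a)\<^sup>2)"
      by (intro sum.cong) (auto simp: diff[OF _ that] power_mult_distrib)
    then show ?thesis by (simp add: onb_parseval_sq[OF A(1)] power2_norm_eq_inner)
  qed
  have eqT: "schatten_powr p T = (\<Sum>a\<in>A. norm (T a) powr p)"
    by (rule schatten_powr_eq[OF T(1) sA(1) p])
  have eqS: "schatten_powr p S = (\<Sum>b\<in>B. norm (S b) powr p)"
    by (rule schatten_powr_eq[OF S(1) sB(1) p])
  have tA: "schatten_powr p T = (\<Sum>a\<in>A. \<Sum>b\<in>B. (a \<bullet> b)\<^sup>2 * \<bar>\<alpha> a\<bar> powr p)"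
    unfolding eqT
    by (intro sum.cong) (simp_all add: sA(2) oneA flip: sum_distrib_right)
  have tB: "schatten_powr p S = (\<Sum>a\<in>A. \<Sum>b\<in>B. (a \<bullet> b)\<^sup>2 * \<bar>\<beta> b\<bar> powr p)"
    unfolding eqS
    by (subst sum.swap, intro sum.cong) (simp_all add: sB(2) oneB flip: sum_distrib_right)
  have tL: "(\<Sum>a\<in>A. dpow p (T a \<bullet> a) * (a \<bullet> (S a - T a)))
      = (\<Sum>a\<in>A. \<Sum>b\<in>B. (a \<bullet> b)\<^sup>2 * (dpow p (\<alpha> a) * (\<beta> b - \<alpha> a)))"
    by (intro sum.cong) (simp_all add: lin[symmetric] sum_distrib_left \<alpha>_def mult_ac)
  have tRA: "(\<Sum>a\<in>A. norm (T a) powr (p - 2) * (norm (S a - T a))\<^sup>2)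
      = (\<Sum>a\<in>A. \<Sum>b\<in>B. (a \<bullet> b)\<^sup>2 * (\<bar>\<alpha> a\<bar> powr (p - 2) * (\<beta> b - \<alpha> a)\<^sup>2))"
    by (intro sum.cong) (simp_all add: sqA[symmetric] sA(2) sum_distrib_left mult_ac)
  have tRB: "(\<Sum>b\<in>B. norm (S b) powr (p - 2) * (norm (S b - T b))\<^sup>2)
      = (\<Sum>a\<in>A. \<Sum>b\<in>B. (a \<bullet> b)\<^sup>2 * (\<bar>\<beta> b\<bar> powr (p - 2) * (\<beta> b - \<alpha> a)\<^sup>2))"
    by (subst sum.swap, intro sum.cong) (simp_all add: sqB[symmetric] sB(2) sum_distrib_left mult_ac)
  show "schatten_powr p T + (\<Sum>a\<in>A. dpow p (T a \<bullet> a) * (a \<bullet> (S a - T a))) \<le> schatten_powr p S"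
    unfolding tA tB tL sum.distrib[symmetric] distrib_left[symmetric]
    by (intro sum_mono mult_left_mono abs_powr_remainder p) simp
  show "schatten_powr p S \<le> schatten_powr p T + (\<Sum>a\<in>A. dpow p (T a \<bullet> a) * (a \<bullet> (S a - T a)))
      + p * (p - 1) / 2 * ((\<Sum>a\<in>A. norm (T a) powr (p - 2) * (norm (S a - T a))\<^sup>2)
                         + (\<Sum>b\<in>B. norm (S b) powr (p - 2) * (norm (S b - T b))\<^sup>2))"
  proof -
    have "schatten_powr p S \<le> (\<Sum>a\<in>A. \<Sum>b\<in>B. (a \<bullet> b)\<^sup>2 * (\<bar>\<alpha> a\<bar> powr p + dpow p (\<alpha> a) * (\<beta> b - \<alpha> a)
           + p * (p - 1) / 2 * (\<bar>\<alpha> a\<bar> powr (p - 2) + \<bar>\<beta> b\<bar> powr (p - 2)) * (\<beta> b - \<alpha> a)\<^sup>2))"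
      unfolding tB by (intro sum_mono mult_left_mono abs_powr_remainder p) simp
    also have "\<dots> = (\<Sum>a\<in>A. \<Sum>b\<in>B. (a \<bullet> b)\<^sup>2 * \<bar>\<alpha> a\<bar> powr p + (a \<bullet> b)\<^sup>2 * (dpow p (\<alpha> a) * (\<beta> b - \<alpha> a))
           + p * (p - 1) / 2 * ((a \<bullet> b)\<^sup>2 * (\<bar>\<alpha> a\<bar> powr (p - 2) * (\<beta> b - \<alpha> a)\<^sup>2)
              + (a \<bullet> b)\<^sup>2 * (\<bar>\<beta> b\<bar> powr (p - 2) * (\<beta> b - \<alpha> a)\<^sup>2)))"
      by (intro sum.cong refl) (simp only: distrib_left distrib_right mult_ac)
    also have "\<dots> = schatten_powr p T + (\<Sum>a\<in>A. dpow p (T a \<bullet> a) * (a \<bullet> (S a - T a)))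
      + p * (p - 1) / 2 * ((\<Sum>a\<in>A. norm (T a) powr (p - 2) * (norm (S a - T a))\<^sup>2)
                         + (\<Sum>b\<in>B. norm (S b) powr (p - 2) * (norm (S b - T b))\<^sup>2))"
      unfolding tA tL tRA tRB by (simp only: sum.distrib sum_distrib_left[symmetric])
    finally show ?thesis .
  qed
qed

text \<open>Young's inequality is applied vector by vector in a singular basis of \<open>T\<close>.
  This basis need not be singular for \<open>R\<close>, but the variational formula still bounds the
  resulting sum for \<open>R\<close>.\<close>

lemma sum_powr_mult_square_le_schatten_powr:
  fixes T R :: "'a::euclidean_space \<Rightarrow> 'a"
  assumes p: "2 \<le> p" and T: "linear T" and R: "linear R" and A: "svd_basis T A" and FG: "0 < F" "0 < G"
  shows "(\<Sum>a\<in>A. norm (T a) powr (p - 2) * (norm (R a))\<^sup>2) \<le> F powr (p - 2) * G\<^sup>2 *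
     ((p - 2) / p * (schatten_powr p T / F powr p) + 2 / p * (schatten_powr p R / G powr p))"
proof -
  have "(\<Sum>a\<in>A. norm (T a) powr (p - 2) * (norm (R a))\<^sup>2) \<le> (\<Sum>a\<in>A. F powr (p - 2) * G\<^sup>2 *
     ((p - 2) / p * (norm (T a) powr p / F powr p) + 2 / p * (norm (R a) powr p / G powr p)))"
    using p FG by (intro sum_mono powr_mult_square_le) auto
  also have "\<dots> = F powr (p - 2) * G\<^sup>2 *
     ((p - 2) / p * ((\<Sum>a\<in>A. norm (T a) powr p) / F powr p) + 2 / p * ((\<Sum>a\<in>A. norm (R a) powr p) / G powr p))"
    by (simp only: sum_distrib_left[symmetric] sum_divide_distrib[symmetric] sum.distrib)
  also have "\<dots> \<le> F powr (p - 2) * G\<^sup>2 *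
     ((p - 2) / p * (schatten_powr p T / F powr p) + 2 / p * (schatten_powr p R / G powr p))"
    using FG A p by (intro mult_left_mono add_mono divide_right_mono
        sum_norm_powr_le_schatten_powr[OF T p] sum_norm_powr_le_schatten_powr[OF R p])
      (auto simp: svd_basis_def onb_def)
  finally show ?thesis .
qed

text \<open>The upper bound still contains \<open>S\<close> on its right side. This does no harm:
  \<open>S\<close> gets its own scale \<open>H\<close>, later supplied by the triangle
  inequality.\<close>

lemma schatten_powr_self_adjoint_smooth:
  fixes T S :: "'a::euclidean_space \<Rightarrow> 'a"
  assumes p: "2 \<le> p"
    and T: "linear T" "\<And>x y. T x \<bullet> y = x \<bullet> T y" and S: "linear S" "\<And>x y. S x \<bullet> y = x \<bullet> S y"
    and A: "onb A" "\<And>a. a \<in> A \<Longrightarrow> T a = (T a \<bullet> a) *\<^sub>R a"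
    and FGH: "0 < F" "0 < G" "0 < H"
  shows "schatten_powr p T + (\<Sum>a\<in>A. dpow p (T a \<bullet> a) * (a \<bullet> (S a - T a))) \<le> schatten_powr p S"
    and "schatten_powr p S \<le> schatten_powr p T + (\<Sum>a\<in>A. dpow p (T a \<bullet> a) * (a \<bullet> (S a - T a)))
      + p * (p - 1) / 2 *
       (F powr (p - 2) * G\<^sup>2 * ((p - 2) / p * (schatten_powr p T / F powr p)
          + 2 / p * (schatten_powr p (\<lambda>x. S x - T x) / G powr p))
      + H powr (p - 2) * G\<^sup>2 * ((p - 2) / p * (schatten_powr p S / H powr p)
          + 2 / p * (schatten_powr p (\<lambda>x. S x - T x) / G powr p)))"
proof -
  obtain B where B: "onb B" "\<And>b. b \<in> B \<Longrightarrow> S b = (S b \<bullet> b) *\<^sub>R b"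
    using ex_eigenbasis[of S] S by blast
  note K = schatten_powr_klein[of p T S A B, OF p T S A B]
  show "schatten_powr p T + (\<Sum>a\<in>A. dpow p (T a \<bullet> a) * (a \<bullet> (S a - T a))) \<le> schatten_powr p S"
    by (rule K(1))
  have R: "linear (\<lambda>x. S x - T x)" using S(1) T(1) by (rule linear_compose_sub)
  have "0 \<le> p * (p - 1) / 2" using p by auto
  then show "schatten_powr p S \<le> schatten_powr p T + (\<Sum>a\<in>A. dpow p (T a \<bullet> a) * (a \<bullet> (S a - T a)))
      + p * (p - 1) / 2 *
       (F powr (p - 2) * G\<^sup>2 * ((p - 2) / p * (schatten_powr p T / F powr p)
          + 2 / p * (schatten_powr p (\<lambda>x. S x - T x) / G powr p))
      + H powr (p - 2) * G\<^sup>2 * ((p - 2) / p * (schatten_powr p S / H powr p)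
          + 2 / p * (schatten_powr p (\<lambda>x. S x - T x) / G powr p)))"
    by (intro order_trans[OF K(2)] add_left_mono mult_left_mono add_mono FGH
        sum_powr_mult_square_le_schatten_powr[OF p T(1) R] sum_powr_mult_square_le_schatten_powr[OF p S(1) R]
        eigenbasis_svd_basis(1)[OF A] eigenbasis_svd_basis(1)[OF B])
qed

section \<open>Transposes and the dilation of a rectangular matrix\<close>

abbreviation spow :: "real \<Rightarrow> real^'n^'m \<Rightarrow> real" where
  "spow p X \<equiv> schatten_powr p ((*v) X)"

lemma inner_transpose_matrix_vector:
  fixes X :: "real^'n^'m"
  shows "(transpose X *v x) \<bullet> y = x \<bullet> (X *v y)"
  by (simp add: dot_lmul_matrix)

lemma svd_basis_transpose_mult_self:
  fixes X :: "real^'n^'m"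
  assumes B: "svd_basis ((*v) X) B" and b: "b \<in> B"
  shows "transpose X *v (X *v b) = (norm (X *v b))\<^sup>2 *\<^sub>R b"
proof -
  have o: "onb B" and fin: "finite B" using B by (auto simp: svd_basis_def onb_def)
  have "transpose X *v (X *v b) = (\<Sum>c\<in>B. ((transpose X *v (X *v b)) \<bullet> c) *\<^sub>R c)"
    using onb_expand[OF o] by simp
  also have "\<dots> = (\<Sum>c\<in>B. if c = b then (norm (X *v b))\<^sup>2 *\<^sub>R b else 0)"
    using B b unfolding inner_transpose_matrix_vector svd_basis_def
    by (intro sum.cong) (auto simp: power2_norm_eq_inner)
  finally show ?thesis using fin b by simp
qed

text \<open>The normalised nonzero images of right singular vectors form an orthonormal, possibly
  incomplete, system on which the transpose takes the same norms. Applying the bound twice gives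
  equality.\<close>

lemma spow_le_transpose:
  fixes X :: "real^'n^'m"
  assumes p: "2 \<le> p"
  shows "spow p X \<le> spow p (transpose X)"
proof -
  obtain B where B: "svd_basis ((*v) X) B" using ex_svd_basis[of "(*v) X"] by auto
  have o: "onb B" and fin: "finite B" using B by (auto simp: svd_basis_def onb_def)
  have nB: "norm b = 1" if "b \<in> B" for b using o that by (simp add: onb_def)
  define B' where "B' = {b \<in> B. X *v b \<noteq> 0}"
  define u where "u b = (1 / norm (X *v b)) *\<^sub>R (X *v b)" for b
  have B': "finite B'" "B' \<subseteq> B" using fin by (auto simp: B'_def)
  have nu: "norm (u b) = 1" if "b \<in> B'" for b using that by (simp add: u_def B'_def)
  have orth: "u b \<bullet> u c = 0" if "b \<in> B'" "c \<in> B'" "b \<noteq> c" for b c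
    using B that by (auto simp: u_def B'_def svd_basis_def)
  have inj: "inj_on u B'"
  proof (rule inj_onI, rule ccontr)
    fix b c assume "b \<in> B'" "c \<in> B'" "u b = u c" "b \<noteq> c"
    then show False using orth[of b c] nu[of c] norm_eq_1[of "u c"] by simp
  qed
  note tr = svd_basis_transpose_mult_self[OF B]
  have nt: "norm (transpose X *v u b) = norm (X *v b)" if "b \<in> B'" for b
  proof -
    have "transpose X *v u b = (1 / norm (X *v b)) *\<^sub>R (transpose X *v (X *v b))"
      unfolding u_def by (rule linear_scale[OF matrix_vector_mul_linear])
    also have "\<dots> = norm (X *v b) *\<^sub>R b"
      using that B' by (subst tr) (auto simp: B'_def power2_eq_square)
    finally show ?thesis using nB that B' by auto
  qed
  have "spow p X = (\<Sum>b\<in>B. norm (X *v b) powr p)"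
    by (rule schatten_powr_eq[OF _ B p]) simp
  also have "\<dots> = (\<Sum>b\<in>B'. norm (X *v b) powr p)"
    using fin by (intro sum.mono_neutral_right) (auto simp: B'_def)
  also have "\<dots> = (\<Sum>b\<in>B'. norm (transpose X *v u b) powr p)"
    by (intro sum.cong) (simp_all only: nt)
  also have "\<dots> = (\<Sum>c\<in>u ` B'. norm (transpose X *v c) powr p)"
    by (simp only: sum.reindex[OF inj] o_def)
  also have "\<dots> \<le> spow p (transpose X)"
    using B' nu orth by (intro sum_norm_powr_le_schatten_powr[OF matrix_vector_mul_linear p])
      (auto simp: pairwise_image orthogonal_def pairwise_def)
  finally show ?thesis .
qed

lemma spow_transpose:
  fixes X :: "real^'n^'m"
  assumes p: "2 \<le> p"
  shows "spow p (transpose X) = spow p X"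
  using spow_le_transpose[OF p, of X] spow_le_transpose[OF p, of "transpose X"] by simp

text \<open>The block matrix with \<open>X\<close> and \<open>transpose X\<close> off the diagonal,
  realised on a product space.\<close>

definition dilation :: "real^'n^'m \<Rightarrow> (real^'m) \<times> (real^'n) \<Rightarrow> (real^'m) \<times> (real^'n)" where
  "dilation X z = (X *v snd z, transpose X *v fst z)"

lemma linear_dilation: "linear (dilation X)"
  unfolding dilation_def
  by (intro linearI) (auto simp: matrix_vector_right_distrib vector_matrix_left_distrib
      matrix_vector_mult_scaleR scaleR_vector_matrix_assoc)

lemma dilation_self_adjoint: "dilation X x \<bullet> y = x \<bullet> dilation X y"
proof -
  have "(X *v snd x) \<bullet> fst y = snd x \<bullet> (transpose X *v fst y)"
    using inner_transpose_matrix_vector[of X "fst y" "snd x"] by (simp only: inner_commute)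
  then show ?thesis
    using inner_transpose_matrix_vector[of X "fst x" "snd y"]
    by (simp only: dilation_def inner_prod_def fst_conv snd_conv)
qed

lemma dilation_diff: "dilation X z - dilation Y z = dilation (X - Y) z"
  by (simp add: dilation_def matrix_vector_mult_diff_rdistrib vector_matrix_mult_def vec_eq_iff
      algebra_simps sum_subtractf)

text \<open>Singular bases of \<open>X\<close> and of \<open>transpose X\<close>, placed in the two
  factors, are jointly singular for the dilation, since it exchanges the factors. The sum is
  therefore \<open>spow p (transpose X) + spow p X\<close>.\<close>

lemma schatten_powr_dilation:
  fixes X :: "real^'n^'m"
  assumes p: "2 \<le> p"
  shows "schatten_powr p (dilation X) = 2 * spow p X"
proof -
  obtain B where B: "svd_basis ((*v) X) B" using ex_svd_basis[of "(*v) X"] by auto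
  obtain C where C: "svd_basis ((*v) (transpose X)) C" using ex_svd_basis[of "(*v) (transpose X)"] by auto
  have fin: "finite B" "finite C" using B C by (auto simp: svd_basis_def onb_def)
  let ?L = "(\<lambda>c. (c, 0 :: real^'n)) ` C" and ?R = "(\<lambda>b. (0 :: real^'m, b)) ` B"
  have n0: "norm b = 1" if "b \<in> B" for b using B that by (simp add: svd_basis_def onb_def)
  have disj: "?L \<inter> ?R = {}" using n0 by fastforce
  have "(x, y) \<in> span (?L \<union> ?R)" for x y
  proof -
    have l: "linear (\<lambda>c. (c, 0 :: real^'n))" "linear (\<lambda>b. (0 :: real^'m, b))"
      by (auto intro!: linearI)
    have "span C = UNIV" "span B = UNIV" using B C by (auto simp: svd_basis_def onb_def)
    then have "(x, 0) \<in> span ?L" "(0, y) \<in> span ?R"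
      using linear_span_image[OF l(1), of C] linear_span_image[OF l(2), of B] by auto
    then have "(x, 0) + (0, y) \<in> span (?L \<union> ?R)"
      by (intro span_add) (meson span_mono subsetD Un_upper1 Un_upper2)+
    then show ?thesis by simp
  qed
  then have sp: "span (?L \<union> ?R) = UNIV" by auto
  have "svd_basis (dilation X) (?L \<union> ?R)"
    unfolding svd_basis_def onb_def
    using B C fin sp
    by (auto simp: svd_basis_def onb_def pairwise_def orthogonal_def norm_Pair dilation_def inner_prod_def
        simp del: transpose_matrix_vector) blast+
  then have "schatten_powr p (dilation X) = (\<Sum>z\<in>?L \<union> ?R. norm (dilation X z) powr p)"
    by (rule schatten_powr_eq[OF linear_dilation _ p])
  also have "\<dots> = (\<Sum>z\<in>?L. norm (dilation X z) powr p) + (\<Sum>z\<in>?R. norm (dilation X z) powr p)"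
    using fin disj by (intro sum.union_disjoint) auto
  also have "(\<Sum>z\<in>?L. norm (dilation X z) powr p) = (\<Sum>c\<in>C. norm (transpose X *v c) powr p)"
    by (subst sum.reindex) (auto simp: inj_on_def dilation_def norm_Pair simp del: transpose_matrix_vector)
  also have "\<dots> = spow p (transpose X)"
    by (rule schatten_powr_eq[OF matrix_vector_mul_linear C p, symmetric])
  also have "(\<Sum>z\<in>?R. norm (dilation X z) powr p) = (\<Sum>b\<in>B. norm (X *v b) powr p)"
    by (subst sum.reindex) (auto simp: inj_on_def dilation_def norm_Pair)
  also have "\<dots> = spow p X"
    by (rule schatten_powr_eq[OF matrix_vector_mul_linear B p, symmetric])
  finally show ?thesis unfolding spow_transpose[OF p] by simp
qed

subsection \<open>Schatten norms of matrices\<close>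

declare transpose_matrix_vector [simp del]

lemma spow_add:
  fixes X Y :: "real^'n^'m"
  assumes p: "2 \<le> p" and FG: "0 < F" "0 < G"
  shows "spow p (X + Y) \<le> (F + G) powr p *
    (F / (F + G) * (spow p X / F powr p) + G / (F + G) * (spow p Y / G powr p))"
proof -
  have "(\<lambda>x. X *v x + Y *v x) = (*v) (X + Y)"
    by (simp add: fun_eq_iff matrix_vector_mult_add_rdistrib)
  then show ?thesis
    using schatten_powr_add[OF matrix_vector_mul_linear[of X] matrix_vector_mul_linear[of Y] p FG] by simp
qed

lemma norm_matrix_vector_le: "norm (A *v x) \<le> spec_norm A * norm x"
  unfolding spec_norm_def by (rule onorm[OF matrix_vector_mul_bounded_linear])

lemma spec_norm_le:
  assumes "\<And>x. norm (A *v x) \<le> c * norm x"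
  shows "spec_norm A \<le> c"
  unfolding spec_norm_def by (rule onorm_le) (rule assms)

lemma spec_norm_nonneg: "0 \<le> spec_norm A"
  unfolding spec_norm_def by (rule onorm_pos_le[OF matrix_vector_mul_bounded_linear])

lemma spec_norm_mult: "spec_norm (A ** B) \<le> spec_norm A * spec_norm B"
proof (rule spec_norm_le)
  fix x
  have "norm ((A ** B) *v x) = norm (A *v (B *v x))" by (simp add: matrix_vector_mul_assoc)
  also have "\<dots> \<le> spec_norm A * (spec_norm B * norm x)"
    using norm_matrix_vector_le[of A "B *v x"] norm_matrix_vector_le[of B x] spec_norm_nonneg[of A]
    by (meson mult_left_mono order_trans)
  finally show "norm ((A ** B) *v x) \<le> spec_norm A * spec_norm B * norm x" by (simp add: mult.assoc)
qed

lemma spec_norm_transpose_le: "spec_norm (transpose A) \<le> spec_norm A"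
proof (rule spec_norm_le)
  fix x
  let ?y = "transpose A *v x"
  have "norm ?y * norm ?y = x \<bullet> (A *v ?y)"
    using inner_transpose_matrix_vector[of A x ?y] by (simp add: power2_norm_eq_inner flip: power2_eq_square)
  also have "\<dots> \<le> norm x * (spec_norm A * norm ?y)"
    by (intro order_trans[OF norm_cauchy_schwarz] mult_left_mono norm_matrix_vector_le) simp
  finally have "norm ?y * norm ?y \<le> (spec_norm A * norm x) * norm ?y" by (simp add: mult_ac)
  then show "norm ?y \<le> spec_norm A * norm x"
    using spec_norm_nonneg[of A] by (cases "norm ?y = 0") (auto simp: mult_le_cancel_right)
qed

lemma spec_norm_transpose: "spec_norm (transpose A) = spec_norm A"
  using spec_norm_transpose_le[of A] spec_norm_transpose_le[of "transpose A"] by simp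

lemma spow_mult_left:
  fixes A :: "real^'m^'l" and X :: "real^'n^'m"
  assumes p: "2 \<le> p"
  shows "spow p (A ** X) \<le> spec_norm A powr p * spow p X"
proof -
  obtain B where B: "svd_basis ((*v) (A ** X)) B" using ex_svd_basis[OF matrix_vector_mul_linear] .
  have "spow p (A ** X) = (\<Sum>b\<in>B. norm ((A ** X) *v b) powr p)"
    by (rule schatten_powr_eq[OF matrix_vector_mul_linear B p])
  also have "\<dots> \<le> (\<Sum>b\<in>B. (spec_norm A * norm (X *v b)) powr p)"
    using p by (intro sum_mono powr_mono2) (auto simp: norm_matrix_vector_le simp flip: matrix_vector_mul_assoc)
  also have "\<dots> = spec_norm A powr p * (\<Sum>b\<in>B. norm (X *v b) powr p)"
    by (simp add: powr_mult spec_norm_nonneg sum_distrib_left)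
  also have "\<dots> \<le> spec_norm A powr p * spow p X"
    using B by (intro mult_left_mono sum_norm_powr_le_schatten_powr[OF matrix_vector_mul_linear p])
      (auto simp: svd_basis_def onb_def)
  finally show ?thesis .
qed

lemma spow_mult_right:
  fixes X :: "real^'m^'l" and A :: "real^'n^'m"
  assumes p: "2 \<le> p"
  shows "spow p (X ** A) \<le> spow p X * spec_norm A powr p"
  using spow_mult_left[OF p, of "transpose A" "transpose X"]
  by (simp add: matrix_transpose_mul[symmetric] spow_transpose[OF p] spec_norm_transpose mult.commute)

lemma onb_card:
  fixes B :: "'a::euclidean_space set"
  assumes "onb B"
  shows "card B = DIM('a)"
proof -
  have "0 \<notin> B" "pairwise orthogonal B" "span B = UNIV" using assms by (auto simp: onb_def)
  then have "independent B" by (intro pairwise_orthogonal_independent)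
  then have "card B = dim (span B)" by (simp add: dim_eq_card_independent)
  then show ?thesis using \<open>span B = UNIV\<close> by simp
qed

text \<open>A singular basis has one vector per column. With \<open>k\<close> columns this is the
  origin of the factor \<open>k powr (2 / p)\<close> in the theorem.\<close>

lemma spow_le_card_spec_norm:
  fixes X :: "real^'n^'m"
  assumes p: "2 \<le> p"
  shows "spow p X \<le> real CARD('n) * spec_norm X powr p"
proof -
  obtain B where B: "svd_basis ((*v) X) B" using ex_svd_basis[OF matrix_vector_mul_linear] .
  have nB: "norm b = 1" if "b \<in> B" for b using B that by (simp add: svd_basis_def onb_def)
  have nX: "norm (X *v b) \<le> spec_norm X" if "b \<in> B" for b
    using norm_matrix_vector_le[of X b] nB[OF that] by simp
  have "spow p X = (\<Sum>b\<in>B. norm (X *v b) powr p)"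
    by (rule schatten_powr_eq[OF matrix_vector_mul_linear B p])
  also have "\<dots> \<le> (\<Sum>b\<in>B. spec_norm X powr p)"
    using p nX by (intro sum_mono powr_mono2) auto
  also have "\<dots> = real CARD('n) * spec_norm X powr p"
    using B by (simp add: svd_basis_def onb_card)
  finally show ?thesis .
qed

lemma spow_scaleR:
  fixes X :: "real^'n^'m"
  assumes p: "2 \<le> p"
  shows "spow p (c *\<^sub>R X) = \<bar>c\<bar> powr p * spow p X"
proof -
  obtain B where B: "svd_basis ((*v) X) B" using ex_svd_basis[OF matrix_vector_mul_linear] .
  have e: "(c *\<^sub>R X) *v b = c *\<^sub>R (X *v b)" for b by (simp add: scaleR_matrix_vector_assoc)
  have B': "svd_basis ((*v) (c *\<^sub>R X)) B" using B by (simp add: svd_basis_def e)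
  show ?thesis
    unfolding schatten_powr_eq[OF matrix_vector_mul_linear B p] schatten_powr_eq[OF matrix_vector_mul_linear B' p]
    by (simp add: e powr_mult sum_distrib_left)
qed

lemma spow_zero [simp]: "2 \<le> p \<Longrightarrow> spow p (0 :: real^'n^'m) = 0"
  using spow_scaleR[of p 0 "0 :: real^'n^'m"] by simp

text \<open>Shows that the choice in \<open>sing_vals\<close> has a witness: the columns of
  \<open>Q\<close> enumerate a singular basis.\<close>

lemma ex_singular_values:
  fixes X :: "real^'n^'m"
  shows "\<exists>s. (\<forall>j. 0 \<le> s j) \<and> (\<exists>Q::real^'n^'n. orthogonal_matrix Q \<and>
     transpose X ** X = Q ** diag_mat (\<lambda>j. (s j)\<^sup>2) ** transpose Q)"
proof -
  obtain B where B: "svd_basis ((*v) X) B" using ex_svd_basis[OF matrix_vector_mul_linear] .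
  have o: "onb B" using B by (simp add: svd_basis_def)
  have "card B = CARD('n)" "finite B" using onb_card[OF o] o by (auto simp: onb_def)
  then obtain f where f: "bij_betw f (UNIV :: 'n set) B"
    by (metis finite_class.finite_UNIV finite_same_card_bij)
  have fB: "f j \<in> B" for j using f by (auto simp: bij_betw_def)
  have inj: "f i \<noteq> f j" if "i \<noteq> j" for i j using f that by (auto simp: bij_betw_def inj_on_def)
  define Q :: "real^'n^'n" where "Q = (\<chi> i j. f j $ i)"
  define s where "s j = norm (X *v f j)" for j
  have col: "column j Q = f j" for j by (simp add: Q_def column_def vec_eq_iff)
  have Q: "orthogonal_matrix Q"
    unfolding orthogonal_matrix_orthonormal_columns col
    using o fB inj by (auto simp: onb_def pairwise_def)
  have "transpose X ** X ** Q = Q ** diag_mat (\<lambda>j. (s j)\<^sup>2)"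
  proof -
    have "(transpose X ** X ** Q) $ i $ j = (Q ** diag_mat (\<lambda>j. (s j)\<^sup>2)) $ i $ j" for i j
    proof -
      have "(transpose X ** X ** Q) $ i $ j = ((transpose X ** X) *v f j) $ i"
        by (simp add: matrix_matrix_mult_def matrix_vector_mult_def Q_def)
      also have "\<dots> = (s j)\<^sup>2 * f j $ i"
        using svd_basis_transpose_mult_self[OF B fB[of j]]
        by (simp add: s_def flip: matrix_vector_mul_assoc)
      also have "\<dots> = (Q ** diag_mat (\<lambda>j. (s j)\<^sup>2)) $ i $ j"
        by (simp add: matrix_matrix_mult_def diag_mat_def Q_def if_distrib cong: if_cong)
      finally show ?thesis .
    qed
    then show ?thesis by (simp add: vec_eq_iff)
  qed
  then have "transpose X ** X ** Q ** transpose Q = Q ** diag_mat (\<lambda>j. (s j)\<^sup>2) ** transpose Q" by simp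
  moreover have "transpose X ** X ** Q ** transpose Q = transpose X ** X"
    using Q by (simp add: orthogonal_matrix_def flip: matrix_mul_assoc)
  ultimately show ?thesis using Q by (intro exI[of _ s]) (auto simp: s_def)
qed

text \<open>Bridge from the norm of the statement to the variational one: whatever diagonalisation
  the choice in \<open>sing_vals\<close> satisfies, the columns of its \<open>Q\<close> form a
  singular basis, and all singular bases give the same sum.\<close>

lemma schatten_powr_spow:
  fixes X :: "real^'n^'m"
  assumes p: "2 \<le> p"
  shows "schatten p X powr p = spow p X"
proof -
  define s where "s = sing_vals X"
  have "(\<forall>j. 0 \<le> s j) \<and> (\<exists>Q::real^'n^'n. orthogonal_matrix Q \<and>
     transpose X ** X = Q ** diag_mat (\<lambda>j. (s j)\<^sup>2) ** transpose Q)"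
    unfolding s_def sing_vals_def by (rule someI_ex[OF ex_singular_values])
  then obtain Q :: "real^'n^'n" where s0: "\<And>j. 0 \<le> s j" and Q: "orthogonal_matrix Q"
    and eq: "transpose X ** X = Q ** diag_mat (\<lambda>j. (s j)\<^sup>2) ** transpose Q" by blast
  have "transpose X ** X ** Q = Q ** diag_mat (\<lambda>j. (s j)\<^sup>2)"
    using Q by (simp add: eq orthogonal_matrix_def flip: matrix_mul_assoc)
  then have ent: "((transpose X ** X) *v column j Q) $ i = (s j)\<^sup>2 * column j Q $ i" for i j
  proof -
    have "((transpose X ** X) *v column j Q) $ i = (transpose X ** X ** Q) $ i $ j"
      by (simp add: matrix_matrix_mult_def matrix_vector_mult_def column_def)
    also have "\<dots> = (Q ** diag_mat (\<lambda>j. (s j)\<^sup>2)) $ i $ j"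
      using \<open>transpose X ** X ** Q = Q ** diag_mat (\<lambda>j. (s j)\<^sup>2)\<close> by simp
    also have "\<dots> = (s j)\<^sup>2 * column j Q $ i"
      by (simp add: matrix_matrix_mult_def diag_mat_def column_def if_distrib cong: if_cong)
    finally show ?thesis .
  qed
  have eig: "transpose X *v (X *v column j Q) = (s j)\<^sup>2 *\<^sub>R column j Q" for j
    using ent[of j] by (simp add: vec_eq_iff matrix_vector_mul_assoc)
  have n1: "norm (column j Q) = 1" and orth: "i \<noteq> j \<Longrightarrow> column i Q \<bullet> column j Q = 0" for i j
    using Q unfolding orthogonal_matrix_orthonormal_columns by (auto simp: orthogonal_def)
  have inj: "inj (\<lambda>j. column j Q)"
  proof (rule injI, rule ccontr)
    fix i j assume "column i Q = column j Q" "i \<noteq> j"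
    then show False using orth[of i j] n1[of j] norm_eq_1[of "column j Q"] by simp
  qed
  let ?B = "range (\<lambda>j. column j Q)"
  have pw: "pairwise orthogonal ?B" using orth unfolding pairwise_image by (auto simp: pairwise_def orthogonal_def)
  have "0 \<notin> ?B" using n1 by (metis (mono_tags, lifting) norm_zero rangeE zero_neq_one)
  then have "independent ?B" by (rule pairwise_orthogonal_independent[OF pw])
  moreover have "card ?B = CARD('n)" using inj by (simp add: card_image)
  ultimately have "span ?B = UNIV"
    using card_eq_dim[of ?B UNIV] by (auto simp: independent_imp_finite)
  then have o: "onb ?B" using pw n1 by (auto simp: onb_def)
  have gram: "(X *v column i Q) \<bullet> (X *v column j Q) = (s j)\<^sup>2 * (column i Q \<bullet> column j Q)" for i j
    using inner_transpose_matrix_vector[of X "X *v column j Q" "column i Q"]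
    by (simp add: eig inner_commute)
  have orth': "column i Q \<bullet> column j Q = 0" if "column i Q \<noteq> column j Q" for i j
    using orth[of i j] that by (cases "i = j") auto
  have sv: "svd_basis ((*v) X) ?B" using o gram orth' by (auto simp: svd_basis_def)
  have nX: "norm (X *v column j Q) = s j" for j
  proof -
    have "(norm (X *v column j Q))\<^sup>2 = (s j)\<^sup>2"
      using gram[of j j] n1[of j] by (simp add: power2_norm_eq_inner norm_eq_1)
    then show ?thesis using s0 by simp
  qed
  have "spow p X = (\<Sum>j\<in>UNIV. s j powr p)"
    unfolding schatten_powr_eq[OF matrix_vector_mul_linear sv p] sum.reindex[OF inj] by (simp add: nX)
  moreover have "schatten p X powr p = (\<Sum>j\<in>UNIV. s j powr p)"
    using p by (simp add: schatten_def s_def[symmetric] powr_powr sum_nonneg)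
  ultimately show ?thesis by simp
qed

section \<open>The gradient of the Schatten power\<close>

definition dilation_eigenbasis :: "real^'n^'m \<Rightarrow> ((real^'m) \<times> (real^'n)) set" where
  "dilation_eigenbasis X = (SOME A. onb A \<and> (\<forall>a\<in>A. dilation X a = (dilation X a \<bullet> a) *\<^sub>R a))"

lemma dilation_eigenbasis:
  "onb (dilation_eigenbasis X)"
  "a \<in> dilation_eigenbasis X \<Longrightarrow> dilation X a = (dilation X a \<bullet> a) *\<^sub>R a"
proof -
  obtain B where "onb B" "\<And>b. b \<in> B \<Longrightarrow> dilation X b = (dilation X b \<bullet> b) *\<^sub>R b"
    using ex_eigenbasis[OF linear_dilation dilation_self_adjoint, of X] by blast
  then have "\<exists>A. onb A \<and> (\<forall>a\<in>A. dilation X a = (dilation X a \<bullet> a) *\<^sub>R a)" by blast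
  from someI_ex[OF this] show "onb (dilation_eigenbasis X)"
    "a \<in> dilation_eigenbasis X \<Longrightarrow> dilation X a = (dilation X a \<bullet> a) *\<^sub>R a"
    unfolding dilation_eigenbasis_def by blast+
qed

text \<open>The directional derivative of \<open>spow p\<close> at \<open>X\<close> along
  \<open>Y\<close>; the division by 2 undoes the doubling by the dilation. It refers to a chosen
  eigenbasis, but \<open>spow_grad_limit\<close> shows that the value does not depend on it.\<close>

definition spow_grad :: "real \<Rightarrow> real^'n^'m \<Rightarrow> real^'n^'m \<Rightarrow> real" where
  "spow_grad p X Y = (\<Sum>a\<in>dilation_eigenbasis X. dpow p (dilation X a \<bullet> a) * (a \<bullet> dilation Y a)) / 2"

lemma linear_spow_grad:
  fixes X :: "real^'n^'m"
  shows "linear (spow_grad p X)"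
proof (rule linearI)
  have "dilation (Y + Z) a = dilation Y a + dilation Z a" for Y Z :: "real^'n^'m" and a
    by (simp add: dilation_def matrix_vector_mult_add_rdistrib transpose_def vec_eq_iff
        matrix_vector_mult_def sum.distrib algebra_simps)
  then show "spow_grad p X (Y + Z) = spow_grad p X Y + spow_grad p X Z" for Y Z
    by (simp add: spow_grad_def inner_add_right distrib_left sum.distrib add_divide_distrib)
  have "dilation (c *\<^sub>R Y) a = c *\<^sub>R dilation Y a" for c and Y :: "real^'n^'m" and a
    by (simp add: dilation_def transpose_def vec_eq_iff matrix_vector_mult_def sum_distrib_left algebra_simps)
  then show "spow_grad p X (c *\<^sub>R Y) = c *\<^sub>R spow_grad p X Y" for c Y
    by (simp add: spow_grad_def sum_distrib_left mult.left_commute)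
qed

lemma spow_grad_le:
  fixes X Y :: "real^'n^'m"
  assumes p: "2 \<le> p"
  shows "spow p X + spow_grad p X (Y - X) \<le> spow p Y"
  using schatten_powr_self_adjoint_smooth(1)[OF p linear_dilation[of X] dilation_self_adjoint[of X]
      linear_dilation[of Y] dilation_self_adjoint[of Y] dilation_eigenbasis(1)[of X] dilation_eigenbasis(2)[of _ X], of 1 1 1]
  by (simp add: schatten_powr_dilation[OF p] dilation_diff spow_grad_def)

text \<open>Here \<open>x\<close> and \<open>y\<close> are \<open>p\<close>-th powers of norms. The
  expression is normalised so that moments at most \<open>F powr p\<close> and
  \<open>G powr p\<close> integrate it to at most \<open>F powr (p - 2) * G\<^sup>2\<close>.\<close>

definition young_bound :: "real \<Rightarrow> real \<Rightarrow> real \<Rightarrow> real \<Rightarrow> real \<Rightarrow> real" where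
  "young_bound p F G x y = F powr (p - 2) * G\<^sup>2 * ((p - 2) / p * (x / F powr p) + 2 / p * (y / G powr p))"

lemma spow_smooth:
  fixes X Y :: "real^'n^'m"
  assumes p: "2 \<le> p" and FGH: "0 < F" "0 < G" "0 < H"
  shows "spow p Y \<le> spow p X + spow_grad p X (Y - X) + p * (p - 1) / 2 *
     (young_bound p F G (spow p X) (spow p (Y - X)) + young_bound p H G (spow p Y) (spow p (Y - X)))"
proof -
  have two: "young_bound p F' G' (2 * x) (2 * y) = 2 * young_bound p F' G' x y" for F' G' x y
    by (simp add: young_bound_def algebra_simps)
  have half: "y \<le> x + s / 2 + K * (A + B)" if "2 * y \<le> 2 * x + s + K * (2 * A + 2 * B)"
    for x y s K A B :: real
  proof -
    have "2 * (K * (A + B)) = K * (2 * A + 2 * B)" by (simp add: algebra_simps)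
    then show ?thesis using that by linarith
  qed
  show ?thesis
    unfolding spow_grad_def
    by (rule half) (use schatten_powr_self_adjoint_smooth(2)[OF p linear_dilation[of X] dilation_self_adjoint[of X]
        linear_dilation[of Y] dilation_self_adjoint[of Y] dilation_eigenbasis(1)[of X] dilation_eigenbasis(2)[of _ X] FGH] in \<open>simp only: schatten_powr_dilation[OF p] dilation_diff young_bound_def[symmetric] two\<close>)
qed

text \<open>Average the supporting hyperplanes at the convex combination; by linearity the gradient
  terms cancel. Convexity then yields continuity and so measurability.\<close>

lemma convex_on_spow:
  assumes p: "2 \<le> p"
  shows "convex_on UNIV (spow p :: real^'n^'m \<Rightarrow> real)"
proof (rule convex_onI)
  fix t :: real and X Y :: "real^'n^'m"
  assume t: "0 < t" "t < 1"
  let ?Z = "(1 - t) *\<^sub>R X + t *\<^sub>R Y"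
  have "(1 - t) * (spow p ?Z + spow_grad p ?Z (X - ?Z)) + t * (spow p ?Z + spow_grad p ?Z (Y - ?Z))
      \<le> (1 - t) * spow p X + t * spow p Y"
    using t by (intro add_mono mult_left_mono spow_grad_le[OF p]) auto
  moreover have "(1 - t) * spow_grad p ?Z (X - ?Z) + t * spow_grad p ?Z (Y - ?Z) = 0"
  proof -
    have "(1 - t) * spow_grad p ?Z (X - ?Z) + t * spow_grad p ?Z (Y - ?Z)
        = spow_grad p ?Z ((1 - t) *\<^sub>R (X - ?Z) + t *\<^sub>R (Y - ?Z))"
      by (simp add: linear_add[OF linear_spow_grad] linear_scale[OF linear_spow_grad])
    also have "(1 - t) *\<^sub>R (X - ?Z) + t *\<^sub>R (Y - ?Z) = 0"
      by (simp add: algebra_simps)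
    finally show ?thesis by (simp add: linear_0[OF linear_spow_grad])
  qed
  ultimately show "spow p ?Z \<le> (1 - t) * spow p X + t * spow p Y"
    by (simp add: algebra_simps)
qed simp

lemma continuous_on_spow:
  assumes p: "2 \<le> p"
  shows "continuous_on UNIV (spow p :: real^'n^'m \<Rightarrow> real)"
  by (rule convex_on_continuous[OF open_UNIV convex_on_spow[OF p]])

lemma borel_measurable_spow [measurable (raw)]:
  assumes "2 \<le> p" and [measurable]: "X \<in> borel_measurable M"
  shows "(\<lambda>\<omega>. spow p (X \<omega> :: real^'n^'m)) \<in> borel_measurable M"
  using borel_measurable_continuous_onI[OF continuous_on_spow[OF assms(1)]] by measurable

text \<open>The gradient inequality bounds the quotient from below, and smoothness with scales
  \<open>1\<close>, \<open>h n\<close>, \<open>1\<close> bounds it from above: by homogeneity the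
  remainder is \<open>(h n)\<^sup>2 * C n\<close>, where \<open>C n\<close> converges. This
  identifies the gradient without reference to the chosen eigenbasis, which makes it measurable in
  \<open>X\<close>.\<close>

lemma spow_grad_limit:
  fixes X Y :: "real^'n^'m"
  assumes p: "2 \<le> p"
  shows "(\<lambda>n. real (Suc n) * (spow p (X + (1 / real (Suc n)) *\<^sub>R Y) - spow p X)) \<longlonglongrightarrow> spow_grad p X Y"
proof -
  define h where "h n = 1 / real (Suc n)" for n
  have h0: "0 < h n" for n by (simp add: h_def)
  have h1: "real (Suc n) = 1 / h n" for n by (simp add: h_def)
  have hlim: "h \<longlonglongrightarrow> 0" unfolding h_def using LIMSEQ_inverse_real_of_nat by (simp add: inverse_eq_divide)
  define C where "C n = p * (p - 1) / 2 * (((p - 2) / p * spow p X + 2 / p * spow p Y)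
     + ((p - 2) / p * spow p (X + h n *\<^sub>R Y) + 2 / p * spow p Y))" for n
  have yb: "young_bound p 1 (h n) x (spow p (h n *\<^sub>R Y)) = (h n)\<^sup>2 * ((p - 2) / p * x + 2 / p * spow p Y)" for n x
    using h0[of n] by (simp add: young_bound_def spow_scaleR[OF p])
  have up: "spow p (X + h n *\<^sub>R Y) - spow p X \<le> h n * spow_grad p X Y + (h n)\<^sup>2 * C n" for n
  proof -
    have "spow p (X + h n *\<^sub>R Y) \<le> spow p X + spow_grad p X (h n *\<^sub>R Y) + p * (p - 1) / 2 *
      (young_bound p 1 (h n) (spow p X) (spow p (h n *\<^sub>R Y))
       + young_bound p 1 (h n) (spow p (X + h n *\<^sub>R Y)) (spow p (h n *\<^sub>R Y)))"
      using spow_smooth[OF p zero_less_one h0[of n] zero_less_one, of "X + h n *\<^sub>R Y" X] by simp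
    also have "\<dots> = spow p X + h n * spow_grad p X Y + (h n)\<^sup>2 * C n"
      by (simp only: yb C_def linear_scale[OF linear_spow_grad]) (simp add: algebra_simps)
    finally show ?thesis by simp
  qed
  have low: "h n * spow_grad p X Y \<le> spow p (X + h n *\<^sub>R Y) - spow p X" for n
    using spow_grad_le[OF p, of X "X + h n *\<^sub>R Y"] by (simp add: linear_scale[OF linear_spow_grad])
  have "isCont (spow p) X"
    using continuous_on_spow[OF p, where ?'n = 'n and ?'m = 'm] by (simp add: continuous_on_eq_continuous_at)
  moreover have "(\<lambda>n. X + h n *\<^sub>R Y) \<longlonglongrightarrow> X + 0 *\<^sub>R Y" by (intro tendsto_intros hlim)
  ultimately have "(\<lambda>n. spow p (X + h n *\<^sub>R Y)) \<longlonglongrightarrow> spow p X"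
    using isCont_tendsto_compose[of X "spow p" "\<lambda>n. X + h n *\<^sub>R Y"] by simp
  then have "(\<lambda>n. spow_grad p X Y + h n * C n) \<longlonglongrightarrow> spow_grad p X Y + 0 * (p * (p - 1) / 2 *
     (((p - 2) / p * spow p X + 2 / p * spow p Y) + ((p - 2) / p * spow p X + 2 / p * spow p Y)))"
    unfolding C_def by (intro tendsto_intros hlim)
  then have lim: "(\<lambda>n. spow_grad p X Y + h n * C n) \<longlonglongrightarrow> spow_grad p X Y" by simp
  have "(\<lambda>n. (1 / h n) * (spow p (X + h n *\<^sub>R Y) - spow p X)) \<longlonglongrightarrow> spow_grad p X Y"
  proof (rule tendsto_sandwich[OF _ _ tendsto_const lim])
    show "\<forall>\<^sub>F n in sequentially. spow_grad p X Y \<le> (1 / h n) * (spow p (X + h n *\<^sub>R Y) - spow p X)"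
      using low h0 by (simp add: pos_le_divide_eq mult.commute)
    show "\<forall>\<^sub>F n in sequentially. (1 / h n) * (spow p (X + h n *\<^sub>R Y) - spow p X) \<le> spow_grad p X Y + h n * C n"
    proof (rule always_eventually, rule allI)
      fix n
      have "(1 / h n) * (spow p (X + h n *\<^sub>R Y) - spow p X)
          \<le> (1 / h n) * (h n * spow_grad p X Y + (h n)\<^sup>2 * C n)"
        using up[of n] h0[of n] by (intro mult_left_mono) auto
      also have "\<dots> = spow_grad p X Y + h n * C n"
        using h0[of n] by (simp add: power2_eq_square add_divide_distrib)
      finally show "(1 / h n) * (spow p (X + h n *\<^sub>R Y) - spow p X) \<le> spow_grad p X Y + h n * C n" .
    qed
  qed
  then show ?thesis unfolding h1 by (simp add: h_def)
qed

lemma borel_measurable_spow_grad: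
  assumes p: "2 \<le> p" and X: "X \<in> borel_measurable M"
  shows "(\<lambda>\<omega>. spow_grad p (X \<omega> :: real^'n^'m) Y) \<in> borel_measurable M"
  by (rule borel_measurable_LIMSEQ_real[OF spow_grad_limit[OF p]]) (use p X in measurable)

subsection \<open>Uniform smoothness\<close>

lemma matrix_expand_axis:
  fixes Y :: "real^'n^'m"
  shows "(\<Sum>i\<in>UNIV. \<Sum>j\<in>UNIV. Y $ i $ j *\<^sub>R axis i (axis j 1)) = Y"
proof -
  have "(\<Sum>i\<in>UNIV. \<Sum>j\<in>UNIV. Y $ i $ j *\<^sub>R axis i (axis j 1)) $ a $ b
      = (\<Sum>i\<in>UNIV. \<Sum>j\<in>UNIV. if j = b then (if i = a then Y $ i $ j else 0) else 0)" for a b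
    unfolding sum_component vector_scaleR_component
    by (intro sum.cong refl) (auto simp: axis_def)
  then show ?thesis by (simp add: vec_eq_iff)
qed

lemma linear_matrix_expand:
  fixes f :: "real^'n^'m \<Rightarrow> real"
  assumes "linear f"
  shows "f Y = (\<Sum>i\<in>UNIV. \<Sum>j\<in>UNIV. Y $ i $ j * f (axis i (axis j 1)))"
proof -
  have "f Y = f (\<Sum>i\<in>UNIV. \<Sum>j\<in>UNIV. Y $ i $ j *\<^sub>R axis i (axis j 1))"
    by (simp only: matrix_expand_axis)
  also have "\<dots> = (\<Sum>i\<in>UNIV. \<Sum>j\<in>UNIV. Y $ i $ j * f (axis i (axis j 1)))"
    by (simp add: linear_sum[OF assms] linear_scale[OF assms])
  finally show ?thesis .
qed

lemma borel_measurable_matrix_component [measurable (raw)]: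
  fixes Y :: "'a \<Rightarrow> real^'n^'m"
  assumes "Y \<in> borel_measurable M"
  shows "(\<lambda>\<omega>. Y \<omega> $ i $ j) \<in> borel_measurable M"
proof -
  have "continuous_on UNIV (\<lambda>Y :: real^'n^'m. Y $ i $ j)" by (intro continuous_intros)
  then show ?thesis using assms by (rule borel_measurable_continuous_on)
qed

text \<open>Linearity in the second argument turns joint measurability into a finite sum of products
  of entries of \<open>Y\<close> with gradients in fixed directions.\<close>

lemma borel_measurable_spow_grad_pair:
  fixes X Y :: "'a \<Rightarrow> real^'n^'m"
  assumes p: "2 \<le> p" and X: "X \<in> borel_measurable M" and Y: "Y \<in> borel_measurable M"
  shows "(\<lambda>\<omega>. spow_grad p (X \<omega>) (Y \<omega>)) \<in> borel_measurable M"
  by (subst linear_matrix_expand[OF linear_spow_grad]) (intro borel_measurable_sum borel_measurable_times borel_measurable_spow_grad[OF p X]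
      borel_measurable_matrix_component[OF Y])

text \<open>The gradient inequality in the directions \<open>Y\<close> and \<open>- Y\<close>. It
  serves only to establish integrability, so the constant is crude.\<close>

lemma abs_spow_grad_le:
  fixes X Y :: "real^'n^'m"
  assumes p: "2 \<le> p"
  shows "\<bar>spow_grad p X Y\<bar> \<le> 2 powr p * (2 * spow p X + spow p Y)"
proof -
  have yz: "spow p (- Y) = spow p Y" using spow_scaleR[OF p, of "-1" Y] by simp
  have "spow_grad p X Y \<le> spow p (X + Y)" "- spow_grad p X Y \<le> spow p (X + - Y)"
    using spow_grad_le[OF p, of X "X + Y"] spow_grad_le[OF p, of X "X + - Y"]
      schatten_powr_nonneg[of p "(*v) X"] linear_neg[OF linear_spow_grad, of p X Y] by auto
  moreover have "spow p (X + Z) \<le> 2 powr p * (1 / 2 * spow p X + 1 / 2 * spow p Z)" for Z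
    using spow_add[OF p zero_less_one zero_less_one, of X Z] by simp
  ultimately have "\<bar>spow_grad p X Y\<bar> \<le> 2 powr p * (1 / 2 * spow p X + 1 / 2 * spow p Y)"
    using yz by (smt (verit))
  also have "\<dots> \<le> 2 powr p * (2 * spow p X + spow p Y)"
    using schatten_powr_nonneg[of p "(*v) X"] schatten_powr_nonneg[of p "(*v) Y"]
    by (intro mult_left_mono) auto
  finally show ?thesis .
qed

text \<open>Minkowski's inequality for upper bounds \<open>F\<close>, \<open>G\<close> of the two
  \<open>L_p\<close> norms: after normalisation both moments are at most 1 and the weights add up to
  1.\<close>

lemma spow_add_integral:
  fixes X Y :: "'a \<Rightarrow> real^'n^'m"
  assumes p: "2 \<le> p" and FG: "0 < F" "0 < G"
    and m: "X \<in> borel_measurable M" "Y \<in> borel_measurable M"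
    and i: "integrable M (\<lambda>\<omega>. spow p (X \<omega>))" "integrable M (\<lambda>\<omega>. spow p (Y \<omega>))"
    and b: "(\<integral>\<omega>. spow p (X \<omega>) \<partial>M) \<le> F powr p" "(\<integral>\<omega>. spow p (Y \<omega>) \<partial>M) \<le> G powr p"
  shows "integrable M (\<lambda>\<omega>. spow p (X \<omega> + Y \<omega>))"
    and "(\<integral>\<omega>. spow p (X \<omega> + Y \<omega>) \<partial>M) \<le> (F + G) powr p"
proof -
  let ?r = "\<lambda>\<omega>. (F + G) powr p *
    (F / (F + G) * (spow p (X \<omega>) / F powr p) + G / (F + G) * (spow p (Y \<omega>) / G powr p))"
  have ir: "integrable M ?r" using i by auto
  show int: "integrable M (\<lambda>\<omega>. spow p (X \<omega> + Y \<omega>))"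
  proof (rule Bochner_Integration.integrable_bound[OF ir])
    show "(\<lambda>\<omega>. spow p (X \<omega> + Y \<omega>)) \<in> borel_measurable M"
      using m by (intro borel_measurable_spow[OF p] borel_measurable_add)
    show "AE \<omega> in M. norm (spow p (X \<omega> + Y \<omega>)) \<le> norm (?r \<omega>)"
      unfolding real_norm_def abs_of_nonneg[OF schatten_powr_nonneg]
      by (intro always_eventually allI order_trans[OF spow_add[OF p FG] abs_ge_self])
  qed
  have "(\<integral>\<omega>. spow p (X \<omega> + Y \<omega>) \<partial>M) \<le> (\<integral>\<omega>. ?r \<omega> \<partial>M)"
    using int ir spow_add[OF p FG] by (intro integral_mono) auto
  also have "\<dots> = (F + G) powr p * (F / (F + G) * ((\<integral>\<omega>. spow p (X \<omega>) \<partial>M) / F powr p)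
      + G / (F + G) * ((\<integral>\<omega>. spow p (Y \<omega>) \<partial>M) / G powr p))"
    using i by simp
  also have "\<dots> \<le> (F + G) powr p * (F / (F + G) * 1 + G / (F + G) * 1)"
    using b FG by (intro mult_left_mono add_mono) auto
  also have "F / (F + G) * 1 + G / (F + G) * 1 = 1"
    using FG by (simp add: add_divide_distrib[symmetric])
  finally show "(\<integral>\<omega>. spow p (X \<omega> + Y \<omega>) \<partial>M) \<le> (F + G) powr p" by simp
qed

lemma young_bound_integral:
  assumes p: "2 \<le> p" and FG: "0 < F" "0 < G"
    and i: "integrable M f" "integrable M g"
    and b: "(\<integral>\<omega>. f \<omega> \<partial>M) \<le> F powr p" "(\<integral>\<omega>. g \<omega> \<partial>M) \<le> G powr p"
  shows "integrable M (\<lambda>\<omega>. young_bound p F G (f \<omega>) (g \<omega>))"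
    and "(\<integral>\<omega>. young_bound p F G (f \<omega>) (g \<omega>) \<partial>M) \<le> F powr (p - 2) * G\<^sup>2"
proof -
  show "integrable M (\<lambda>\<omega>. young_bound p F G (f \<omega>) (g \<omega>))"
    unfolding young_bound_def using i by auto
  have "(\<integral>\<omega>. young_bound p F G (f \<omega>) (g \<omega>) \<partial>M) = F powr (p - 2) * G\<^sup>2 *
      ((p - 2) / p * ((\<integral>\<omega>. f \<omega> \<partial>M) / F powr p) + 2 / p * ((\<integral>\<omega>. g \<omega> \<partial>M) / G powr p))"
    unfolding young_bound_def using i by simp
  also have "\<dots> \<le> F powr (p - 2) * G\<^sup>2 * ((p - 2) / p * 1 + 2 / p * 1)"
    using b FG p by (intro mult_left_mono add_mono) auto
  also have "(p - 2) / p * 1 + 2 / p * 1 = 1" using p by (simp add: field_simps)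
  finally show "(\<integral>\<omega>. young_bound p F G (f \<omega>) (g \<omega>) \<partial>M) \<le> F powr (p - 2) * G\<^sup>2" by simp
qed

text \<open>Bernoulli's inequality for real exponents, obtained from Young's inequality with 1 as
  the second factor.\<close>

lemma one_plus_mult_le_powr:
  fixes q z :: real
  assumes "1 \<le> q" "0 \<le> z"
  shows "1 + q * z \<le> (1 + z) powr q"
proof -
  have pos: "0 < 1 + q * z" using assms by (simp add: add_pos_nonneg)
  have "(1 + q * z) powr (1 / q) * 1 powr (1 - 1 / q) \<le> 1 / q * (1 + q * z) + (1 - 1 / q) * 1"
    using assms pos by (intro Youngs_inequality_0) auto
  also have "\<dots> = 1 + z" using assms by (simp add: field_simps)
  finally have "((1 + q * z) powr (1 / q)) powr q \<le> (1 + z) powr q"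
    using assms by (intro powr_mono2) auto
  then show ?thesis using assms pos by (simp add: powr_powr)
qed

text \<open>When \<open>y (p - 1)\<close> exceeds \<open>h\<close> the triangle inequality is enough;
  otherwise \<open>(h + y) powr (p - 2)\<close> is at most \<open>exp 1\<close> times \<open>h powr (p - 2)\<close>,
  so the second-order expansion about \<open>H\<close> suffices.\<close>
lemma spow_smooth_integral:
  fixes H Y :: "'a \<Rightarrow> real^'n^'m"
  assumes p: "2 \<le> p" and hy: "0 < h" "0 < y"
    and m: "H \<in> borel_measurable M" "Y \<in> borel_measurable M"
    and i: "integrable M (\<lambda>\<omega>. spow p (H \<omega>))" "integrable M (\<lambda>\<omega>. spow p (Y \<omega>))"
    and b: "(\<integral>\<omega>. spow p (H \<omega>) \<partial>M) \<le> h powr p" "(\<integral>\<omega>. spow p (Y \<omega>) \<partial>M) \<le> y powr p"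
    and g0: "(\<integral>\<omega>. spow_grad p (H \<omega>) (Y \<omega>) \<partial>M) = 0"
  shows "(\<integral>\<omega>. spow p (H \<omega> + Y \<omega>) \<partial>M) \<le> sqrt (h\<^sup>2 + 4 * (p - 1) * y\<^sup>2) powr p"
proof -
  note tri = spow_add_integral[OF p hy m i b]
  show ?thesis
  proof (cases "h \<le> y * (p - 1)")
    case True
    have "2 * (h * y) \<le> 2 * ((y * (p - 1)) * y)"
      using True hy by (intro mult_left_mono mult_right_mono) auto
    moreover have "1 * y\<^sup>2 \<le> (p - 1) * y\<^sup>2" using p by (intro mult_right_mono) auto
    moreover have "0 \<le> (p - 1) * y\<^sup>2" using p by auto
    ultimately have "(h + y)\<^sup>2 \<le> h\<^sup>2 + 4 * (p - 1) * y\<^sup>2"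
      by (simp add: power2_eq_square algebra_simps)
    then have "h + y \<le> sqrt (h\<^sup>2 + 4 * (p - 1) * y\<^sup>2)" by (rule real_le_rsqrt)
    then show ?thesis using hy p by (intro order_trans[OF tri(2)] powr_mono2) auto
  next
    case False
    have ig: "integrable M (\<lambda>\<omega>. spow_grad p (H \<omega>) (Y \<omega>))"
    proof (rule Bochner_Integration.integrable_bound)
      show "integrable M (\<lambda>\<omega>. 2 powr p * (2 * spow p (H \<omega>) + spow p (Y \<omega>)))" using i by auto
    qed (auto intro!: borel_measurable_spow_grad_pair p m order_trans[OF abs_spow_grad_le[OF p] abs_ge_self])
    note y1 = young_bound_integral[OF p hy(1) hy(2) i b]
    \<comment> \<open>For the perturbed matrix the scale is \<open>h + y\<close>, the bound from the
      triangle inequality.\<close>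
    note y2 = young_bound_integral[OF p add_pos_pos[OF hy] hy(2) tri(1) i(2) tri(2) b(2)]
    let ?K = "p * (p - 1) / 2"
    let ?r = "\<lambda>\<omega>. spow p (H \<omega>) + spow_grad p (H \<omega>) (Y \<omega>) +
       ?K * (young_bound p h y (spow p (H \<omega>)) (spow p (Y \<omega>))
           + young_bound p (h + y) y (spow p (H \<omega> + Y \<omega>)) (spow p (Y \<omega>)))"
    have "(\<integral>\<omega>. spow p (H \<omega> + Y \<omega>) \<partial>M) \<le> (\<integral>\<omega>. ?r \<omega> \<partial>M)"
    proof (rule integral_mono)
      show "integrable M ?r" using i ig y1(1) y2(1) by auto
      show "spow p (H \<omega> + Y \<omega>) \<le> ?r \<omega>" for \<omega>
        using spow_smooth[OF p hy(1) hy(2) add_pos_pos[OF hy], of "H \<omega> + Y \<omega>" "H \<omega>"] by simp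
    qed (rule tri(1))
    also have "\<dots> = (\<integral>\<omega>. spow p (H \<omega>) \<partial>M) +
       ?K * ((\<integral>\<omega>. young_bound p h y (spow p (H \<omega>)) (spow p (Y \<omega>)) \<partial>M)
           + (\<integral>\<omega>. young_bound p (h + y) y (spow p (H \<omega> + Y \<omega>)) (spow p (Y \<omega>)) \<partial>M))"
      using i ig y1(1) y2(1) g0 by simp
    also have "\<dots> \<le> h powr p + ?K * (h powr (p - 2) * y\<^sup>2 + (h + y) powr (p - 2) * y\<^sup>2)"
      using p by (intro add_mono mult_left_mono b y1(2) y2(2)) auto
    \<comment> \<open>With \<open>exp 1\<close> rounded up to 3, the two Young terms contribute 1 +
      3 = 4; this is the 4 in the claim.\<close>
    also have "\<dots> \<le> h powr p + ?K * (h powr (p - 2) * y\<^sup>2 + 3 * h powr (p - 2) * y\<^sup>2)"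
    proof -
      have "(h + y) powr (p - 2) = h powr (p - 2) * (1 + y / h) powr (p - 2)"
        using hy by (simp add: distrib_left flip: powr_mult)
      also have "\<dots> \<le> h powr (p - 2) * 3"
      proof (intro mult_left_mono)
        have "(1 + y / h) powr (p - 2) \<le> exp (y / h) powr (p - 2)"
          using hy p by (intro powr_mono2) auto
        also have "\<dots> = exp (y / h * (p - 2))" by (simp add: powr_def mult.commute)
        also have "y / h * (p - 2) \<le> 1"
        proof -
          have "y * (p - 2) \<le> y * (p - 1)" using hy by (intro mult_left_mono) auto
          then have "y * (p - 2) \<le> h" using False by linarith
          then show ?thesis using hy by (simp add: pos_divide_le_eq)
        qed
        then have "exp (y / h * (p - 2)) \<le> exp 1" by simp
        also have "\<dots> \<le> 3" by (rule exp_le)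
        finally show "(1 + y / h) powr (p - 2) \<le> 3" .
      qed simp
      finally have "(h + y) powr (p - 2) * y\<^sup>2 \<le> 3 * h powr (p - 2) * y\<^sup>2"
        by (intro mult_right_mono) (auto simp: mult.commute)
      then show ?thesis using p by (intro add_left_mono mult_left_mono) auto
    qed
    also have "\<dots> = h powr p * (1 + (p / 2) * (4 * (p - 1) * y\<^sup>2 / h\<^sup>2))"
    proof -
      have "h powr p = h powr (p - 2) * h\<^sup>2" using hy by (simp flip: powr_add powr_numeral)
      then show ?thesis using hy by (simp add: field_simps)
    qed
    \<comment> \<open>Bernoulli with exponent \<open>p / 2\<close> turns the first-order bound for
      the \<open>p\<close>-th moment into an additive bound for the squared norm.\<close>
    also have "\<dots> \<le> h powr p * (1 + 4 * (p - 1) * y\<^sup>2 / h\<^sup>2) powr (p / 2)"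
      using p hy by (intro mult_left_mono one_plus_mult_le_powr) auto
    also have "\<dots> = (h\<^sup>2) powr (p / 2) * (1 + 4 * (p - 1) * y\<^sup>2 / h\<^sup>2) powr (p / 2)"
      using hy by (simp add: powr_powr flip: powr_numeral)
    also have "\<dots> = (h\<^sup>2 + 4 * (p - 1) * y\<^sup>2) powr (p / 2)"
      using hy p by (simp add: distrib_left flip: powr_mult)
    also have "\<dots> = sqrt (h\<^sup>2 + 4 * (p - 1) * y\<^sup>2) powr p"
      using hy p by (simp add: powr_half_sqrt[symmetric] powr_powr)
    finally show ?thesis .
  qed
qed

subsection \<open>The deterministic Oja step\<close>

lemma matrix_add_rdistrib: "(A + B) ** C = A ** C + B ** (C :: 'a::semiring_1^'n^'m)"
  by (simp add: matrix_matrix_mult_def vec_eq_iff sum.distrib distrib_right)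

lemma matrix_diff_ldistrib: "C ** (A - B) = C ** A - C ** (B :: real^'n^'m)"
  by (simp add: matrix_matrix_mult_def vec_eq_iff sum_subtractf right_diff_distrib)

lemma matrix_diff_rdistrib: "(A - B) ** C = A ** C - B ** (C :: real^'n^'m)"
  by (simp add: matrix_matrix_mult_def vec_eq_iff sum_subtractf left_diff_distrib)

lemma matrix_scaleR_left: "(c *\<^sub>R A) ** B = c *\<^sub>R (A ** (B :: real^'n^'m))"
  by (simp add: matrix_matrix_mult_def vec_eq_iff sum_distrib_left mult.assoc)

lemma matrix_scaleR_right: "A ** (c *\<^sub>R B) = c *\<^sub>R (A ** (B :: real^'n^'m))"
  by (simp add: matrix_matrix_mult_def vec_eq_iff sum_distrib_left mult_ac)

lemma matrix_zero_left [simp]: "0 ** (A :: real^'n^'m) = 0"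
  by (simp add: matrix_matrix_mult_def vec_eq_iff)

lemma matrix_zero_right [simp]: "(A :: real^'n^'m) ** 0 = 0"
  by (simp add: matrix_matrix_mult_def vec_eq_iff)

lemmas matrix_ring_simps = matrix_add_ldistrib matrix_add_rdistrib matrix_diff_ldistrib
  matrix_diff_rdistrib matrix_scaleR_left matrix_scaleR_right

lemma matrix_inv_inverse:
  fixes A :: "real^'n^'n"
  assumes "invertible A"
  shows "A ** matrix_inv A = mat 1" "matrix_inv A ** A = mat 1"
  using someI_ex[of "\<lambda>A'. A ** A' = mat 1 \<and> A' ** A = mat 1"] assms
  unfolding matrix_inv_def invertible_def by auto

lemma matrix_inv_unique:
  fixes A :: "real^'n^'n"
  assumes "A ** B = mat 1"
  shows "matrix_inv A = B" "invertible A"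
proof -
  show inv: "invertible A" using assms invertible_right_inverse by blast
  have "matrix_inv A = matrix_inv A ** (A ** B)" using assms by simp
  then show "matrix_inv A = B" using inv by (simp add: matrix_mul_assoc matrix_inv_inverse)
qed

text \<open>No Neumann series: \<open>1 + D\<close> shrinks no vector by more than half, which gives
  injectivity and, read backwards, the bound for the inverse.\<close>

lemma matrix_inv_one_plus:
  fixes D :: "real^'n^'n"
  assumes D: "spec_norm D \<le> 1 / 2"
  shows "invertible (mat 1 + D)" "spec_norm (matrix_inv (mat 1 + D)) \<le> 2"
proof -
  have low: "norm x / 2 \<le> norm ((mat 1 + D) *v x)" for x
  proof -
    have "norm (D *v x) \<le> 1 / 2 * norm x"
      using norm_matrix_vector_le[of D x] mult_right_mono[OF D, of "norm x"] by simp
    moreover have "norm x \<le> norm (x + D *v x) + norm (D *v x)"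
      using norm_triangle_ineq4[of "x + D *v x" "D *v x"] by simp
    ultimately show ?thesis by (simp add: matrix_vector_mult_add_rdistrib)
  qed
  have "x = 0" if "(mat 1 + D) *v x = 0" for x using low[of x] that by simp
  then show inv: "invertible (mat 1 + D)"
    unfolding invertible_left_inverse matrix_left_invertible_ker by blast
  show "spec_norm (matrix_inv (mat 1 + D)) \<le> 2"
  proof (rule spec_norm_le)
    fix x
    show "norm (matrix_inv (mat 1 + D) *v x) \<le> 2 * norm x"
      using low[of "matrix_inv (mat 1 + D) *v x"]
      by (simp add: matrix_vector_mul_assoc matrix_inv_inverse[OF inv])
  qed
qed

lemma diag_mat_mult_vector: "(diag_mat f *v x) $ i = f i * x $ i"
proof -
  have "(diag_mat f *v x) $ i = (\<Sum>j\<in>UNIV. if j = i then f i * x $ i else 0)"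
    unfolding diag_mat_def matrix_vector_mult_def vec_lambda_beta by (intro sum.cong) auto
  then show ?thesis by simp
qed

lemma spec_norm_diag_mat_le:
  assumes "\<And>i. \<bar>f i\<bar> \<le> c" "0 \<le> c"
  shows "spec_norm (diag_mat f) \<le> c"
proof (rule spec_norm_le)
  fix x
  have "norm (diag_mat f *v x) = L2_set (\<lambda>i. norm (f i * x $ i)) UNIV"
    by (simp add: norm_vec_def diag_mat_mult_vector)
  also have "\<dots> \<le> L2_set (\<lambda>i. c * norm (x $ i)) UNIV"
    using assms by (intro L2_set_mono) (auto simp: abs_mult intro: mult_right_mono)
  also have "\<dots> = c * norm x"
    using assms by (simp add: norm_vec_def L2_set_right_distrib)
  finally show "norm (diag_mat f *v x) \<le> c * norm x" .
qed

lemma diag_mat_mult: "diag_mat f ** diag_mat g = diag_mat (\<lambda>i. f i * g i)"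
proof -
  have "(diag_mat f ** diag_mat g) $ i $ j = (\<Sum>k\<in>UNIV. if k = i then (if i = j then f i * g i else 0) else 0)"
    for i j
    unfolding diag_mat_def matrix_matrix_mult_def vec_lambda_beta by (intro sum.cong) auto
  then show ?thesis by (simp add: vec_eq_iff diag_mat_def)
qed

lemma one_plus_diag_mat: "mat 1 + c *\<^sub>R diag_mat f = diag_mat (\<lambda>i. 1 + c * f i)"
  by (simp add: diag_mat_def mat_def vec_eq_iff)

lemma diag_mat_one: "diag_mat (\<lambda>i. 1) = mat 1"
  by (simp add: diag_mat_def mat_def vec_eq_iff)

lemma transpose_diag_mat: "transpose (diag_mat f) = diag_mat f"
  by (simp add: diag_mat_def transpose_def vec_eq_iff)

lemma spec_norm_scaleR: "spec_norm (c *\<^sub>R A) = \<bar>c\<bar> * spec_norm (A :: real^'n^'m)"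
  unfolding spec_norm_def scaleR_matrix_vector_assoc[symmetric]
  by (rule onorm_scaleR[OF matrix_vector_mul_bounded_linear])

lemma spec_norm_add: "spec_norm (A + B) \<le> spec_norm A + spec_norm B"
proof (rule spec_norm_le)
  fix x
  show "norm ((A + B) *v x) \<le> (spec_norm A + spec_norm B) * norm x"
    unfolding matrix_vector_mult_add_rdistrib distrib_right
    by (intro order_trans[OF norm_triangle_ineq] add_mono norm_matrix_vector_le)
qed

lemma spec_norm_mult_le:
  assumes "spec_norm A \<le> a" "spec_norm B \<le> b"
  shows "spec_norm (A ** B) \<le> a * b"
  using assms spec_norm_nonneg[of A] spec_norm_nonneg[of B]
  by (intro order_trans[OF spec_norm_mult] mult_mono) auto

lemma norm_orthonormal_columns:
  fixes Q :: "real^'n^'m"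
  assumes "transpose Q ** Q = mat 1"
  shows "norm (Q *v x) = norm x"
proof -
  have "(Q *v x) \<bullet> (Q *v x) = x \<bullet> ((transpose Q ** Q) *v x)"
    using inner_transpose_matrix_vector[of "Q" "Q *v x" x]
    by (simp add: inner_commute flip: matrix_vector_mul_assoc)
  then show ?thesis using assms by (simp add: norm_eq)
qed

lemma spec_norm_orthonormal_columns:
  fixes Q :: "real^'n^'m"
  assumes "transpose Q ** Q = mat 1"
  shows "spec_norm Q \<le> 1" "spec_norm (transpose Q) \<le> 1"
  using spec_norm_le[of Q 1] norm_orthonormal_columns[OF assms] by (simp_all add: spec_norm_transpose)

text \<open>Column types encode the split of the dimension, and the eigenvalues are not sorted; the
  gap therefore appears as the minimum of \<open>lv\<close> minus the maximum of
  \<open>lu\<close>.\<close>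

locale spectral_split =
  fixes Mbar :: "real^'d^'d" and V :: "real^'k^'d" and U :: "real^'u^'d"
    and lv :: "'k \<Rightarrow> real" and lu :: "'u \<Rightarrow> real"
  assumes dims: "CARD('k) + CARD('u) = CARD('d)"
    and V_orth: "transpose V ** V = mat 1"
    and U_orth: "transpose U ** U = mat 1"
    and VU_orth: "transpose V ** U = 0"
    and V_eig: "Mbar ** V = V ** diag_mat lv"
    and U_eig: "Mbar ** U = U ** diag_mat lu"
    and Mbar_sym: "transpose Mbar = Mbar"
begin

lemma UV_orth: "transpose U ** V = 0"
proof -
  have "transpose (transpose V ** U) = 0" unfolding VU_orth by (simp add: transpose_def vec_eq_iff)
  then show ?thesis by (simp add: matrix_transpose_mul)
qed

text \<open>The defect is an orthogonal projection of trace \<open>d - k - (d - k) = 0\<close>.\<close>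
lemma resolution_of_identity: "V ** transpose V + U ** transpose U = mat 1"
proof -
  define P where "P = mat 1 - V ** transpose V - U ** transpose U"
  have tP: "transpose P = P"
    unfolding P_def
    by (simp add: vec_eq_iff transpose_def matrix_matrix_mult_def mat_def mult.commute)
  have "P ** P = P"
    unfolding P_def using V_orth U_orth VU_orth UV_orth
    by (simp add: matrix_ring_simps matrix_mul_assoc)
      (simp add: V_orth U_orth VU_orth UV_orth flip: matrix_mul_assoc)
  then have "trace (transpose P ** P) = trace P" by (simp add: tP)
  also have "\<dots> = trace (mat 1 :: real^'d^'d) - trace (transpose V ** V) - trace (transpose U ** U)"
    unfolding P_def trace_sub trace_mul_sym[of V "transpose V"] trace_mul_sym[of U "transpose U"] by (rule refl)
  also have "\<dots> = real CARD('d) - real CARD('k) - real CARD('u)"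
    unfolding V_orth U_orth by (simp add: trace_def mat_def)
  also have "\<dots> = 0" using dims by (simp flip: of_nat_add)
  finally have "(\<Sum>i\<in>UNIV. \<Sum>j\<in>UNIV. (P $ j $ i)\<^sup>2) = 0"
    by (simp add: trace_def matrix_matrix_mult_def transpose_def power2_eq_square)
  then have "P $ j $ i = 0" for i j
    by (simp add: sum_nonneg_eq_0_iff sum_nonneg)
  then have "P = 0" by (simp add: vec_eq_iff)
  then show ?thesis unfolding P_def by (simp add: algebra_simps)
qed

lemma VtM: "transpose V ** Mbar = diag_mat lv ** transpose V"
  using arg_cong[OF V_eig, of transpose] by (simp add: matrix_transpose_mul Mbar_sym transpose_diag_mat)

lemma UtM: "transpose U ** Mbar = diag_mat lu ** transpose U"
  using arg_cong[OF U_eig, of transpose] by (simp add: matrix_transpose_mul Mbar_sym transpose_diag_mat)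

lemma eigenvalue_le_spec_norm:
  fixes Q :: "real^'n^'d"
  assumes "transpose Q ** Q = mat 1" "Mbar ** Q = Q ** diag_mat l"
  shows "\<bar>l i\<bar> \<le> spec_norm Mbar"
proof -
  let ?q = "Q *v axis i 1"
  have nq: "norm ?q = 1" using norm_orthonormal_columns[OF assms(1)] by (simp add: norm_axis_1)
  have "diag_mat l *v axis i 1 = l i *\<^sub>R axis i 1"
    by (simp add: vec_eq_iff diag_mat_mult_vector axis_def)
  then have "Mbar *v ?q = Q *v (l i *\<^sub>R axis i 1)"
    by (metis assms(2) matrix_vector_mul_assoc)
  also have "\<dots> = l i *\<^sub>R ?q" by (rule linear_scale[OF matrix_vector_mul_linear])
  finally show ?thesis using norm_matrix_vector_le[of Mbar ?q] nq by simp
qed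

text \<open>\<open>Dv\<close> and \<open>Du\<close> are the blocks of \<open>1 + \<eta> Mbar\<close>
  on the column spans of \<open>V\<close> and \<open>U\<close>; \<open>Di\<close> is the entrywise
  inverse of the diagonal of \<open>Dv\<close>.\<close>

definition "Dv \<eta> = diag_mat (\<lambda>i. 1 + \<eta> * lv i)"
definition "Du \<eta> = diag_mat (\<lambda>j. 1 + \<eta> * lu j)"
definition "Di \<eta> = diag_mat (\<lambda>i. 1 / (1 + \<eta> * lv i))"

definition contraction :: "real \<Rightarrow> real^'k^'u \<Rightarrow> real^'k^'u" where
  "contraction \<eta> W = Du \<eta> ** W ** Di \<eta>"

text \<open>\<open>noise_V\<close>, \<open>noise_U\<close> and \<open>noise\<close> are \<Delta>,
  \<Theta> and \<open>J\<close> of the overview. The argument \<open>R\<close> stands for the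
  normalised iterate \<open>Z ** matrix_inv (transpose V ** Z)\<close>, which equals
  \<open>V + U ** W\<close>.\<close>

definition noise_V :: "real \<Rightarrow> real^'d^'d \<Rightarrow> real^'k^'d \<Rightarrow> real^'k^'k" where
  "noise_V \<eta> E R = \<eta> *\<^sub>R (transpose V ** E ** R ** Di \<eta>)"

definition noise_U :: "real \<Rightarrow> real^'d^'d \<Rightarrow> real^'k^'d \<Rightarrow> real^'k^'u" where
  "noise_U \<eta> E R = \<eta> *\<^sub>R (transpose U ** E ** R ** Di \<eta>)"

definition noise :: "real \<Rightarrow> real^'k^'u \<Rightarrow> real^'k^'d \<Rightarrow> real^'d^'d \<Rightarrow> real^'k^'u" where
  "noise \<eta> H R E = noise_U \<eta> E R - H ** noise_V \<eta> E R"

lemma eigenvalue_bounds: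
  assumes "0 < \<eta>" "\<eta> * spec_norm Mbar \<le> 1 / 2"
  shows "\<bar>\<eta> * lv i\<bar> \<le> 1 / 2" "\<bar>\<eta> * lu j\<bar> \<le> 1 / 2"
proof -
  have *: "\<bar>\<eta> * x\<bar> \<le> 1 / 2" if "\<bar>x\<bar> \<le> spec_norm Mbar" for x
  proof -
    have "\<bar>\<eta> * x\<bar> = \<eta> * \<bar>x\<bar>" using assms by (simp add: abs_mult)
    also have "\<dots> \<le> \<eta> * spec_norm Mbar" using assms that by (intro mult_left_mono) auto
    finally show ?thesis using assms by linarith
  qed
  show "\<bar>\<eta> * lv i\<bar> \<le> 1 / 2" "\<bar>\<eta> * lu j\<bar> \<le> 1 / 2"
    by (rule * eigenvalue_le_spec_norm[OF V_orth V_eig] eigenvalue_le_spec_norm[OF U_orth U_eig])+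
qed

lemma Dv_Di:
  assumes "0 < \<eta>" "\<eta> * spec_norm Mbar \<le> 1 / 2"
  shows "Dv \<eta> ** Di \<eta> = mat 1" "Di \<eta> ** Dv \<eta> = mat 1" "spec_norm (Di \<eta>) \<le> 2"
proof -
  have b: "1 / 2 \<le> 1 + \<eta> * lv i" for i using eigenvalue_bounds(1)[OF assms, of i] by linarith
  have nz: "1 + \<eta> * lv i \<noteq> 0" for i using b[of i] by linarith
  show "Dv \<eta> ** Di \<eta> = mat 1" "Di \<eta> ** Dv \<eta> = mat 1"
    using nz by (simp_all add: Dv_def Di_def diag_mat_mult diag_mat_one)
  show "spec_norm (Di \<eta>) \<le> 2"
    unfolding Di_def
  proof (rule spec_norm_diag_mat_le)
    fix i
    show "\<bar>1 / (1 + \<eta> * lv i)\<bar> \<le> 2" using b[of i] by (simp add: field_simps abs_if)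
  qed simp
qed

text \<open>The ratio defining \<open>W\<close> does not change when \<open>Z\<close> is multiplied
  on the right by an invertible matrix. Normalising by the inverse of
  \<open>transpose V ** Z\<close> and then by \<open>Di\<close> turns the \<open>V\<close> rows of
  the new iterate into \<open>1 + \<Delta>\<close> and its \<open>U\<close> rows into
  \<open>H + \<Theta>\<close>.\<close>

lemma oja_step:
  fixes Z :: "real^'k^'d" and B :: "real^'d^'d"
  assumes \<eta>: "0 < \<eta>" "\<eta> * spec_norm Mbar \<le> 1 / 2"
    and inv: "invertible (transpose V ** Z)"
    and W: "W = transpose U ** Z ** matrix_inv (transpose V ** Z)"
    and R: "R = V + U ** W" and E: "E = B - Mbar"
    and small: "spec_norm (noise_V \<eta> E R) \<le> 1 / 2"
  defines "Z' \<equiv> (mat 1 + \<eta> *\<^sub>R B) ** Z"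
  shows "transpose U ** Z' ** matrix_inv (transpose V ** Z') =
    contraction \<eta> W + noise \<eta> (contraction \<eta> W) R E
     + - (noise \<eta> (contraction \<eta> W) R E ** (noise_V \<eta> E R ** matrix_inv (mat 1 + noise_V \<eta> E R)))"
proof -
  let ?X = "transpose V ** Z" and ?D = "noise_V \<eta> E R" and ?H = "contraction \<eta> W"
  define S where "S = matrix_inv (mat 1 + ?D)"
  note DD = Dv_Di[OF \<eta>]
  have Xinv: "?X ** matrix_inv ?X = mat 1" "matrix_inv ?X ** ?X = mat 1"
    by (rule matrix_inv_inverse[OF inv])+
  have ZR: "Z ** matrix_inv ?X = R"
  proof -
    have "Z ** matrix_inv ?X = (V ** transpose V + U ** transpose U) ** (Z ** matrix_inv ?X)"
      by (simp add: resolution_of_identity)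
    also have "\<dots> = V ** (?X ** matrix_inv ?X) + U ** (transpose U ** Z ** matrix_inv ?X)"
      by (simp add: matrix_add_rdistrib matrix_mul_assoc)
    finally show ?thesis by (simp add: Xinv R W)
  qed
  have VR: "transpose V ** R = mat 1" and UR: "transpose U ** R = W"
    by (simp_all add: R matrix_add_ldistrib matrix_mul_assoc V_orth U_orth VU_orth UV_orth)
  have B: "B = Mbar + E" by (simp add: E)
  have VZ: "transpose V ** Z' ** matrix_inv ?X = Dv \<eta> + \<eta> *\<^sub>R (transpose V ** E ** R)"
  proof -
    have "transpose V ** Z' ** matrix_inv ?X = transpose V ** ((mat 1 + \<eta> *\<^sub>R B) ** (Z ** matrix_inv ?X))"
      by (simp add: Z'_def matrix_mul_assoc)
    also have "\<dots> = transpose V ** R + \<eta> *\<^sub>R (transpose V ** Mbar ** R) + \<eta> *\<^sub>R (transpose V ** E ** R)"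
      unfolding ZR B by (simp add: matrix_ring_simps matrix_mul_assoc scaleR_add_right)
    also have "transpose V ** Mbar ** R = diag_mat lv"
      unfolding VtM by (simp add: VR flip: matrix_mul_assoc)
    finally show ?thesis by (simp add: VR Dv_def one_plus_diag_mat)
  qed
  have UZ: "transpose U ** Z' ** matrix_inv ?X = Du \<eta> ** W + \<eta> *\<^sub>R (transpose U ** E ** R)"
  proof -
    have "transpose U ** Z' ** matrix_inv ?X = transpose U ** ((mat 1 + \<eta> *\<^sub>R B) ** (Z ** matrix_inv ?X))"
      by (simp add: Z'_def matrix_mul_assoc)
    also have "\<dots> = transpose U ** R + \<eta> *\<^sub>R (transpose U ** Mbar ** R) + \<eta> *\<^sub>R (transpose U ** E ** R)"
      unfolding ZR B by (simp add: matrix_ring_simps matrix_mul_assoc scaleR_add_right)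
    also have "transpose U ** Mbar ** R = diag_mat lu ** W"
      unfolding UtM by (simp add: UR flip: matrix_mul_assoc)
    also have "transpose U ** R + \<eta> *\<^sub>R (diag_mat lu ** W) = Du \<eta> ** W"
      unfolding UR Du_def one_plus_diag_mat[symmetric] by (simp add: matrix_ring_simps)
    finally show ?thesis .
  qed
  have V': "transpose V ** Z' ** matrix_inv ?X ** Di \<eta> = mat 1 + ?D"
    unfolding VZ by (simp add: matrix_ring_simps DD noise_V_def)
  have U': "transpose U ** Z' ** matrix_inv ?X ** Di \<eta> = ?H + noise_U \<eta> E R"
    unfolding UZ by (simp add: matrix_ring_simps contraction_def noise_U_def)
  note inv1 = matrix_inv_one_plus(1)[OF small]
  have S: "(mat 1 + ?D) ** S = mat 1" unfolding S_def by (rule matrix_inv_inverse[OF inv1])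
  have "transpose V ** Z' ** (matrix_inv ?X ** Di \<eta> ** S) = mat 1"
    using V' S by (simp add: matrix_mul_assoc)
  then have "matrix_inv (transpose V ** Z') = matrix_inv ?X ** Di \<eta> ** S" by (rule matrix_inv_unique)
  then have "transpose U ** Z' ** matrix_inv (transpose V ** Z') = (?H + noise_U \<eta> E R) ** S"
    using U' by (simp add: matrix_mul_assoc)
  also have "\<dots> = ?H ** ((mat 1 + ?D) ** S) + noise \<eta> ?H R E ** S"
    by (simp add: noise_def matrix_ring_simps matrix_mul_assoc)
  also have eq: "noise \<eta> ?H R E ** S = noise \<eta> ?H R E ** ((mat 1 + ?D) ** S) - noise \<eta> ?H R E ** (?D ** S)"
    by (simp add: matrix_add_rdistrib matrix_add_ldistrib)
  also have "?H ** ((mat 1 + ?D) ** S) + (noise \<eta> ?H R E ** ((mat 1 + ?D) ** S) - noise \<eta> ?H R E ** (?D ** S))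
     = ?H + noise \<eta> ?H R E ** ((mat 1 + ?D) ** S) - noise \<eta> ?H R E ** (?D ** S)"
    unfolding S by simp
  finally show ?thesis unfolding S by (simp add: S_def)
qed

end

context spectral_split
begin

lemma eta_gap_le_one:
  assumes "0 < \<eta>" "\<eta> * spec_norm Mbar \<le> 1 / 2"
  shows "\<eta> * (Min (range lv) - Max (range lu)) \<le> 1"
proof -
  have "Min (range lv) \<in> range lv" "Max (range lu) \<in> range lu"
    by (intro Min_in Max_in; simp)+
  then obtain i j where ij: "Min (range lv) = lv i" "Max (range lu) = lu j" by blast
  show ?thesis
    unfolding ij right_diff_distrib using eigenvalue_bounds(1)[OF assms, of i] eigenvalue_bounds(2)[OF assms, of j]
    by linarith
qed

text \<open>The factor is at most \<open>a / b\<close> with \<open>a = b - \<eta> * \<rho>\<close>.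
  Since \<open>\<eta> * spec_norm Mbar\<close> is at most 1/2, \<open>b\<close> is at most 3/2,
  whence \<open>1 - \<eta> * \<rho> / b \<le> 1 - 2 / 3 * (\<eta> * \<rho>)\<close>.\<close>

lemma spow_contraction_le:
  assumes p: "2 \<le> p" and \<eta>: "0 < \<eta>" "\<eta> * spec_norm Mbar \<le> 1 / 2"
    and \<rho>: "\<rho> = Min (range lv) - Max (range lu)" "0 < \<rho>"
  shows "spow p (contraction \<eta> W) \<le> (1 - 2 / 3 * (\<eta> * \<rho>)) powr p * spow p W"
proof -
  define a where "a = 1 + \<eta> * Max (range lu)"
  define b where "b = 1 + \<eta> * Min (range lv)"
  have "Min (range lv) \<in> range lv" "Max (range lu) \<in> range lu"
    by (intro Min_in Max_in; simp)+
  then obtain i0 j0 where ij: "Min (range lv) = lv i0" "Max (range lu) = lu j0" by blast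
  have ab: "1 / 2 \<le> a" "1 / 2 \<le> b" "b \<le> 3 / 2" "a = b - \<eta> * \<rho>"
    unfolding a_def b_def \<rho> ij using eigenvalue_bounds(1)[OF \<eta>, of i0] eigenvalue_bounds(2)[OF \<eta>, of j0]
    by (simp_all add: algebra_simps)
  have "spec_norm (Du \<eta>) \<le> a"
    unfolding Du_def
  proof (rule spec_norm_diag_mat_le)
    fix j
    have "\<eta> * lu j \<le> \<eta> * Max (range lu)" using \<eta> by (intro mult_left_mono Max_ge) auto
    then show "\<bar>1 + \<eta> * lu j\<bar> \<le> a"
      using eigenvalue_bounds(2)[OF \<eta>, of j] unfolding a_def by linarith
  qed (use ab in simp)
  moreover have "spec_norm (Di \<eta>) \<le> 1 / b"
    unfolding Di_def
  proof (rule spec_norm_diag_mat_le)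
    fix i
    have "\<eta> * Min (range lv) \<le> \<eta> * lv i" using \<eta> by (intro mult_left_mono Min_le) auto
    then have "b \<le> 1 + \<eta> * lv i" unfolding b_def by linarith
    moreover from this have "0 < 1 + \<eta> * lv i" using ab by linarith
    ultimately show "\<bar>1 / (1 + \<eta> * lv i)\<bar> \<le> 1 / b" using ab by (simp add: frac_le)
  qed (use ab in simp)
  moreover have "spow p (contraction \<eta> W) \<le> spec_norm (Du \<eta>) powr p * spow p W * spec_norm (Di \<eta>) powr p"
    unfolding contraction_def
    by (intro order_trans[OF spow_mult_right[OF p]] mult_right_mono spow_mult_left[OF p]) simp
  moreover have "spec_norm (Du \<eta>) powr p * spow p W * spec_norm (Di \<eta>) powr p \<le> a powr p * spow p W * (1 / b) powr p"
    using p ab calculation(1,2)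
    by (intro mult_mono powr_mono2 mult_nonneg_nonneg) (auto simp: spec_norm_nonneg schatten_powr_nonneg)
  ultimately have "spow p (contraction \<eta> W) \<le> (a * (1 / b)) powr p * spow p W"
    using ab by (simp add: powr_mult powr_divide mult_ac)
  also have "\<dots> \<le> (1 - 2 / 3 * (\<eta> * \<rho>)) powr p * spow p W"
  proof (intro mult_right_mono powr_mono2)
    have "\<eta> * \<rho> * 2 / 3 \<le> \<eta> * \<rho> / b"
      using ab \<eta> \<rho>(2) divide_left_mono[of b "3/2" "\<eta> * \<rho>"] by simp
    then show "a * (1 / b) \<le> 1 - 2 / 3 * (\<eta> * \<rho>)" using ab by (simp add: diff_divide_distrib)
  qed (use p ab in \<open>auto simp: schatten_powr_nonneg\<close>)
  finally show ?thesis .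
qed

text \<open>This bound is the origin of \<epsilon>: the \<open>V\<close> part of \<open>R\<close>
  contributes \<open>m\<close>, condition (CR) gives \<open>m * \<gamma>\<close> for the
  \<open>U ** W\<close> part, and \<open>Di\<close> contributes the factor 2.\<close>

lemma spec_norm_noise_V_le:
  assumes \<eta>: "0 < \<eta>" "\<eta> * spec_norm Mbar \<le> 1 / 2"
    and E: "spec_norm E \<le> m" "spec_norm (transpose V ** E ** U ** W) \<le> m * \<gamma>"
  shows "spec_norm (noise_V \<eta> E (V + U ** W)) \<le> 2 * \<eta> * m * (1 + \<gamma>)"
proof -
  have "spec_norm (transpose V ** E ** V) \<le> 1 * m * 1"
    by (intro spec_norm_mult_le spec_norm_orthonormal_columns V_orth E)
  then have "spec_norm (transpose V ** E ** (V + U ** W)) \<le> m + m * \<gamma>"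
    unfolding matrix_add_ldistrib matrix_mul_assoc
    by (intro order_trans[OF spec_norm_add] add_mono E) auto
  then have "spec_norm (transpose V ** E ** (V + U ** W) ** Di \<eta>) \<le> (m + m * \<gamma>) * 2"
    by (intro spec_norm_mult_le Dv_Di[OF \<eta>])
  then have "\<eta> * spec_norm (transpose V ** E ** (V + U ** W) ** Di \<eta>) \<le> \<eta> * ((m + m * \<gamma>) * 2)"
    using \<eta> by (intro mult_left_mono) auto
  then show ?thesis
    using \<eta> by (simp add: noise_V_def spec_norm_scaleR algebra_simps)
qed

lemma spec_norm_noise_U_V_le:
  assumes \<eta>: "0 < \<eta>" "\<eta> * spec_norm Mbar \<le> 1 / 2" and E: "spec_norm E \<le> m"
  shows "spec_norm (noise_U \<eta> E V) \<le> 2 * \<eta> * m"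
proof -
  have "spec_norm (transpose U ** E ** V ** Di \<eta>) \<le> 1 * m * 1 * 2"
    by (intro spec_norm_mult_le spec_norm_orthonormal_columns V_orth U_orth E Dv_Di[OF \<eta>])
  then have "\<eta> * spec_norm (transpose U ** E ** V ** Di \<eta>) \<le> \<eta> * (1 * m * 1 * 2)"
    using \<eta> by (intro mult_left_mono) auto
  then show ?thesis
    using \<eta> by (simp add: noise_U_def spec_norm_scaleR algebra_simps)
qed

text \<open>Condition (CR) controls only the \<open>V\<close> rows of the noise. In the
  \<open>U\<close> rows the contribution of \<open>U ** W\<close> is estimated relative to the size
  of \<open>W\<close>; this feeds the term in the theorem that sums earlier norms.\<close>

lemma spow_noise_U_U_le:
  assumes p: "2 \<le> p" and \<eta>: "0 < \<eta>" "\<eta> * spec_norm Mbar \<le> 1 / 2" and E: "spec_norm E \<le> m"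
  shows "spow p (noise_U \<eta> E (U ** W)) \<le> (2 * \<eta> * m) powr p * spow p W"
proof -
  have m: "0 \<le> m" using spec_norm_nonneg[of E] E by linarith
  have UEU: "spec_norm (transpose U ** E ** U) \<le> 1 * m * 1"
    by (intro spec_norm_mult_le spec_norm_orthonormal_columns U_orth E)
  have "spow p (transpose U ** E ** U ** W ** Di \<eta>)
      \<le> spec_norm (transpose U ** E ** U) powr p * spow p W * spec_norm (Di \<eta>) powr p"
    by (intro order_trans[OF spow_mult_right[OF p]] mult_right_mono spow_mult_left[OF p]) simp
  also have "\<dots> \<le> m powr p * spow p W * 2 powr p"
    using p m UEU Dv_Di(3)[OF \<eta>]
    by (intro mult_mono powr_mono2 mult_nonneg_nonneg) (auto simp: spec_norm_nonneg schatten_powr_nonneg)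
  finally have "\<eta> powr p * spow p (transpose U ** E ** U ** W ** Di \<eta>) \<le> \<eta> powr p * (m powr p * spow p W * 2 powr p)"
    by (intro mult_left_mono) auto
  then show ?thesis
    using \<eta> m by (simp add: noise_U_def matrix_mul_assoc spow_scaleR[OF p] powr_mult mult_ac)
qed

end

text \<open>Converts Assumption 2 into a bound on the full spectral norm. Rotating \<open>V\<close>
  by an orthogonal matrix makes any unit vector \<open>x\<close> a column of some admissible
  \<open>Q\<close>, and then \<open>transpose E *v x\<close> is a column of the transpose of
  \<open>transpose Q ** E\<close>.\<close>

lemma spec_norm_le_of_orthonormal_rows:
  fixes V :: "real^'k^'d" and E :: "real^'d^'d"
  assumes V: "transpose V ** V = mat 1"
    and b: "\<And>Q :: real^'k^'d. transpose Q ** Q = mat 1 \<Longrightarrow> spec_norm (transpose Q ** E) \<le> m"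
  shows "spec_norm E \<le> m"
proof -
  have unit: "norm (transpose E *v x) \<le> m" if x: "norm x = 1" for x
  proof -
    let ?e = "axis undefined 1 :: real^'k"
    let ?a = "axis undefined 1 :: real^'d"
    have "norm (V *v ?e) = 1" using norm_orthonormal_columns[OF V] by (simp add: norm_axis_1)
    then obtain A B where AB: "orthogonal_matrix A" "A *v ?a = V *v ?e"
       "orthogonal_matrix B" "B *v ?a = x"
      using x by (metis orthogonal_matrix_exists_basis)
    define Q where "Q = B ** transpose A ** V"
    have "transpose Q ** Q = transpose V ** (A ** (transpose B ** B) ** transpose A) ** V"
      by (simp add: Q_def matrix_transpose_mul matrix_mul_assoc)
    also have "\<dots> = mat 1"
      using AB V by (simp add: orthogonal_matrix_def)
    finally have Q: "transpose Q ** Q = mat 1" .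
    have "Q *v ?e = B *v (transpose A *v (A *v ?a))"
      by (simp add: Q_def AB(2) flip: matrix_vector_mul_assoc)
    also have "transpose A *v (A *v ?a) = ?a"
      using AB(1) by (simp add: matrix_vector_mul_assoc orthogonal_matrix_def)
    also note AB(4)
    finally have "transpose E *v x = transpose (transpose Q ** E) *v ?e"
      by (simp add: matrix_transpose_mul flip: matrix_vector_mul_assoc)
    then have "norm (transpose E *v x) \<le> spec_norm (transpose (transpose Q ** E)) * norm ?e"
      using norm_matrix_vector_le by metis
    then show ?thesis using b[OF Q] by (simp add: spec_norm_transpose norm_axis_1)
  qed
  have "spec_norm (transpose E) \<le> m"
  proof (rule spec_norm_le)
    fix x
    show "norm (transpose E *v x) \<le> m * norm x"
    proof (cases "x = 0")
      case True then show ?thesis by simp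
    next
      case False
      have "transpose E *v x = norm x *\<^sub>R (transpose E *v (x /\<^sub>R norm x))"
        using False by (simp add: linear_scale[OF matrix_vector_mul_linear])
      then show ?thesis
        using unit[of "x /\<^sub>R norm x"] False by (simp add: mult.commute mult_left_mono)
    qed
  qed
  then show ?thesis by (simp add: spec_norm_transpose)
qed

section \<open>Measurable matrix functions and centring by independence\<close>

lemma borel_measurable_matrixI:
  fixes X :: "'a \<Rightarrow> real^'n^'m"
  assumes "\<And>i j. (\<lambda>\<omega>. X \<omega> $ i $ j) \<in> borel_measurable M"
  shows "X \<in> borel_measurable M"
  unfolding borel_measurable_euclidean_space[of X]
proof
  fix b :: "real^'n^'m" assume "b \<in> Basis"
  then obtain i j where "b = axis i (axis j 1)" by (auto simp: Basis_vec_def)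
  then show "(\<lambda>x. X x \<bullet> b) \<in> borel_measurable M" using assms by (simp add: inner_axis)
qed

lemma borel_measurable_matrix_mult [measurable (raw)]:
  fixes X :: "'a \<Rightarrow> real^'n^'m" and Y :: "'a \<Rightarrow> real^'l^'n"
  assumes "X \<in> borel_measurable M" "Y \<in> borel_measurable M"
  shows "(\<lambda>\<omega>. X \<omega> ** Y \<omega>) \<in> borel_measurable M"
  unfolding matrix_matrix_mult_def
  by (rule borel_measurable_matrixI)
    (simp, intro borel_measurable_sum borel_measurable_times borel_measurable_matrix_component assms)

text \<open>Cramer's rule on invertible matrices. On singular ones the predicate inside the choice
  is identically false, so \<open>matrix_inv\<close> takes one fixed value there, whose entry is
  \<open>c0\<close>.\<close>

lemma borel_measurable_matrix_inv [measurable (raw)]: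
  fixes X :: "'a \<Rightarrow> real^'n^'n"
  assumes X: "X \<in> borel_measurable M"
  shows "(\<lambda>\<omega>. matrix_inv (X \<omega>)) \<in> borel_measurable M"
proof (rule borel_measurable_matrixI)
  fix i j
  define C where "C Y = (\<chi> a b. if b = i then axis j 1 $ a else Y $ a $ b)" for Y :: "real^'n^'n"
  define c0 where "c0 = (SOME A' :: real^'n^'n. False) $ i $ j"
  have eq: "matrix_inv Y $ i $ j = (if det Y = 0 then c0 else det (C Y) / det Y)" for Y :: "real^'n^'n"
  proof (cases "det Y = 0")
    case True
    then have "\<not> invertible Y" by (simp add: invertible_det_nz)
    then have "(\<lambda>A'. Y ** A' = mat 1 \<and> A' ** Y = mat 1) = (\<lambda>A'. False)"
      by (auto simp: invertible_def)
    then show ?thesis using True by (simp add: matrix_inv_def c0_def)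
  next
    case False
    then have inv: "invertible Y" by (simp add: invertible_det_nz)
    have "Y *v column j (matrix_inv Y) = axis j 1"
    proof -
      have "Y *v column j (matrix_inv Y) = column j (Y ** matrix_inv Y)"
        by (simp add: vec_eq_iff column_def matrix_matrix_mult_def matrix_vector_mult_def)
      then show ?thesis by (simp add: matrix_inv_inverse[OF inv] vec_eq_iff column_def mat_def axis_def)
    qed
    then have "column j (matrix_inv Y) = (\<chi> k. det (\<chi> a b. if b = k then axis j 1 $ a else Y $ a $ b) / det Y)"
      using cramer[OF False] by blast
    then have "column j (matrix_inv Y) $ i = det (C Y) / det Y" by (simp add: C_def)
    then show ?thesis using False by (simp add: column_def)
  qed
  have det_meas: "(\<lambda>\<omega>. det (Y \<omega>)) \<in> borel_measurable M" if "Y \<in> borel_measurable M" for Y :: "'a \<Rightarrow> real^'n^'n"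
    unfolding det_def
    by (intro borel_measurable_sum borel_measurable_times borel_measurable_const borel_measurable_prod
        borel_measurable_matrix_component that)
  have C_meas: "(\<lambda>\<omega>. C (X \<omega>)) \<in> borel_measurable M"
  proof (rule borel_measurable_matrixI)
    fix a b
    show "(\<lambda>\<omega>. C (X \<omega>) $ a $ b) \<in> borel_measurable M"
      using borel_measurable_matrix_component[OF X] by (cases "b = i") (simp_all add: C_def)
  qed
  show "(\<lambda>\<omega>. matrix_inv (X \<omega>) $ i $ j) \<in> borel_measurable M"
    unfolding eq using det_meas[OF X] det_meas[OF C_meas] by measurable
qed

lemma Int_stable_vimage_sets: "Int_stable {f -` A \<inter> S | A. A \<in> sets N}"
proof (rule Int_stableI)
  fix B C assume "B \<in> {f -` A \<inter> S | A. A \<in> sets N}" "C \<in> {f -` A \<inter> S | A. A \<in> sets N}"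
  then obtain B' C' where "B = f -` B' \<inter> S" "C = f -` C' \<inter> S" "B' \<in> sets N" "C' \<in> sets N" by blast
  then have "B \<inter> C = f -` (B' \<inter> C') \<inter> S" "B' \<inter> C' \<in> sets N" by auto
  then show "B \<inter> C \<in> {f -` A \<inter> S | A. A \<in> sets N}" by blast
qed

text \<open>Only the whole sum is assumed integrable, not its terms, so independence cannot be
  applied termwise at once. All coefficients are truncated simultaneously on the events
  \<open>T n\<close>, which belong to the past \<open>F\<close>; there each term has mean zero, and
  dominated convergence with the absolute value of the whole sum removes the truncation.\<close>

lemma (in prob_space) expectation_indep_linear_zero:
  fixes F :: "'a measure" and X :: "'a \<Rightarrow> 'b::topological_space"
    and c :: "'i \<Rightarrow> 'a \<Rightarrow> real" and f :: "'i \<Rightarrow> 'b \<Rightarrow> real"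
  assumes I: "finite I"
    and F: "space F = space M" "sets F \<subseteq> sets M"
    and X: "X \<in> borel_measurable M"
    and ind: "indep_set (sets F) (rv_sets M X)"
    and c: "\<And>i. i \<in> I \<Longrightarrow> c i \<in> borel_measurable F"
    and f: "\<And>i. i \<in> I \<Longrightarrow> f i \<in> borel_measurable borel"
    and fi: "\<And>i. i \<in> I \<Longrightarrow> integrable M (\<lambda>\<omega>. f i (X \<omega>))"
    and f0: "\<And>i. i \<in> I \<Longrightarrow> expectation (\<lambda>\<omega>. f i (X \<omega>)) = 0"
    and S: "integrable M (\<lambda>\<omega>. \<Sum>i\<in>I. c i \<omega> * f i (X \<omega>))"
  shows "expectation (\<lambda>\<omega>. \<Sum>i\<in>I. c i \<omega> * f i (X \<omega>)) = 0"
proof -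
  have FM: "h \<in> borel_measurable M" if "h \<in> borel_measurable F" for h :: "'a \<Rightarrow> real"
    using measurable_mono[of borel borel F M] F that by auto
  let ?S = "\<lambda>\<omega>. \<Sum>i\<in>I. c i \<omega> * f i (X \<omega>)"
  define T where "T n = {\<omega> \<in> space F. \<forall>i\<in>I. \<bar>c i \<omega>\<bar> \<le> real n}" for n :: nat
  have T: "T n \<in> sets F" for n
    unfolding T_def using c I by measurable
  have zero: "expectation (\<lambda>\<omega>. (indicator (T n) \<omega> * c i \<omega>) * f i (X \<omega>)) = 0" if i: "i \<in> I" for n i
  proof -
    let ?g = "\<lambda>\<omega>. indicator (T n) \<omega> * c i \<omega> :: real"
    have gF: "?g \<in> borel_measurable F" using T c[OF i] by measurable
    have "integrable M ?g"
    proof (rule integrable_const_bound[of _ "real n"])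
      show "AE \<omega> in M. norm (?g \<omega>) \<le> real n" using i by (auto simp: T_def indicator_def)
    qed (rule FM[OF gF])
    moreover have "indep_var borel ?g borel (\<lambda>\<omega>. f i (X \<omega>))"
      unfolding indep_var_eq
    proof (intro conjI)
      show "random_variable borel ?g" by (rule FM[OF gF])
      show rX: "random_variable borel (\<lambda>\<omega>. f i (X \<omega>))" using X f[OF i] by measurable
      have 1: "{?g -` A \<inter> space M |A. A \<in> sets borel} \<subseteq> sets F"
        using measurable_sets[OF gF] F(1) by auto
      have 2: "{(\<lambda>\<omega>. f i (X \<omega>)) -` A \<inter> space M |A. A \<in> sets borel} \<subseteq> rv_sets M X"
      proof clarify
        fix A :: "real set" assume A: "A \<in> sets borel"
        have "f i -` A \<in> sets borel" using measurable_sets[OF f[OF i] A] by simp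
        moreover have "(\<lambda>\<omega>. f i (X \<omega>)) -` A \<inter> space M = X -` (f i -` A) \<inter> space M" by auto
        ultimately show "(\<lambda>\<omega>. f i (X \<omega>)) -` A \<inter> space M \<in> rv_sets M X"
          unfolding rv_sets_def by blast
      qed
      have "indep_set {?g -` A \<inter> space M |A. A \<in> sets borel}
          {(\<lambda>\<omega>. f i (X \<omega>)) -` A \<inter> space M |A. A \<in> sets borel}"
        using ind 1 2 unfolding indep_set_def
        by (elim indep_sets_mono_sets) (auto split: bool.split)
      then show "indep_set (sigma_sets (space M) {?g -` A \<inter> space M |A. A \<in> sets borel})
          (sigma_sets (space M) {(\<lambda>\<omega>. f i (X \<omega>)) -` A \<inter> space M |A. A \<in> sets borel})"
        by (rule indep_set_sigma_sets) (rule Int_stable_vimage_sets)+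
    qed
    ultimately have "expectation (\<lambda>\<omega>. ?g \<omega> * f i (X \<omega>)) = expectation ?g * expectation (\<lambda>\<omega>. f i (X \<omega>))"
      using fi[OF i] by (intro indep_var_lebesgue_integral)
    then show ?thesis using f0[OF i] by simp
  qed
  have int: "integrable M (\<lambda>\<omega>. (indicator (T n) \<omega> * c i \<omega>) * f i (X \<omega>))" if i: "i \<in> I" for n i
  proof (rule Bochner_Integration.integrable_bound)
    show "integrable M (\<lambda>\<omega>. real n * f i (X \<omega>))" using fi[OF i] by simp
    have "(\<lambda>\<omega>. indicator (T n) \<omega> * c i \<omega> :: real) \<in> borel_measurable F" using T c[OF i] by measurable
    then show "(\<lambda>\<omega>. (indicator (T n) \<omega> * c i \<omega>) * f i (X \<omega>)) \<in> borel_measurable M"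
      by (rule borel_measurable_times[OF FM borel_measurable_integrable[OF fi[OF i]]])
    show "AE \<omega> in M. norm (indicator (T n) \<omega> * c i \<omega> * f i (X \<omega>)) \<le> norm (real n * f i (X \<omega>))"
      using i by (auto simp: T_def indicator_def abs_mult intro!: mult_right_mono)
  qed
  have "(\<lambda>n. expectation (\<lambda>\<omega>. indicator (T n) \<omega> * ?S \<omega>)) \<longlonglongrightarrow> expectation ?S"
  proof (rule integral_dominated_convergence[where w = "\<lambda>\<omega>. \<bar>?S \<omega>\<bar>"])
    show Sm: "?S \<in> borel_measurable M" using S by auto
    show "integrable M (\<lambda>\<omega>. \<bar>?S \<omega>\<bar>)" using S by auto
    show "(\<lambda>\<omega>. indicator (T n) \<omega> * ?S \<omega>) \<in> borel_measurable M" for n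
      using T[of n] F Sm by (intro borel_measurable_times borel_measurable_indicator) auto
    show "AE \<omega> in M. norm (indicator (T n) \<omega> * ?S \<omega>) \<le> \<bar>?S \<omega>\<bar>" for n
      by (auto simp: indicator_def)
    show "AE \<omega> in M. (\<lambda>n. indicator (T n) \<omega> * ?S \<omega>) \<longlonglongrightarrow> ?S \<omega>"
    proof (rule AE_I2)
      fix \<omega> assume \<omega>: "\<omega> \<in> space M"
      obtain N :: nat where N: "(\<Sum>i\<in>I. \<bar>c i \<omega>\<bar>) \<le> real N" using real_arch_simple by blast
      have "\<omega> \<in> T n" if n: "N \<le> n" for n
      proof -
        have "\<bar>c i \<omega>\<bar> \<le> real n" if "i \<in> I" for i
          using member_le_sum[of i I "\<lambda>i. \<bar>c i \<omega>\<bar>"] I that N n by fastforce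
        then show ?thesis using \<omega> F by (simp add: T_def)
      qed
      then have "\<forall>\<^sub>F n in sequentially. indicator (T n) \<omega> * ?S \<omega> = ?S \<omega>"
        unfolding eventually_sequentially by (intro exI[of _ N]) simp
      then show "(\<lambda>n. indicator (T n) \<omega> * ?S \<omega>) \<longlonglongrightarrow> ?S \<omega>" by (rule tendsto_eventually)
    qed
  qed
  moreover have "expectation (\<lambda>\<omega>. indicator (T n) \<omega> * ?S \<omega>) = 0" for n
  proof -
    have "expectation (\<lambda>\<omega>. indicator (T n) \<omega> * ?S \<omega>)
        = expectation (\<lambda>\<omega>. \<Sum>i\<in>I. (indicator (T n) \<omega> * c i \<omega>) * f i (X \<omega>))"
      by (simp add: sum_distrib_left mult.assoc)
    also have "\<dots> = (\<Sum>i\<in>I. expectation (\<lambda>\<omega>. (indicator (T n) \<omega> * c i \<omega>) * f i (X \<omega>)))"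
      using int by (rule Bochner_Integration.integral_sum)
    finally show ?thesis using zero by simp
  qed
  ultimately show ?thesis by (simp add: LIMSEQ_const_iff)
qed

subsection \<open>One step in mean\<close>

text \<open>Here \<open>a\<close> bounds the norm of \<open>W\<close>, \<kappa> is
  \<open>k powr (1 / p)\<close>, \<open>r\<close> the contraction factor and \<open>j\<close> the
  size of the noise increment; the summand \<open>2 * \<epsilon> * j\<close> accounts for the last
  term of the update.\<close>

lemma oja_constants:
  fixes p r a \<kappa> \<epsilon> :: real
  assumes p: "2 \<le> p" and \<epsilon>: "0 \<le> \<epsilon>" "\<epsilon> \<le> 1 / 2" and a: "0 \<le> a" and \<kappa>: "0 \<le> \<kappa>"
    and r: "0 \<le> r" "r \<le> 1"
  defines "j \<equiv> \<epsilon> / 2 * \<kappa> + (\<epsilon> / 2 * a + \<epsilon> * a)"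
  shows "(sqrt ((r * a)\<^sup>2 + 4 * (p - 1) * j\<^sup>2) + 2 * \<epsilon> * j)\<^sup>2
    \<le> (r\<^sup>2 + 20 * p * \<epsilon>\<^sup>2) * a\<^sup>2 + 5 * p * \<kappa>\<^sup>2 * \<epsilon>\<^sup>2"
proof -
  define s where "s = sqrt (p - 1)"
  define q where "q = sqrt ((r * a)\<^sup>2 + 4 * (p - 1) * j\<^sup>2)"
  have s: "0 \<le> s" "s\<^sup>2 = p - 1" using p by (auto simp: s_def)
  have j: "j = \<epsilon> / 2 * (\<kappa> + 3 * a)" "0 \<le> j"
    using \<epsilon> a \<kappa> by (auto simp: j_def algebra_simps)
  have q2: "q\<^sup>2 = (r * a)\<^sup>2 + 4 * s\<^sup>2 * j\<^sup>2" using p by (simp add: q_def s)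
  have qle: "q \<le> r * a + 2 * s * j"
  proof -
    have "0 \<le> r * a * (s * j)" using r a s(1) j(2) by auto
    then have "(r * a)\<^sup>2 + 4 * (p - 1) * j\<^sup>2 \<le> (r * a + 2 * s * j)\<^sup>2"
      unfolding s(2)[symmetric] by (simp add: power2_eq_square algebra_simps)
    then show ?thesis
      unfolding q_def using r a s(1) j(2) by (intro real_le_lsqrt) auto
  qed
  have q0: "0 \<le> q" using p by (simp add: q_def)
  have "(q + 2 * \<epsilon> * j)\<^sup>2 = q\<^sup>2 + 4 * (\<epsilon> * j) * q + (2 * \<epsilon>)\<^sup>2 * j\<^sup>2"
    by (simp add: power2_eq_square algebra_simps)
  also have "q\<^sup>2 + 4 * (\<epsilon> * j) * q + (2 * \<epsilon>)\<^sup>2 * j\<^sup>2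
      \<le> q\<^sup>2 + 4 * (\<epsilon> * j) * (r * a + 2 * s * j) + 1\<^sup>2 * j\<^sup>2"
    using \<epsilon> j(2) qle q0 by (intro add_mono mult_left_mono mult_right_mono power_mono) auto
  also have "\<dots> = (r * a)\<^sup>2 + 4 * (\<epsilon> * j) * (r * a) + (4 * s\<^sup>2 + (2 * \<epsilon>) * (4 * s) + 1) * j\<^sup>2"
    unfolding q2 by (simp add: power2_eq_square algebra_simps)
  \<comment> \<open>With \<open>2 * \<epsilon>\<close> at most 1 and \<open>p\<close> equal to
    \<open>s\<^sup>2 + 1\<close>, the slack in the last coefficient is at least
    \<open>(s - 2)\<^sup>2\<close>.\<close>
  also have "\<dots> \<le> (r * a)\<^sup>2 + 4 * (\<epsilon> * j) * a + (5 * p) * j\<^sup>2"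
  proof (intro add_mono mult_left_mono mult_right_mono order_refl)
    show "r * a \<le> a" using r a by (simp add: mult_left_le_one_le)
    have "(2 * \<epsilon>) * (4 * s) \<le> 1 * (4 * s)" using \<epsilon> s by (intro mult_right_mono) auto
    moreover have "0 \<le> (s - 2)\<^sup>2" by simp
    moreover have "p = s\<^sup>2 + 1" using s by simp
    ultimately show "4 * s\<^sup>2 + (2 * \<epsilon>) * (4 * s) + 1 \<le> 5 * p"
      by (simp add: power2_eq_square algebra_simps)
  qed (use \<epsilon> j(2) in auto)
  also have "4 * (\<epsilon> * j) * a = 2 * (\<epsilon>\<^sup>2 * ((\<kappa> + 3 * a) * a))"
    by (simp add: j power2_eq_square algebra_simps)
  also have "(r * a)\<^sup>2 + 2 * (\<epsilon>\<^sup>2 * ((\<kappa> + 3 * a) * a)) + (5 * p) * j\<^sup>2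
     \<le> (r * a)\<^sup>2 + p * (\<epsilon>\<^sup>2 * ((\<kappa> + 3 * a) * a)) + (5 * p) * j\<^sup>2"
    using p a \<kappa> by (intro add_mono mult_right_mono) auto
  also have "\<dots> = (r * a)\<^sup>2 + (p * \<epsilon>\<^sup>2) * ((\<kappa> + 3 * a) * a + 5 / 4 * (\<kappa> + 3 * a)\<^sup>2)"
    by (simp add: j power2_eq_square algebra_simps)
  also have "\<dots> \<le> (r * a)\<^sup>2 + (p * \<epsilon>\<^sup>2) * (5 * \<kappa>\<^sup>2 + 20 * a\<^sup>2)"
  proof (intro add_left_mono mult_left_mono)
    \<comment> \<open>Completing the square in \<kappa> shows that 5 and 20 dominate the quadratic
      form, cross term included.\<close>
    have "5 * \<kappa>\<^sup>2 + 20 * a\<^sup>2 - ((\<kappa> + 3 * a) * a + 5 / 4 * (\<kappa> + 3 * a)\<^sup>2)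
        = 15 / 4 * (\<kappa> - 17 / 15 * a)\<^sup>2 + 14 / 15 * a\<^sup>2"
      by (simp add: power2_eq_square field_simps)
    also have "\<dots> \<ge> 0" by simp
    finally show "(\<kappa> + 3 * a) * a + 5 / 4 * (\<kappa> + 3 * a)\<^sup>2 \<le> 5 * \<kappa>\<^sup>2 + 20 * a\<^sup>2" by simp
  qed (use p in simp)
  also have "\<dots> = (r\<^sup>2 + 20 * p * \<epsilon>\<^sup>2) * a\<^sup>2 + 5 * p * \<kappa>\<^sup>2 * \<epsilon>\<^sup>2"
    by (simp add: power2_eq_square algebra_simps)
  finally show ?thesis unfolding q_def .
qed

text \<open>The comparison function \<open>f\<close> is kept general because the pieces of a step
  are compared with a constant, with the power of \<open>W0\<close>, or with that of
  \<open>J\<close>.\<close>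

lemma spow_integral_dominated:
  fixes X :: "'a \<Rightarrow> real^'n^'m"
  assumes p: "2 \<le> p" and X: "X \<in> borel_measurable M"
    and f: "integrable M f" "(\<integral>\<omega>. f \<omega> \<partial>M) \<le> a powr p"
    and le: "AE \<omega> in M. spow p (X \<omega>) \<le> c powr p * f \<omega>" and ca: "0 \<le> c" "0 \<le> a"
  shows "integrable M (\<lambda>\<omega>. spow p (X \<omega>))" "(\<integral>\<omega>. spow p (X \<omega>) \<partial>M) \<le> (c * a) powr p"
proof -
  have i: "integrable M (\<lambda>\<omega>. c powr p * f \<omega>)" using f by simp
  show int: "integrable M (\<lambda>\<omega>. spow p (X \<omega>))"
  proof (rule Bochner_Integration.integrable_bound[OF i borel_measurable_spow[OF p X]])
    show "AE \<omega> in M. norm (spow p (X \<omega>)) \<le> norm (c powr p * f \<omega>)"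
      using le by eventually_elim (simp add: schatten_powr_nonneg)
  qed
  have "(\<integral>\<omega>. spow p (X \<omega>) \<partial>M) \<le> (\<integral>\<omega>. c powr p * f \<omega> \<partial>M)"
    by (rule integral_mono_AE[OF int i le])
  also have "\<dots> = c powr p * (\<integral>\<omega>. f \<omega> \<partial>M)" using f by simp
  also have "\<dots> \<le> c powr p * a powr p" using f by (intro mult_left_mono) auto
  finally show "(\<integral>\<omega>. spow p (X \<omega>) \<partial>M) \<le> (c * a) powr p" using ca by (simp add: powr_mult)
qed

lemma spec_norm_zero [simp]: "spec_norm (0 :: real^'n^'m) = 0"
  using spec_norm_le[of "0 :: real^'n^'m" 0] spec_norm_nonneg[of "0 :: real^'n^'m"] by simp

lemma spow_minus: "2 \<le> p \<Longrightarrow> spow p (- X :: real^'n^'m) = spow p X"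
  using spow_scaleR[of p "-1" X] by simp

lemma borel_measurable_larger:
  assumes "space F = space M" "sets F \<subseteq> sets M" "h \<in> borel_measurable F"
  shows "h \<in> borel_measurable M"
  using measurable_mono[of borel borel F M] assms by auto

context spectral_split
begin

lemma linear_noise: "linear (noise \<eta> H R)"
  by (rule linearI)
    (simp_all add: noise_def noise_U_def noise_V_def matrix_ring_simps scaleR_add_right
      scaleR_diff_right mult.commute)

text \<open>In \<open>noise_U\<close> the two parts of \<open>R\<close> obey different kinds of
  bounds and must be separated; in \<open>noise_V\<close> the sum stays whole, since its spectral
  norm is bounded as a whole.\<close>

lemma noise_split:
  "noise \<eta> H (R + R') E = noise_U \<eta> E R + (noise_U \<eta> E R' + - (H ** noise_V \<eta> E (R + R')))"
  by (simp add: noise_def noise_U_def matrix_ring_simps scaleR_add_right)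

lemma borel_measurable_contraction:
  assumes [measurable]: "W \<in> borel_measurable M"
  shows "(\<lambda>\<omega>. contraction \<eta> (W \<omega>)) \<in> borel_measurable M"
  unfolding contraction_def
  by (intro borel_measurable_matrix_mult borel_measurable_const assms)

lemma borel_measurable_noise_U:
  assumes "E \<in> borel_measurable M" "R \<in> borel_measurable M"
  shows "(\<lambda>\<omega>. noise_U \<eta> (E \<omega>) (R \<omega>)) \<in> borel_measurable M"
  unfolding noise_U_def
  by (intro borel_measurable_scaleR borel_measurable_matrix_mult borel_measurable_const assms)

lemma borel_measurable_noise_V:
  assumes "E \<in> borel_measurable M" "R \<in> borel_measurable M"
  shows "(\<lambda>\<omega>. noise_V \<eta> (E \<omega>) (R \<omega>)) \<in> borel_measurable M"
  unfolding noise_V_def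
  by (intro borel_measurable_scaleR borel_measurable_matrix_mult borel_measurable_const assms)

lemma borel_measurable_noise:
  assumes "E \<in> borel_measurable M" "R \<in> borel_measurable M" "H \<in> borel_measurable M"
  shows "(\<lambda>\<omega>. noise \<eta> (H \<omega>) (R \<omega>) (E \<omega>)) \<in> borel_measurable M"
  unfolding noise_def
  by (intro borel_measurable_diff borel_measurable_noise_U borel_measurable_matrix_mult
      borel_measurable_noise_V assms)

text \<open>Given the past, the gradient at \<open>H\<close> applied to the noise is a linear form
  in \<open>A - Mbar\<close>. Its coefficients are measurable in \<open>F\<close>, while the entries
  of \<open>A - Mbar\<close> are centred and independent of \<open>F\<close>.\<close>

lemma expectation_grad_noise_zero:
  assumes P: "prob_space P" and p: "2 \<le> p"
    and F: "space F = space P" "sets F \<subseteq> sets P"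
    and H: "H \<in> borel_measurable F" and R: "R \<in> borel_measurable F"
    and A: "A \<in> borel_measurable P" "prob_space.indep_set P (sets F) (rv_sets P A)"
      "integrable P A" "prob_space.expectation P A = Mbar"
    and int: "integrable P (\<lambda>\<omega>. spow p (H \<omega>))"
      "integrable P (\<lambda>\<omega>. spow p (noise \<eta> (H \<omega>) (R \<omega>) (A \<omega> - Mbar)))"
  shows "(\<integral>\<omega>. spow_grad p (H \<omega>) (noise \<eta> (H \<omega>) (R \<omega>) (A \<omega> - Mbar)) \<partial>P) = 0"
proof -
  interpret prob_space P by (rule P)
  note FP = borel_measurable_larger[OF F]
  let ?J = "\<lambda>\<omega>. noise \<eta> (H \<omega>) (R \<omega>) (A \<omega> - Mbar)"
  define c where "c = (\<lambda>(i, j) \<omega>. spow_grad p (H \<omega>) (noise \<eta> (H \<omega>) (R \<omega>) (axis i (axis j 1))))"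
  define f where "f = (\<lambda>(i, j) B. (B - Mbar) $ i $ j)"
  have lin: "linear (\<lambda>E. spow_grad p (H \<omega>) (noise \<eta> (H \<omega>) (R \<omega>) E))" for \<omega>
    using linear_compose[OF linear_noise linear_spow_grad] by (simp add: o_def)
  have eq: "spow_grad p (H \<omega>) (?J \<omega>) = (\<Sum>ij\<in>UNIV. c ij \<omega> * f ij (A \<omega>))" for \<omega>
  proof -
    have "spow_grad p (H \<omega>) (?J \<omega>) = (\<Sum>i\<in>UNIV. \<Sum>j\<in>UNIV. c (i, j) \<omega> * f (i, j) (A \<omega>))"
      unfolding linear_matrix_expand[OF lin[of \<omega>], of "A \<omega> - Mbar"] by (simp add: c_def f_def mult.commute)
    then show ?thesis by (simp add: sum.cartesian_product case_prod_unfold)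
  qed
  have Jm: "?J \<in> borel_measurable P"
    using A(1) FP[OF H] FP[OF R]
    by (intro borel_measurable_noise borel_measurable_diff borel_measurable_const)
  have "expectation (\<lambda>\<omega>. \<Sum>ij\<in>UNIV. c ij \<omega> * f ij (A \<omega>)) = 0"
  proof (rule expectation_indep_linear_zero[OF _ F A(1,2)])
    show "c ij \<in> borel_measurable F" for ij
      unfolding c_def case_prod_unfold
      by (intro borel_measurable_spow_grad_pair[OF p] borel_measurable_noise borel_measurable_const H R)
    show "f ij \<in> borel_measurable borel" for ij
      unfolding f_def case_prod_unfold
      by (intro borel_measurable_matrix_component borel_measurable_diff borel_measurable_const measurable_ident_sets[OF refl])
    have bl: "bounded_linear (\<lambda>B :: real^'d^'d. B $ i $ j)" for i j
      using bounded_linear_compose[OF bounded_linear_vec_nth bounded_linear_vec_nth] .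
    have iA: "integrable P (\<lambda>\<omega>. A \<omega> $ i $ j)" "(\<integral>\<omega>. A \<omega> $ i $ j \<partial>P) = Mbar $ i $ j" for i j
      using integrable_bounded_linear[OF bl A(3)] integral_bounded_linear[OF bl A(3)] A(4) by auto
    show "integrable P (\<lambda>\<omega>. f ij (A \<omega>))" for ij
      using iA by (simp add: f_def case_prod_unfold)
    show "expectation (\<lambda>\<omega>. f ij (A \<omega>)) = 0" for ij
      using iA by (simp add: f_def case_prod_unfold prob_space)
    show "integrable P (\<lambda>\<omega>. \<Sum>ij\<in>UNIV. c ij \<omega> * f ij (A \<omega>))"
      unfolding eq[symmetric]
    proof (rule Bochner_Integration.integrable_bound)
      show "integrable P (\<lambda>\<omega>. 2 powr p * (2 * spow p (H \<omega>) + spow p (?J \<omega>)))" using int by auto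
      show "(\<lambda>\<omega>. spow_grad p (H \<omega>) (?J \<omega>)) \<in> borel_measurable P"
        by (rule borel_measurable_spow_grad_pair[OF p FP[OF H] Jm])
      show "AE \<omega> in P. norm (spow_grad p (H \<omega>) (?J \<omega>)) \<le> norm (2 powr p * (2 * spow p (H \<omega>) + spow p (?J \<omega>)))"
        unfolding real_norm_def
        by (intro always_eventually allI order_trans[OF abs_spow_grad_le[OF p] abs_ge_self])
    qed
  qed simp
  then show ?thesis by (simp only: eq)
qed

lemma AE_spec_norm_noise_V:
  assumes \<eta>: "0 < \<eta>" "\<eta> * spec_norm Mbar \<le> 1 / 2"
    and m: "0 < m" "1 \<le> \<gamma>" "\<epsilon> = 2 * \<eta> * m * (1 + \<gamma>)"
    and g: "\<And>\<omega>. \<omega> \<notin> g \<Longrightarrow> W \<omega> = 0"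
    and E: "AE \<omega> in P. spec_norm (A \<omega> - Mbar) \<le> m"
      "AE \<omega> in P. spec_norm (transpose V ** (A \<omega> - Mbar) ** U ** W \<omega>) \<le> m * \<gamma>"
  shows "AE \<omega> in P. spec_norm (noise_V \<eta> (A \<omega> - Mbar) ((if \<omega> \<in> g then V else 0) + U ** W \<omega>)) \<le> \<epsilon>"
  using E
proof eventually_elim
  case (elim \<omega>)
  show ?case
  proof (cases "\<omega> \<in> g")
    case True
    then show ?thesis using spec_norm_noise_V_le[OF \<eta> elim] m by simp
  next
    case False
    then have "noise_V \<eta> (A \<omega> - Mbar) ((if \<omega> \<in> g then V else 0) + U ** W \<omega>) = 0"
      using g by (simp add: noise_V_def)
    moreover have "0 \<le> \<epsilon>" using m \<eta> by simp
    ultimately show ?thesis by simp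
  qed
qed

text \<open>All hypotheses on \<open>W0\<close> are in terms of the past \<open>F\<close>; only
  \<open>A\<close> is new. \<open>W1\<close> is the right side of the exact update, with
  \<open>V\<close> replaced by 0 outside \<open>g\<close>.\<close>

lemma oja_step_integral:
  fixes W0 :: "'b \<Rightarrow> real^'k^'u" and A :: "'b \<Rightarrow> real^'d^'d"
  assumes P: "prob_space P" and p: "2 \<le> p"
    and \<eta>: "0 < \<eta>" "\<eta> * spec_norm Mbar \<le> 1 / 2"
    and \<rho>: "\<rho> = Min (range lv) - Max (range lu)" "0 < \<rho>"
    and m: "0 < m" "1 \<le> \<gamma>" "\<epsilon> = 2 * \<eta> * m * (1 + \<gamma>)" "\<epsilon> \<le> 1 / 2"
    and F: "space F = space P" "sets F \<subseteq> sets P"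
    and W0: "W0 \<in> borel_measurable F" and g: "g \<in> sets F" "\<And>\<omega>. \<omega> \<notin> g \<Longrightarrow> W0 \<omega> = 0"
    and A: "A \<in> borel_measurable P" "prob_space.indep_set P (sets F) (rv_sets P A)"
      "integrable P A" "prob_space.expectation P A = Mbar"
    and E: "AE \<omega> in P. spec_norm (A \<omega> - Mbar) \<le> m"
      "AE \<omega> in P. spec_norm (transpose V ** (A \<omega> - Mbar) ** U ** W0 \<omega>) \<le> m * \<gamma>"
    and int: "integrable P (\<lambda>\<omega>. spow p (W0 \<omega>))" "(\<integral>\<omega>. spow p (W0 \<omega>) \<partial>P) \<le> a powr p" "0 < a"
  defines "R \<equiv> \<lambda>\<omega>. (if \<omega> \<in> g then V else 0) + U ** W0 \<omega>"
  defines "D \<equiv> \<lambda>\<omega>. noise_V \<eta> (A \<omega> - Mbar) (R \<omega>)"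
  defines "J \<equiv> \<lambda>\<omega>. noise \<eta> (contraction \<eta> (W0 \<omega>)) (R \<omega>) (A \<omega> - Mbar)"
  defines "W1 \<equiv> \<lambda>\<omega>. contraction \<eta> (W0 \<omega>) + J \<omega> + - (J \<omega> ** (D \<omega> ** matrix_inv (mat 1 + D \<omega>)))"
  shows "integrable P (\<lambda>\<omega>. spow p (W1 \<omega>))"
    and "(\<integral>\<omega>. spow p (W1 \<omega>) \<partial>P) \<le> (((1 - 2 / 3 * (\<eta> * \<rho>))\<^sup>2 + 20 * p * \<epsilon>\<^sup>2) * a\<^sup>2
      + 5 * p * real CARD('k) powr (2 / p) * \<epsilon>\<^sup>2) powr (p / 2)"
proof -
  interpret prob_space P by (rule P)
  note FP = borel_measurable_larger[OF F]
  define H where "H = (\<lambda>\<omega>. contraction \<eta> (W0 \<omega>))"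
  define r where "r = 1 - 2 / 3 * (\<eta> * \<rho>)"
  define \<kappa> where "\<kappa> = real CARD('k) powr (1 / p)"
  have x: "0 < \<eta> * \<rho>" "\<eta> * \<rho> \<le> 1" using eta_gap_le_one[OF \<eta>] \<eta> \<rho> by auto
  have r: "0 < r" "r \<le> 1" using x by (auto simp: r_def)
  have \<epsilon>0: "0 < \<epsilon>" using m \<eta> by simp
  have \<kappa>: "0 < \<kappa>" "\<kappa> powr p = real CARD('k)" "\<kappa>\<^sup>2 = real CARD('k) powr (2 / p)"
    using p by (auto simp: \<kappa>_def powr_powr power2_eq_square simp flip: powr_add)
  \<comment> \<open>Since \<gamma> is at least 1, \<open>1 + \<gamma>\<close> is at least 2; hence
    the bound for the \<open>U\<close> rows is only half of \<epsilon>.\<close>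
  have half: "2 * \<eta> * m \<le> \<epsilon> / 2"
  proof -
    have "2 * \<eta> * m * 2 \<le> 2 * \<eta> * m * (1 + \<gamma>)" using m \<eta> by (intro mult_left_mono) auto
    then show ?thesis using m by simp
  qed
  have Rm: "R \<in> borel_measurable F" and R0m: "(\<lambda>\<omega>. if \<omega> \<in> g then V else 0) \<in> borel_measurable F"
  proof -
    show *: "(\<lambda>\<omega>. if \<omega> \<in> g then V else 0) \<in> borel_measurable F"
      using g(1) by (intro measurable_If_set borel_measurable_const) auto
    show "R \<in> borel_measurable F"
      unfolding R_def by (intro borel_measurable_add * borel_measurable_matrix_mult borel_measurable_const W0)
  qed
  have Hm: "H \<in> borel_measurable F" unfolding H_def by (rule borel_measurable_contraction[OF W0])
  let ?E = "\<lambda>\<omega>. A \<omega> - Mbar"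
  have Em: "?E \<in> borel_measurable P" using A(1) by simp
  have Dm: "D \<in> borel_measurable P" unfolding D_def by (rule borel_measurable_noise_V[OF Em FP[OF Rm]])
  have Jm: "J \<in> borel_measurable P" unfolding J_def
    by (rule borel_measurable_noise[OF Em FP[OF Rm] FP[OF Hm, unfolded H_def]])
  have De: "AE \<omega> in P. spec_norm (D \<omega>) \<le> \<epsilon>"
    unfolding D_def R_def by (rule AE_spec_norm_noise_V[OF \<eta> m(1-3) g(2) E])
  have SH: "spow p (H \<omega>) \<le> r powr p * spow p (W0 \<omega>)" for \<omega>
    unfolding H_def r_def by (rule spow_contraction_le[OF p \<eta> \<rho>])
  note H_int = spow_integral_dominated[OF p FP[OF Hm] int(1,2) always_eventually[OF allI[OF SH]]]
  have H1: "integrable P (\<lambda>\<omega>. spow p (H \<omega>))" "(\<integral>\<omega>. spow p (H \<omega>) \<partial>P) \<le> (r * a) powr p"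
    using H_int r int by auto
  \<comment> \<open>Three pieces of \<open>J\<close>: a bounded one of size
    \<open>\<epsilon> / 2 * \<kappa>\<close>, and two relative to \<open>W0\<close> of sizes
    \<open>\<epsilon> / 2 * a\<close> and \<open>\<epsilon> * a\<close>. Their sum is
    \<open>j\<close>.\<close>
  define X1 where "X1 = (\<lambda>\<omega>. noise_U \<eta> (?E \<omega>) (if \<omega> \<in> g then V else 0))"
  define X2 where "X2 = (\<lambda>\<omega>. noise_U \<eta> (?E \<omega>) (U ** W0 \<omega>))"
  define X3 where "X3 = (\<lambda>\<omega>. - (H \<omega> ** D \<omega>))"
  have J: "J \<omega> = X1 \<omega> + (X2 \<omega> + X3 \<omega>)" for \<omega>
    unfolding J_def X1_def X2_def X3_def R_def D_def H_def by (rule noise_split)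
  have Xm: "X1 \<in> borel_measurable P" "X2 \<in> borel_measurable P" "X3 \<in> borel_measurable P"
    unfolding X1_def X2_def X3_def
    by (intro borel_measurable_noise_U[OF Em FP] R0m borel_measurable_matrix_mult borel_measurable_const W0
        borel_measurable_uminus FP[OF Hm] Dm)+
  have X1b: "AE \<omega> in P. spow p (X1 \<omega>) \<le> (\<epsilon> / 2) powr p * (\<kappa> powr p)"
    using E(1)
  proof eventually_elim
    case (elim \<omega>)
    have "spec_norm (X1 \<omega>) \<le> \<epsilon> / 2"
    proof (cases "\<omega> \<in> g")
      case True
      then show ?thesis using order_trans[OF spec_norm_noise_U_V_le[OF \<eta> elim] half] by (simp add: X1_def)
    next
      case False
      then show ?thesis using \<epsilon>0 by (simp add: X1_def noise_U_def)
    qed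
    then have "spec_norm (X1 \<omega>) powr p \<le> (\<epsilon> / 2) powr p"
      using p by (intro powr_mono2) (auto simp: spec_norm_nonneg)
    then have "real CARD('k) * spec_norm (X1 \<omega>) powr p \<le> real CARD('k) * (\<epsilon> / 2) powr p"
      by (intro mult_left_mono) auto
    then have "spow p (X1 \<omega>) \<le> real CARD('k) * (\<epsilon> / 2) powr p"
      by (rule order_trans[OF spow_le_card_spec_norm[OF p]])
    then show ?case by (simp add: \<kappa>(2) mult.commute)
  qed
  have X1i: "integrable P (\<lambda>\<omega>. spow p (X1 \<omega>))" "(\<integral>\<omega>. spow p (X1 \<omega>) \<partial>P) \<le> (\<epsilon> / 2 * \<kappa>) powr p"
    using spow_integral_dominated[OF p Xm(1) _ _ X1b, of \<kappa>] \<epsilon>0 \<kappa>(1) by (auto simp: prob_space)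
  have X2b: "AE \<omega> in P. spow p (X2 \<omega>) \<le> (\<epsilon> / 2) powr p * spow p (W0 \<omega>)"
    using E(1)
  proof eventually_elim
    case (elim \<omega>)
    have "(2 * \<eta> * m) powr p \<le> (\<epsilon> / 2) powr p" using half m \<eta> p by (intro powr_mono2) auto
    then have "(2 * \<eta> * m) powr p * spow p (W0 \<omega>) \<le> (\<epsilon> / 2) powr p * spow p (W0 \<omega>)"
      by (intro mult_right_mono) (auto simp: schatten_powr_nonneg)
    then show ?case using spow_noise_U_U_le[OF p \<eta> elim, of "W0 \<omega>"] by (simp add: X2_def)
  qed
  have X2i: "integrable P (\<lambda>\<omega>. spow p (X2 \<omega>))" "(\<integral>\<omega>. spow p (X2 \<omega>) \<partial>P) \<le> (\<epsilon> / 2 * a) powr p"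
    using spow_integral_dominated[OF p Xm(2) int(1,2) X2b] \<epsilon>0 int(3) by auto
  have X3b: "AE \<omega> in P. spow p (X3 \<omega>) \<le> \<epsilon> powr p * spow p (W0 \<omega>)"
    using De
  proof eventually_elim
    case (elim \<omega>)
    have "spow p (H \<omega> ** D \<omega>) \<le> spow p (H \<omega>) * spec_norm (D \<omega>) powr p" by (rule spow_mult_right[OF p])
    also have "\<dots> \<le> (1 powr p * spow p (W0 \<omega>)) * \<epsilon> powr p"
    proof (intro mult_mono powr_mono2 elim)
      have "r powr p \<le> 1 powr p" using r p by (intro powr_mono2) auto
      then have "r powr p * spow p (W0 \<omega>) \<le> 1 powr p * spow p (W0 \<omega>)"
        by (intro mult_right_mono) (auto simp: schatten_powr_nonneg)
      then show "spow p (H \<omega>) \<le> 1 powr p * spow p (W0 \<omega>)" using SH[of \<omega>] by linarith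
    qed (use p in \<open>auto simp: schatten_powr_nonneg spec_norm_nonneg\<close>)
    finally show ?case by (simp add: X3_def spow_minus[OF p] mult.commute)
  qed
  have X3i: "integrable P (\<lambda>\<omega>. spow p (X3 \<omega>))" "(\<integral>\<omega>. spow p (X3 \<omega>) \<partial>P) \<le> (\<epsilon> * a) powr p"
    using spow_integral_dominated[OF p Xm(3) int(1,2) X3b] \<epsilon>0 int(3) by auto
  define j where "j = \<epsilon> / 2 * \<kappa> + (\<epsilon> / 2 * a + \<epsilon> * a)"
  have pos: "0 < \<epsilon> / 2 * \<kappa>" "0 < \<epsilon> / 2 * a" "0 < \<epsilon> * a" "0 < \<epsilon> / 2 * a + \<epsilon> * a" "0 < j" "0 < r * a"
    using \<epsilon>0 \<kappa>(1) int(3) r by (auto simp: j_def add_pos_pos)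
  note X23 = spow_add_integral[OF p pos(2,3) Xm(2,3) X2i(1) X3i(1) X2i(2) X3i(2)]
  note X123 = spow_add_integral[OF p pos(1,4) Xm(1) borel_measurable_add[OF Xm(2,3)] X1i(1) X23(1) X1i(2) X23(2)]
  have Ji: "integrable P (\<lambda>\<omega>. spow p (J \<omega>))" "(\<integral>\<omega>. spow p (J \<omega>) \<partial>P) \<le> j powr p"
    using X123 by (simp_all add: J j_def)
  have zero: "(\<integral>\<omega>. spow_grad p (H \<omega>) (J \<omega>) \<partial>P) = 0"
    using expectation_grad_noise_zero[OF P p F Hm Rm A H1(1), of \<eta>] Ji(1) by (simp add: J_def H_def)
  let ?b = "sqrt ((r * a)\<^sup>2 + 4 * (p - 1) * j\<^sup>2)"
  have HJ: "(\<integral>\<omega>. spow p (H \<omega> + J \<omega>) \<partial>P) \<le> ?b powr p"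
    by (rule spow_smooth_integral[OF p pos(6,5) FP[OF Hm] Jm H1(1) Ji(1) H1(2) Ji(2) zero])
  have HJi: "integrable P (\<lambda>\<omega>. spow p (H \<omega> + J \<omega>))"
    by (rule spow_add_integral(1)[OF p pos(6,5) FP[OF Hm] Jm H1(1) Ji(1) H1(2) Ji(2)])
  define Y where "Y = (\<lambda>\<omega>. - (J \<omega> ** (D \<omega> ** matrix_inv (mat 1 + D \<omega>))))"
  have Ym: "Y \<in> borel_measurable P"
    unfolding Y_def by (intro borel_measurable_uminus borel_measurable_matrix_mult borel_measurable_matrix_inv
        borel_measurable_add borel_measurable_const Jm Dm)
  have Yb: "AE \<omega> in P. spow p (Y \<omega>) \<le> (2 * \<epsilon>) powr p * spow p (J \<omega>)"
    using De
  proof eventually_elim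
    case (elim \<omega>)
    have "spec_norm (matrix_inv (mat 1 + D \<omega>)) \<le> 2" using elim m by (intro matrix_inv_one_plus) auto
    then have "spec_norm (D \<omega> ** matrix_inv (mat 1 + D \<omega>)) \<le> \<epsilon> * 2"
      by (intro spec_norm_mult_le elim)
    then have "spec_norm (D \<omega> ** matrix_inv (mat 1 + D \<omega>)) powr p \<le> (\<epsilon> * 2) powr p"
      using p by (intro powr_mono2) (auto simp: spec_norm_nonneg)
    then have "spow p (J \<omega>) * spec_norm (D \<omega> ** matrix_inv (mat 1 + D \<omega>)) powr p \<le> spow p (J \<omega>) * (\<epsilon> * 2) powr p"
      by (intro mult_left_mono) (auto simp: schatten_powr_nonneg)
    then show ?case
      using spow_mult_right[OF p, of "J \<omega>" "D \<omega> ** matrix_inv (mat 1 + D \<omega>)"]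
      by (simp add: Y_def spow_minus[OF p] mult.commute)
  qed
  have Yi: "integrable P (\<lambda>\<omega>. spow p (Y \<omega>))" "(\<integral>\<omega>. spow p (Y \<omega>) \<partial>P) \<le> (2 * \<epsilon> * j) powr p"
    using spow_integral_dominated[OF p Ym Ji Yb] \<epsilon>0 pos by auto
  have "0 < (r * a)\<^sup>2 + 4 * (p - 1) * j\<^sup>2" using pos p by (intro add_pos_nonneg) auto
  then have b0: "0 < ?b" by simp
  have e0: "0 < 2 * \<epsilon> * j" using \<epsilon>0 pos by simp
  note fin = spow_add_integral[OF p b0 e0 borel_measurable_add[OF FP[OF Hm] Jm] Ym HJi Yi(1) HJ Yi(2)]
  have W1: "W1 \<omega> = H \<omega> + J \<omega> + Y \<omega>" for \<omega> by (simp add: W1_def H_def Y_def)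
  show "integrable P (\<lambda>\<omega>. spow p (W1 \<omega>))" using fin(1) by (simp add: W1)
  have "(\<integral>\<omega>. spow p (W1 \<omega>) \<partial>P) \<le> (?b + 2 * \<epsilon> * j) powr p" using fin(2) by (simp add: W1)
  also have "\<dots> = ((?b + 2 * \<epsilon> * j)\<^sup>2) powr (p / 2)"
  proof -
    have "((?b + 2 * \<epsilon> * j)\<^sup>2) powr (p / 2) = ((?b + 2 * \<epsilon> * j) powr 2) powr (p / 2)"
      using b0 e0 by (subst powr_numeral) auto
    then show ?thesis by (simp only: powr_powr) simp
  qed
  also have "\<dots> \<le> ((r\<^sup>2 + 20 * p * \<epsilon>\<^sup>2) * a\<^sup>2 + 5 * p * \<kappa>\<^sup>2 * \<epsilon>\<^sup>2) powr (p / 2)"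
    unfolding j_def using p \<epsilon>0 m \<kappa>(1) int(3) r
    by (intro powr_mono2 oja_constants) auto
  finally show "(\<integral>\<omega>. spow p (W1 \<omega>) \<partial>P) \<le> (((1 - 2 / 3 * (\<eta> * \<rho>))\<^sup>2 + 20 * p * \<epsilon>\<^sup>2) * a\<^sup>2
      + 5 * p * real CARD('k) powr (2 / p) * \<epsilon>\<^sup>2) powr (p / 2)"
    by (simp add: r_def \<kappa>(3))
qed

end

subsection \<open>Unrolling the recursion\<close>

lemma ennpow_mono: "x \<le> y \<Longrightarrow> 0 \<le> a \<Longrightarrow> ennpow x a \<le> ennpow y a"
  unfolding ennpow_def
  by (auto simp: top_unique less_top intro!: ennreal_leI powr_mono2 enn2real_mono)

lemma pp_norm_sq_spow:
  fixes X :: "'a \<Rightarrow> real^'n^'m"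
  assumes "2 \<le> p"
  shows "pp_norm_sq P p X = ennpow (\<integral>\<^sup>+ \<omega>. ennreal (spow p (X \<omega>)) \<partial>P) (2 / p)"
  unfolding pp_norm_sq_def by (simp only: schatten_powr_spow[OF assms])

lemma pp_norm_sq_integrable:
  fixes X :: "'a \<Rightarrow> real^'n^'m"
  assumes p: "2 \<le> p" and i: "integrable P (\<lambda>\<omega>. spow p (X \<omega>))"
  shows "pp_norm_sq P p X = ennreal ((\<integral>\<omega>. spow p (X \<omega>) \<partial>P) powr (2 / p))"
proof -
  have "(\<integral>\<^sup>+ \<omega>. ennreal (spow p (X \<omega>)) \<partial>P) = ennreal (\<integral>\<omega>. spow p (X \<omega>) \<partial>P)"
    using i by (intro nn_integral_eq_integral) (auto simp: schatten_powr_nonneg)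
  moreover have "0 \<le> (\<integral>\<omega>. spow p (X \<omega>) \<partial>P)" by (intro integral_nonneg_AE) (simp add: schatten_powr_nonneg)
  ultimately show ?thesis by (simp add: pp_norm_sq_spow[OF p] ennpow_def)
qed

lemma pp_norm_sq_not_integrable:
  fixes X :: "'a \<Rightarrow> real^'n^'m"
  assumes p: "2 \<le> p" and X: "X \<in> borel_measurable P" and i: "\<not> integrable P (\<lambda>\<omega>. spow p (X \<omega>))"
  shows "pp_norm_sq P p X = top"
proof -
  have "\<not> (\<integral>\<^sup>+ \<omega>. ennreal (norm (spow p (X \<omega>))) \<partial>P) < \<infinity>"
    using i borel_measurable_spow[OF p X] unfolding integrable_iff_bounded by blast
  then have "\<not> (\<integral>\<^sup>+ \<omega>. ennreal (spow p (X \<omega>)) \<partial>P) < top"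
    by (simp add: schatten_powr_nonneg)
  then have "(\<integral>\<^sup>+ \<omega>. ennreal (spow p (X \<omega>)) \<partial>P) = top"
    using less_top by blast
  then show ?thesis by (simp add: pp_norm_sq_spow[OF p] ennpow_def)
qed

lemma pp_norm_sq_mono:
  fixes X Y :: "'a \<Rightarrow> real^'n^'m"
  assumes p: "2 \<le> p" and le: "\<And>\<omega>. X \<omega> = Y \<omega> \<or> X \<omega> = 0"
  shows "pp_norm_sq P p X \<le> pp_norm_sq P p Y"
  unfolding pp_norm_sq_spow[OF p]
proof (intro ennpow_mono nn_integral_mono ennreal_leI)
  fix \<omega>
  show "spow p (X \<omega>) \<le> spow p (Y \<omega>)"
    using le[of \<omega>] p by (auto simp: schatten_powr_nonneg)
qed (use p in simp)

lemma pp_norm_sq_cong_AE: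
  fixes X Y :: "'a \<Rightarrow> real^'n^'m"
  assumes p: "2 \<le> p" and eq: "AE \<omega> in P. X \<omega> = Y \<omega>"
  shows "pp_norm_sq P p X = pp_norm_sq P p Y"
proof -
  have "(\<integral>\<^sup>+ \<omega>. ennreal (spow p (X \<omega>)) \<partial>P) = (\<integral>\<^sup>+ \<omega>. ennreal (spow p (Y \<omega>)) \<partial>P)"
    by (intro nn_integral_cong_AE) (use eq in \<open>eventually_elim, simp\<close>)
  then show ?thesis by (simp only: pp_norm_sq_spow[OF p])
qed

text \<open>Passes from positive scales to the exact norm. The choice of \<open>a\<close> with
  square \<open>I powr (2 / p) + \<delta>\<close> is positive even if the moment \<open>I\<close>
  vanishes, and \<delta> tends to 0 at the end. If the moment of \<open>X\<close> is infinite,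
  \<open>0 < C\<close> makes the right side infinite.\<close>

lemma pp_norm_sq_step:
  fixes X :: "'a \<Rightarrow> real^'n^'m" and Y :: "'a \<Rightarrow> real^'n^'m"
  assumes p: "2 \<le> p" and X: "X \<in> borel_measurable P" and C: "0 < C" "0 \<le> D"
    and step: "\<And>a. integrable P (\<lambda>\<omega>. spow p (X \<omega>)) \<Longrightarrow> (\<integral>\<omega>. spow p (X \<omega>) \<partial>P) \<le> a powr p \<Longrightarrow> 0 < a \<Longrightarrow>
      integrable P (\<lambda>\<omega>. spow p (Y \<omega>)) \<and> (\<integral>\<omega>. spow p (Y \<omega>) \<partial>P) \<le> (C * a\<^sup>2 + D) powr (p / 2)"
  shows "pp_norm_sq P p Y \<le> ennreal C * pp_norm_sq P p X + ennreal D"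
proof (cases "integrable P (\<lambda>\<omega>. spow p (X \<omega>))")
  case False
  then show ?thesis
    using C by (simp add: pp_norm_sq_not_integrable[OF p X] ennreal_mult_top)
next
  case True
  define I where "I = (\<integral>\<omega>. spow p (X \<omega>) \<partial>P)"
  define K where "K = (\<integral>\<omega>. spow p (Y \<omega>) \<partial>P)"
  have I0: "0 \<le> I" and K0: "0 \<le> K"
    unfolding I_def K_def by (intro integral_nonneg_AE; simp add: schatten_powr_nonneg)+
  have le: "integrable P (\<lambda>\<omega>. spow p (Y \<omega>)) \<and> K powr (2 / p) \<le> C * (I powr (2 / p) + \<delta>) + D"
    if \<delta>: "0 < \<delta>" for \<delta>
  proof -
    define a where "a = sqrt (I powr (2 / p) + \<delta>)"
    have a: "0 < a" "a\<^sup>2 = I powr (2 / p) + \<delta>" using \<delta> by (auto simp: a_def add_nonneg_pos)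
    have "I = (I powr (2 / p)) powr (p / 2)" using p I0 by (simp add: powr_powr)
    also have "\<dots> \<le> (I powr (2 / p) + \<delta>) powr (p / 2)" using p \<delta> by (intro powr_mono2) auto
    also have "\<dots> = a powr p" using a(1) by (simp add: a(2)[symmetric] powr_powr flip: powr_numeral)
    finally have "integrable P (\<lambda>\<omega>. spow p (Y \<omega>)) \<and> K \<le> (C * a\<^sup>2 + D) powr (p / 2)"
      using step[OF True _ a(1)] by (simp add: I_def K_def)
    moreover from this have "K powr (2 / p) \<le> ((C * a\<^sup>2 + D) powr (p / 2)) powr (2 / p)"
      using p K0 by (intro powr_mono2) auto
    moreover have "((C * a\<^sup>2 + D) powr (p / 2)) powr (2 / p) = C * a\<^sup>2 + D"
    proof -
      have "0 \<le> C * a\<^sup>2 + D" using C by simp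
      then show ?thesis using p by (simp add: powr_powr)
    qed
    ultimately show ?thesis by (simp add: a(2))
  qed
  have iY: "integrable P (\<lambda>\<omega>. spow p (Y \<omega>))" using le[of 1] by simp
  have "K powr (2 / p) \<le> C * I powr (2 / p) + D"
  proof (rule field_le_epsilon)
    fix e :: real assume "0 < e"
    then show "K powr (2 / p) \<le> C * I powr (2 / p) + D + e"
      using le[of "e / C"] C by (simp add: distrib_left)
  qed
  then show ?thesis
    using C by (simp add: pp_norm_sq_integrable[OF p True] pp_norm_sq_integrable[OF p iY]
        I_def[symmetric] K_def[symmetric] ennreal_leI flip: ennreal_mult ennreal_plus)
qed

text \<open>The decay hypotheses absorb the contracted coefficient of the previous index into the
  current one. Thus all accumulated terms carry the last coefficients \<open>K n\<close> and
  \<open>D n\<close>, which is why the theorem involves only the final \<epsilon>.\<close>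

lemma ennreal_contraction_recursion:
  fixes a b :: "nat \<Rightarrow> ennreal" and x K D :: "nat \<Rightarrow> real"
  assumes nonneg: "\<And>n. 0 \<le> K n" "\<And>n. 0 \<le> D n"
    and ab: "\<And>n. a n \<le> b n"
    and step: "\<And>n. n \<in> {1..t} \<Longrightarrow> b n \<le> ennreal (exp (- x n) + K n) * a (n - 1) + ennreal (D n)"
    and decay: "\<And>n. n \<in> {2..t} \<Longrightarrow> exp (- x n) * K (n - 1) \<le> K n"
      "\<And>n. n \<in> {2..t} \<Longrightarrow> exp (- x n) * D (n - 1) \<le> D n"
  shows "1 \<le> n \<Longrightarrow> n \<le> t \<Longrightarrow> b n \<le> ennreal (exp (- (\<Sum>i=1..n. x i))) * a 0
    + ennreal (K n) * (\<Sum>i<n. a i) + ennreal (D n * real n)"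
proof (induction n rule: dec_induct)
  case base
  then show ?case using step[of 1] nonneg by (simp add: distrib_right)
next
  case (step n)
  define A where "A = ennreal (exp (- (\<Sum>i=1..n. x i))) * a 0"
  define B where "B = (\<Sum>i<n. a i)"
  let ?e = "ennreal (exp (- x (Suc n)))"
  have n: "Suc n \<in> {1..t}" "Suc n \<in> {2..t}" using step by auto
  have "b (Suc n) \<le> ?e * a n + ennreal (K (Suc n)) * a n + ennreal (D (Suc n))"
    using assms(4)[OF n(1)] nonneg by (simp add: distrib_right)
  also have "?e * a n \<le> ?e * (A + ennreal (K n) * B + ennreal (D n * real n))"
    unfolding A_def B_def using step by (intro mult_left_mono order_trans[OF ab]) auto
  also have "\<dots> = ?e * A + ennreal (exp (- x (Suc n)) * K n) * B + ennreal (exp (- x (Suc n)) * D n * real n)"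
    using nonneg by (simp add: distrib_left ennreal_mult mult.assoc)
  also have "\<dots> \<le> ?e * A + ennreal (K (Suc n)) * B + ennreal (D (Suc n) * real n)"
    using decay[OF n(2)] by (intro add_mono mult_right_mono ennreal_leI order_refl) auto
  also have "?e * A = ennreal (exp (- (\<Sum>i=1..Suc n. x i))) * a 0"
    by (simp add: A_def mult.assoc[symmetric] ennreal_mult[symmetric] exp_add[symmetric] add.commute)
  finally have "b (Suc n) \<le> ennreal (exp (- (\<Sum>i=1..Suc n. x i))) * a 0 + ennreal (K (Suc n)) * B
      + ennreal (D (Suc n) * real n) + ennreal (K (Suc n)) * a n + ennreal (D (Suc n))"
    by (simp add: add_right_mono)
  also have "\<dots> = ennreal (exp (- (\<Sum>i=1..Suc n. x i))) * a 0 + ennreal (K (Suc n)) * (\<Sum>i<Suc n. a i)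
      + (ennreal (D (Suc n) * real n) + ennreal (D (Suc n)))"
    by (simp add: B_def distrib_left add_ac)
  also have "ennreal (D (Suc n) * real n) + ennreal (D (Suc n)) = ennreal (D (Suc n) * real (Suc n))"
    using nonneg by (simp add: algebra_simps flip: ennreal_plus)
  finally show ?case .
qed

text \<open>The first bound loses from \<open>exp (- 4 / 3 * x)\<close> to \<open>exp (- x)\<close>.
  In the second, \<open>2 / 5 * x\<close> is the room needed for the noise term, and the comparison
  with \<open>(1 - x / 4)\<^sup>2\<close> uses that \<open>x\<close> is at most 1.\<close>

lemma contraction_factor_le_exp:
  fixes x :: real
  assumes "0 \<le> x" "x \<le> 1"
  shows "(1 - 2 / 3 * x)\<^sup>2 \<le> exp (- x)" "(1 - 2 / 3 * x)\<^sup>2 + 2 / 5 * x \<le> exp (- x / 2)"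
proof -
  have "(1 - 2 / 3 * x)\<^sup>2 \<le> (exp (- (2 / 3 * x)))\<^sup>2"
    using assms exp_ge_add_one_self[of "- (2 / 3 * x)"] by (intro power_mono) auto
  also have "\<dots> \<le> exp (- x)" using assms by (simp add: power2_eq_square flip: exp_add)
  finally show "(1 - 2 / 3 * x)\<^sup>2 \<le> exp (- x)" .
  have "(1 - 2 / 3 * x)\<^sup>2 + 2 / 5 * x \<le> (1 - x / 4)\<^sup>2"
    using assms mult_right_mono[of x 1 x] by (simp add: power2_eq_square field_simps)
  also have "\<dots> \<le> (exp (- (x / 4)))\<^sup>2"
    using assms exp_ge_add_one_self[of "- (x / 4)"] by (intro power_mono) auto
  also have "\<dots> = exp (- x / 2)" by (simp add: power2_eq_square flip: exp_add)
  finally show "(1 - 2 / 3 * x)\<^sup>2 + 2 / 5 * x \<le> exp (- x / 2)" .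
qed

section \<open>Equal distributions, the mean, and the filtration\<close>

lemma borel_measurable_spec_norm:
  fixes X :: "'a \<Rightarrow> real^'n^'m"
  assumes "X \<in> borel_measurable M"
  shows "(\<lambda>\<omega>. spec_norm (X \<omega>)) \<in> borel_measurable M"
proof -
  have "convex_on UNIV (spec_norm :: real^'n^'m \<Rightarrow> real)"
  proof (rule convex_onI)
    fix t :: real and A B :: "real^'n^'m"
    assume "0 < t" "t < 1"
    then show "spec_norm ((1 - t) *\<^sub>R A + t *\<^sub>R B) \<le> (1 - t) * spec_norm A + t * spec_norm B"
      using spec_norm_add[of "(1 - t) *\<^sub>R A" "t *\<^sub>R B"] by (simp add: spec_norm_scaleR)
  qed simp
  then have "continuous_on UNIV (spec_norm :: real^'n^'m \<Rightarrow> real)"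
    by (rule convex_on_continuous[OF open_UNIV])
  then show ?thesis using assms by (rule borel_measurable_continuous_on)
qed

lemma AE_of_distr_eq:
  assumes "distr P borel X = distr P borel Y" "X \<in> borel_measurable P" "Y \<in> borel_measurable P"
    and "{x. Q x} \<in> sets borel" "AE \<omega> in P. Q (Y \<omega>)"
  shows "AE \<omega> in P. Q (X \<omega>)"
proof -
  have "AE x in distr P borel X. Q x"
    unfolding assms(1) using assms(3-5) by (subst AE_distr_iff) auto
  then show ?thesis using assms(2,4) by (subst (asm) AE_distr_iff) auto
qed

lemma transpose_expectation:
  fixes A :: "'a \<Rightarrow> real^'n^'n"
  assumes "integrable P A" "AE \<omega> in P. transpose (A \<omega>) = A \<omega>"
  shows "transpose (\<integral>\<omega>. A \<omega> \<partial>P) = (\<integral>\<omega>. A \<omega> \<partial>P)"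
proof -
  have bl: "bounded_linear (\<lambda>B :: real^'n^'n. B $ i $ j)" for i j
    using bounded_linear_compose[OF bounded_linear_vec_nth bounded_linear_vec_nth] .
  have comp: "(\<integral>\<omega>. A \<omega> \<partial>P) $ i $ j = (\<integral>\<omega>. A \<omega> $ i $ j \<partial>P)"
    and int: "integrable P (\<lambda>\<omega>. A \<omega> $ i $ j)" for i j
    using integral_bounded_linear[OF bl assms(1)] integrable_bounded_linear[OF bl assms(1)] by auto
  have "(\<integral>\<omega>. A \<omega> $ j $ i \<partial>P) = (\<integral>\<omega>. A \<omega> $ i $ j \<partial>P)" for i j
  proof (rule integral_cong_AE)
    show "AE \<omega> in P. A \<omega> $ j $ i = A \<omega> $ i $ j"
      using assms(2)
    proof eventually_elim
      case (elim \<omega>)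
      have "transpose (A \<omega>) $ i $ j = A \<omega> $ j $ i" by (simp add: transpose_def)
      then show ?case by (simp add: elim)
    qed
  qed (use int in auto)
  then show ?thesis by (simp add: vec_eq_iff transpose_def comp)
qed

lemma space_sets_filt_sigma:
  "space (sigma (space P) (rv_sets P Z0 \<union> (\<Union>j\<in>{1..n}. rv_sets P (A j)))) = space P"
  "sets (sigma (space P) (rv_sets P Z0 \<union> (\<Union>j\<in>{1..n}. rv_sets P (A j)))) = filt P Z0 A n"
proof -
  have "rv_sets P Z0 \<union> (\<Union>j\<in>{1..n}. rv_sets P (A j)) \<subseteq> Pow (space P)"
    by (auto simp: rv_sets_def)
  then show "space (sigma (space P) (rv_sets P Z0 \<union> (\<Union>j\<in>{1..n}. rv_sets P (A j)))) = space P"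
    "sets (sigma (space P) (rv_sets P Z0 \<union> (\<Union>j\<in>{1..n}. rv_sets P (A j)))) = filt P Z0 A n"
    by (simp_all add: space_measure_of sets_measure_of filt_def)
qed

text \<open>Group the independent family into the indices \<open>{0..n}\<close> and
  \<open>{Suc n}\<close>, where index 0 stands for the initial matrix; the first block generates the
  filtration.\<close>

lemma (in prob_space) indep_filt_next:
  assumes "indep_sets (\<lambda>i. if i = 0 then rv_sets M Z0 else rv_sets M (A i)) UNIV"
  shows "indep_set (filt M Z0 A n) (rv_sets M (A (Suc n)))"
proof -
  let ?E = "\<lambda>i. if i = 0 then rv_sets M Z0 else rv_sets M (A i)"
  define I where "I b = (if b then {0..n} else {Suc n})" for b
  have "indep_sets (\<lambda>b. sigma_sets (space M) (\<Union>i\<in>I b. ?E i)) UNIV"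
  proof (rule indep_sets_collect_sigma)
    show "indep_sets ?E (\<Union>b\<in>UNIV. I b)" using assms by (rule indep_sets_mono_index[rotated]) simp
    show "Int_stable (?E i)" for i
      by (simp add: rv_sets_def Int_stable_vimage_sets)
    show "disjoint_family_on I UNIV" by (auto simp: disjoint_family_on_def I_def)
  qed
  moreover have "(\<Union>i\<in>I True. ?E i) = rv_sets M Z0 \<union> (\<Union>j\<in>{1..n}. rv_sets M (A j))"
    by (auto simp: I_def split: if_splits)
  moreover have "(\<Union>i\<in>I False. ?E i) = rv_sets M (A (Suc n))" by (simp add: I_def)
  ultimately have "indep_sets (case_bool (filt M Z0 A n) (sigma_sets (space M) (rv_sets M (A (Suc n))))) UNIV"
    by (elim indep_sets_mono_sets) (auto simp: filt_def split: bool.splits)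
  then show ?thesis
    unfolding indep_set_def by (elim indep_sets_mono_sets) (auto split: bool.splits)
qed

text \<open>Norms take values in \<open>ennreal\<close>, so no moment of the initial matrix has to
  be assumed: an infinite initial norm makes the right sides infinite.\<close>

theorem theorem3p1:
  fixes P :: "'a measure"
    and A :: "nat \<Rightarrow> 'a \<Rightarrow> real^'d::finite^'d"
    and Z :: "nat \<Rightarrow> 'a \<Rightarrow> real^'k::finite^'d"
    and \<eta> :: "nat \<Rightarrow> real"
    and Mbar :: "real^'d^'d"
    and V :: "real^'k^'d" and U :: "real^'u::finite^'d"
    and lv :: "'k \<Rightarrow> real" and lu :: "'u \<Rightarrow> real"
    and Mb \<gamma> p :: real and t :: nat
    and G :: "nat \<Rightarrow> 'a set"
  defines "\<rho> \<equiv> Min (range lv) - Max (range lu)"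
      and "\<epsilon> \<equiv> (\<lambda>i. 2 * \<eta> i * Mb * (1 + \<gamma>))"
      and "W \<equiv> W_ind U V Z G"
  assumes P: "prob_space P"
    \<comment> \<open>Assumption 1: A_1, A_2, ... i.i.d. symmetric, Z_0 independent of them, mean Mbar\<close>
    and A_meas: "\<And>i. i \<ge> 1 \<Longrightarrow> A i \<in> borel_measurable P"
    and indep: "prob_space.indep_sets P
                  (\<lambda>i. if i = 0 then rv_sets P (Z 0) else rv_sets P (A i)) UNIV"
    and A_ident: "\<And>i. i \<ge> 1 \<Longrightarrow> distr P borel (A i) = distr P borel (A 1)"
    and A_sym: "\<And>i. i \<ge> 1 \<Longrightarrow> AE \<omega> in P. transpose (A i \<omega>) = A i \<omega>"
    and A_int: "integrable P (A 1)"
    and Mbar_def: "Mbar = prob_space.expectation P (A 1)"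
    and Z0_meas: "Z 0 \<in> borel_measurable P"
    \<comment> \<open>eigendecomposition of Mbar: V top-k eigenvectors, U the remaining ones\<close>
    and dims: "CARD('k) + CARD('u) = CARD('d)"
    and V_orth: "transpose V ** V = mat 1"
    and U_orth: "transpose U ** U = mat 1"
    and VU_orth: "transpose V ** U = 0"
    and V_eig: "Mbar ** V = V ** diag_mat lv"
    and U_eig: "Mbar ** U = U ** diag_mat lu"
    and top_k: "\<And>i j. lu j \<le> lv i"
    and gap: "\<rho> > 0"
    \<comment> \<open>Assumption 2\<close>
    and Mb_pos: "Mb > 0"
    and A2: "AE \<omega> in P. \<forall>Q::real^'k^'d. transpose Q ** Q = mat 1 \<longrightarrow>
                 spec_norm (transpose Q ** (A 1 \<omega> - Mbar)) \<le> Mb"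
    \<comment> \<open>Oja's iterates\<close>
    and eta_pos: "\<And>i. i \<ge> 1 \<Longrightarrow> \<eta> i > 0"
    and Z_rec: "\<And>i \<omega>. i \<ge> 1 \<Longrightarrow> Z i \<omega> = (mat 1 + \<eta> i *\<^sub>R A i \<omega>) ** Z (i - 1) \<omega>"
    \<comment> \<open>good events\<close>
    and G_nested: "\<And>i. G (Suc i) \<subseteq> G i"
    and G_meas: "\<And>i. G i \<in> filt P (Z 0) A i"
    and G_inv: "\<And>i \<omega>. \<omega> \<in> G i \<Longrightarrow> invertible (transpose V ** Z i \<omega>)"
    \<comment> \<open>parameters\<close>
    and gamma: "\<gamma> \<ge> 1"
    and t_pos: "t \<ge> 1"
    and CR: "\<And>i. i \<in> {1..t} \<Longrightarrow> AE \<omega> in P.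
               spec_norm (transpose V ** (A i \<omega> - Mbar) ** U ** W (i - 1) (i - 1) \<omega>) \<le> Mb * \<gamma>"
    and eps_small: "\<And>i. i \<in> {1..t} \<Longrightarrow> \<epsilon> i \<le> 1 / 2"
    and eta_small: "\<And>i. i \<in> {1..t} \<Longrightarrow> \<eta> i * spec_norm Mbar \<le> 1 / 2"
    and eps_ratio: "\<And>i. i \<in> {2..t} \<Longrightarrow> exp (- \<eta> i * \<rho> / 4) \<le> \<epsilon> i / \<epsilon> (i - 1)"
    and p: "p \<ge> 2"
  shows "pp_norm_sq P p (W t t) \<le> pp_norm_sq P p (W t (t - 1)) \<and>
         pp_norm_sq P p (W t (t - 1)) \<le>
           ennreal (exp (- (\<Sum>i=1..t. \<eta> i) * \<rho>)) * pp_norm_sq P p (W 0 0)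
           + ennreal (21 * p * (\<epsilon> t)\<^sup>2) * (\<Sum>i<t. pp_norm_sq P p (W i i))
           + ennreal (5 * p * real CARD('k) powr (2 / p) * (\<epsilon> t)\<^sup>2 * real t)
       \<and> ((\<forall>i\<in>{1..t}. p * (\<epsilon> i)\<^sup>2 \<le> \<eta> i * \<rho> / 50) \<longrightarrow>
           pp_norm_sq P p (W t t) \<le> pp_norm_sq P p (W t (t - 1)) \<and>
           pp_norm_sq P p (W t (t - 1)) \<le>
             ennreal (exp (- (\<Sum>i=1..t. \<eta> i) * \<rho> / 2)) * pp_norm_sq P p (W 0 0)
             + ennreal (5 * p * real CARD('k) powr (2 / p) * (\<epsilon> t)\<^sup>2 * real t))"
proof -
  interpret prob_space P by (rule P)
  have Mbar_sym: "transpose Mbar = Mbar"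
    unfolding Mbar_def using A_sym[of 1] by (intro transpose_expectation A_int) simp
  interpret spectral_split Mbar V U lv lu
    by unfold_locales (rule dims V_orth U_orth VU_orth V_eig U_eig Mbar_sym)+

  have A_i: "integrable P (A i)" "expectation (A i) = Mbar" if "1 \<le> i" for i
  proof -
    have m: "A i \<in> measurable P borel" "A 1 \<in> measurable P borel" using A_meas that by auto
    have "integrable (distr P borel (A i)) (\<lambda>x. x)"
      unfolding A_ident[OF that] using A_int m by (subst integrable_distr_eq) auto
    then show "integrable P (A i)" using m by (subst (asm) integrable_distr_eq) auto
    have "expectation (A i) = (\<integral>x. x \<partial>distr P borel (A i))"
      using m by (subst integral_distr) auto
    also have "\<dots> = expectation (A 1)"
      unfolding A_ident[OF that] using m by (subst integral_distr) auto
    finally show "expectation (A i) = Mbar" by (simp add: Mbar_def)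
  qed
  \<comment> \<open>Assumption 2 speaks of the first sample only. It is first rewritten as a bound
    on the full spectral norm, because transfer along equal distributions needs a Borel set of
    matrices.\<close>
  have A_bound: "AE \<omega> in P. spec_norm (A i \<omega> - Mbar) \<le> Mb" if "1 \<le> i" for i
  proof (rule AE_of_distr_eq[OF A_ident[OF that] A_meas[OF that] A_meas[OF order_refl]])
    have "(\<lambda>x. spec_norm (x - Mbar)) \<in> borel_measurable borel"
      by (intro borel_measurable_spec_norm borel_measurable_diff borel_measurable_const measurable_ident_sets[OF refl])
    then show "{x. spec_norm (x - Mbar) \<le> Mb} \<in> sets borel"
      using borel_measurable_le[of _ borel "\<lambda>_. Mb"] by simp
    show "AE \<omega> in P. spec_norm (A 1 \<omega> - Mbar) \<le> Mb"
      using A2 by eventually_elim (rule spec_norm_le_of_orthonormal_rows[OF V_orth], blast)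
  qed

  \<comment> \<open>The filtration as a measurable space, so that being adapted is ordinary
    measurability with respect to \<open>F n\<close>.\<close>
  define F where "F n = sigma (space P) (rv_sets P (Z 0) \<union> (\<Union>j\<in>{1..n}. rv_sets P (A j)))" for n
  have F: "space (F n) = space P" "sets (F n) = filt P (Z 0) A n" for n
    unfolding F_def by (rule space_sets_filt_sigma)+
  have rv_in: "rv_sets P (Z 0) \<subseteq> filt P (Z 0) A n"
    "1 \<le> j \<Longrightarrow> j \<le> n \<Longrightarrow> rv_sets P (A j) \<subseteq> filt P (Z 0) A n" for j n
    unfolding filt_def by (auto intro!: sigma_sets.Basic)
  have F_sub: "sets (F n) \<subseteq> sets P" for n
  proof -
    have "rv_sets P (Z 0) \<union> (\<Union>j\<in>{1..n}. rv_sets P (A j)) \<subseteq> sets P"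
      using Z0_meas A_meas by (auto simp: rv_sets_def measurable_sets)
    then show ?thesis unfolding F(2) filt_def by (rule sets.sigma_sets_subset)
  qed
  have A_F: "A j \<in> borel_measurable (F n)" if "1 \<le> j" "j \<le> n" for j n
    using rv_in(2)[OF that] by (intro measurableI) (auto simp: F rv_sets_def)
  have Z_F: "Z i \<in> borel_measurable (F n)" if "i \<le> n" for i n
    using that
  proof (induction i)
    case 0
    show ?case using rv_in(1)[of n] by (intro measurableI) (auto simp: F rv_sets_def)
  next
    case (Suc i)
    have "Z (Suc i) = (\<lambda>\<omega>. (mat 1 + \<eta> (Suc i) *\<^sub>R A (Suc i) \<omega>) ** Z i \<omega>)"
      using Z_rec[of "Suc i"] by (simp add: fun_eq_iff)
    then show ?case
      using Suc A_F[of "Suc i" n]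
      by (auto intro!: borel_measurable_matrix_mult borel_measurable_add borel_measurable_scaleR)
  qed
  have G_F: "G i \<in> sets (F i)" for i using G_meas F by simp
  have G_P: "G i \<in> sets P" for i using G_F F_sub by blast
  have W_formula: "(\<lambda>\<omega>. transpose U ** Z n \<omega> ** matrix_inv (transpose V ** Z n \<omega>)) \<in> borel_measurable (F n)" for n
    by (intro borel_measurable_matrix_mult borel_measurable_matrix_inv borel_measurable_const Z_F order_refl)
  have W_F: "W n n \<in> borel_measurable (F n)" for n
    unfolding W_def W_ind_def
    by (intro measurable_If_set W_formula borel_measurable_const) (use G_F in auto)
  have W_P: "W n n \<in> borel_measurable P" for n
    by (rule borel_measurable_larger[OF F(1) F_sub W_F])
  have W_off: "W n m \<omega> = 0" if "\<omega> \<notin> G m" for n m \<omega>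
    using that by (simp add: W_def W_ind_def)

  have \<rho>_eq: "\<rho> = Min (range lv) - Max (range lu)" by (simp add: \<rho>_def)
  let ?k = "real CARD('k) powr (2 / p)"
  define c where "c n = (1 - 2 / 3 * (\<eta> n * \<rho>))\<^sup>2 + 20 * p * (\<epsilon> n)\<^sup>2" for n
  define D where "D n = 5 * p * ?k * (\<epsilon> n)\<^sup>2" for n
  have \<eta>: "0 < \<eta> n" "\<eta> n * spec_norm Mbar \<le> 1 / 2" if "n \<in> {1..t}" for n
    using that eta_pos eta_small by auto
  have x: "0 < \<eta> n * \<rho>" "\<eta> n * \<rho> \<le> 1" if "n \<in> {1..t}" for n
    using eta_gap_le_one[OF \<eta>[OF that]] \<eta>(1)[OF that] gap unfolding \<rho>_def by auto
  have \<epsilon>0: "0 < \<epsilon> n" if "1 \<le> n" for n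
    using eta_pos[OF that] Mb_pos gamma by (simp add: \<epsilon>_def)

  have step: "pp_norm_sq P p (W n (n - 1)) \<le> ennreal (c n) * pp_norm_sq P p (W (n - 1) (n - 1)) + ennreal (D n)"
    if n: "n \<in> {1..t}" for n
  proof -
    obtain m where m: "n = Suc m" using n by (cases n) auto
    \<comment> \<open>With \<open>V\<close> cut off outside \<open>G m\<close>, the matrices
      \<open>R\<close>, \<open>Dn\<close>, \<open>J\<close> and \<open>W1\<close> all vanish there,
      just as \<open>W n m\<close> does.\<close>
    define R where "R = (\<lambda>\<omega>. (if \<omega> \<in> G m then V else 0) + U ** W m m \<omega>)"
    define Dn where "Dn = (\<lambda>\<omega>. noise_V (\<eta> n) (A n \<omega> - Mbar) (R \<omega>))"
    define J where "J = (\<lambda>\<omega>. noise (\<eta> n) (contraction (\<eta> n) (W m m \<omega>)) (R \<omega>) (A n \<omega> - Mbar))"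
    define W1 where "W1 = (\<lambda>\<omega>. contraction (\<eta> n) (W m m \<omega>) + J \<omega> + - (J \<omega> ** (Dn \<omega> ** matrix_inv (mat 1 + Dn \<omega>))))"
    have n1: "1 \<le> n" using n by simp
    have ind: "indep_set (sets (F m)) (rv_sets P (A n))"
      unfolding F m by (rule indep_filt_next[OF indep])
    have CRn: "AE \<omega> in P. spec_norm (transpose V ** (A n \<omega> - Mbar) ** U ** W m m \<omega>) \<le> Mb * \<gamma>"
      using CR[OF n] by (simp add: m)
    have \<epsilon>n: "\<epsilon> n = 2 * \<eta> n * Mb * (1 + \<gamma>)" by (simp add: \<epsilon>_def)
    have W_off_m: "W m m \<omega> = 0" if "\<omega> \<notin> G m" for \<omega> using that by (rule W_off)
    have noise_small: "AE \<omega> in P. spec_norm (Dn \<omega>) \<le> \<epsilon> n"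
      unfolding Dn_def R_def
      by (rule AE_spec_norm_noise_V[OF \<eta>[OF n] Mb_pos gamma \<epsilon>n W_off_m A_bound[OF n1] CRn])
    note one = oja_step_integral[OF P p \<eta>[OF n] \<rho>_eq gap Mb_pos gamma \<epsilon>n eps_small[OF n] F(1) F_sub
        W_F G_F W_off_m A_meas[OF n1] ind A_i[OF n1] A_bound[OF n1] CRn]
    \<comment> \<open>Equality holds only almost surely, because the update formula inverts
      \<open>1 + Dn\<close>, and the bound on \<open>Dn\<close> is an almost sure one.\<close>
    have "AE \<omega> in P. W n m \<omega> = W1 \<omega>"
      using noise_small
    proof eventually_elim
      case (elim \<omega>)
      show ?case
      proof (cases "\<omega> \<in> G m")
        case False
        then show ?thesis
          using W_off[OF False]
          by (simp add: W1_def J_def R_def noise_def noise_U_def noise_V_def contraction_def)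
      next
        case True
        have Wm: "W m m \<omega> = transpose U ** Z m \<omega> ** matrix_inv (transpose V ** Z m \<omega>)"
          using True by (simp add: W_def W_ind_def)
        have R: "R \<omega> = V + U ** W m m \<omega>" using True by (simp add: R_def)
        have "W n m \<omega> = transpose U ** ((mat 1 + \<eta> n *\<^sub>R A n \<omega>) ** Z m \<omega>) **
            matrix_inv (transpose V ** ((mat 1 + \<eta> n *\<^sub>R A n \<omega>) ** Z m \<omega>))"
          using True Z_rec[OF n1, of \<omega>] by (simp add: W_def W_ind_def m)
        then show ?thesis
          using oja_step[OF \<eta>[OF n] G_inv[OF True] Wm R refl] order_trans[OF elim eps_small[OF n]]
          by (simp add: W1_def J_def Dn_def)
      qed
    qed
    then have "pp_norm_sq P p (W n m) = pp_norm_sq P p W1" by (rule pp_norm_sq_cong_AE[OF p])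
    also have "\<dots> \<le> ennreal (c n) * pp_norm_sq P p (W m m) + ennreal (D n)"
    proof (rule pp_norm_sq_step[OF p W_P])
      have "0 < (1 - 2 / 3 * (\<eta> n * \<rho>))\<^sup>2" using x[OF n] by simp
      then show "0 < c n" unfolding c_def using p by (intro add_pos_nonneg) auto
      show "0 \<le> D n" using p by (simp add: D_def)
      fix a
      assume i: "integrable P (\<lambda>\<omega>. spow p (W m m \<omega>))" "(\<integral>\<omega>. spow p (W m m \<omega>) \<partial>P) \<le> a powr p" "0 < a"
      show "integrable P (\<lambda>\<omega>. spow p (W1 \<omega>)) \<and>
          (\<integral>\<omega>. spow p (W1 \<omega>) \<partial>P) \<le> (c n * a\<^sup>2 + D n) powr (p / 2)"
        unfolding c_def D_def W1_def J_def Dn_def R_def by (rule conjI[OF one[OF _ i]])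
    qed
    finally show ?thesis by (simp add: m)
  qed

  have mono: "pp_norm_sq P p (W n n) \<le> pp_norm_sq P p (W n (n - 1))" for n
  proof (rule pp_norm_sq_mono[OF p])
    fix \<omega>
    have "G n \<subseteq> G (n - 1)" using G_nested[of "n - 1"] by (cases n) auto
    then show "W n n \<omega> = W n (n - 1) \<omega> \<or> W n n \<omega> = 0"
      by (auto simp: W_def W_ind_def)
  qed

  \<comment> \<open>Coefficients contain the square of \<epsilon>, so the step-size hypothesis with
    rate 1/4 is squared to rate 1/2. This is exactly the decay of the second bound and is stronger
    than what the first one asks for.\<close>
  have ratio: "exp (- (\<eta> n * \<rho> / 2)) * (\<epsilon> (n - 1))\<^sup>2 \<le> (\<epsilon> n)\<^sup>2" if n: "n \<in> {2..t}" for n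
  proof -
    have pos: "0 < \<epsilon> (n - 1)" using n by (intro \<epsilon>0) auto
    have "exp (- \<eta> n * \<rho> / 4) * \<epsilon> (n - 1) \<le> \<epsilon> n"
      using eps_ratio[OF n] unfolding pos_le_divide_eq[OF pos] .
    then have "(exp (- \<eta> n * \<rho> / 4) * \<epsilon> (n - 1))\<^sup>2 \<le> (\<epsilon> n)\<^sup>2"
      using pos by (intro power_mono) auto
    moreover have "(exp (- \<eta> n * \<rho> / 4))\<^sup>2 = exp (- (\<eta> n * \<rho> / 2))"
      by (simp add: power2_eq_square flip: exp_add)
    ultimately show ?thesis by (simp add: power_mult_distrib)
  qed
  have ratio': "exp (- (\<eta> n * \<rho>)) * (\<epsilon> (n - 1))\<^sup>2 \<le> (\<epsilon> n)\<^sup>2" if n: "n \<in> {2..t}" for n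
  proof -
    have "0 < \<eta> n * \<rho>" using n by (intro x(1)) auto
    then have "exp (- (\<eta> n * \<rho>)) \<le> exp (- (\<eta> n * \<rho> / 2))"
      unfolding exp_le_cancel_iff by linarith
    then have "exp (- (\<eta> n * \<rho>)) * (\<epsilon> (n - 1))\<^sup>2 \<le> exp (- (\<eta> n * \<rho> / 2)) * (\<epsilon> (n - 1))\<^sup>2"
      by (intro mult_right_mono) auto
    then show ?thesis using ratio[OF n] by linarith
  qed
  have scale: "e * (C * y) \<le> C * z" if "e * y \<le> z" "0 \<le> C" for e C y z :: real
    using mult_left_mono[OF that] by (simp add: mult.left_commute)
  have D_nonneg: "0 \<le> D n" for n using p by (simp add: D_def)

  have first: "pp_norm_sq P p (W t (t - 1)) \<le> ennreal (exp (- (\<Sum>i=1..t. \<eta> i * \<rho>))) * pp_norm_sq P p (W 0 0)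
      + ennreal (21 * p * (\<epsilon> t)\<^sup>2) * (\<Sum>i<t. pp_norm_sq P p (W i i)) + ennreal (D t * real t)"
  proof (rule ennreal_contraction_recursion[where t = t and a = "\<lambda>i. pp_norm_sq P p (W i i)"
        and b = "\<lambda>i. pp_norm_sq P p (W i (i - 1))" and K = "\<lambda>n. 21 * p * (\<epsilon> n)\<^sup>2"])
    fix n assume n: "n \<in> {1..t}"
    \<comment> \<open>The one-step estimate has the constant 20; it is rounded up to the 21 of the
      claim.\<close>
    have "c n \<le> exp (- (\<eta> n * \<rho>)) + 21 * p * (\<epsilon> n)\<^sup>2"
      unfolding c_def using contraction_factor_le_exp(1)[OF less_imp_le[OF x(1)[OF n]] x(2)[OF n]] p
      by (intro add_mono mult_right_mono) auto
    then show "pp_norm_sq P p (W n (n - 1)) \<le> ennreal (exp (- (\<eta> n * \<rho>)) + 21 * p * (\<epsilon> n)\<^sup>2)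
        * pp_norm_sq P p (W (n - 1) (n - 1)) + ennreal (D n)"
      by (intro order_trans[OF step[OF n]] add_right_mono mult_right_mono ennreal_leI) auto
  next
    fix n assume n: "n \<in> {2..t}"
    show "exp (- (\<eta> n * \<rho>)) * (21 * p * (\<epsilon> (n - 1))\<^sup>2) \<le> 21 * p * (\<epsilon> n)\<^sup>2"
      using p by (intro scale ratio'[OF n]) auto
    show "exp (- (\<eta> n * \<rho>)) * D (n - 1) \<le> D n"
      unfolding D_def using p by (intro scale ratio'[OF n]) auto
  qed (use p t_pos D_nonneg mono in auto)

  have second: "pp_norm_sq P p (W t (t - 1)) \<le> ennreal (exp (- (\<Sum>i=1..t. \<eta> i * \<rho> / 2))) * pp_norm_sq P p (W 0 0)
      + ennreal (D t * real t)" if small: "\<forall>i\<in>{1..t}. p * (\<epsilon> i)\<^sup>2 \<le> \<eta> i * \<rho> / 50"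
  proof -
    \<comment> \<open>With \<open>K\<close> identically 0 the sum over earlier norms disappears: the
      noise term is absorbed into the contraction, at the price of half the exponential
      rate.\<close>
    have "pp_norm_sq P p (W t (t - 1)) \<le> ennreal (exp (- (\<Sum>i=1..t. \<eta> i * \<rho> / 2))) * pp_norm_sq P p (W 0 0)
        + ennreal 0 * (\<Sum>i<t. pp_norm_sq P p (W i i)) + ennreal (D t * real t)"
    proof (rule ennreal_contraction_recursion[where t = t and a = "\<lambda>i. pp_norm_sq P p (W i i)"
          and b = "\<lambda>i. pp_norm_sq P p (W i (i - 1))" and K = "\<lambda>n. 0"])
      fix n assume n: "n \<in> {1..t}"
      \<comment> \<open>By the extra hypothesis the noise term is at most 20 times
        \<open>\<eta> n * \<rho> / 50\<close>, which is the 2/5 here.\<close>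
      have "c n \<le> (1 - 2 / 3 * (\<eta> n * \<rho>))\<^sup>2 + 2 / 5 * (\<eta> n * \<rho>)"
        unfolding c_def mult.assoc[of 20] using small[rule_format, OF n] by linarith
      also have "\<dots> \<le> exp (- (\<eta> n * \<rho> / 2)) + 0"
        using contraction_factor_le_exp(2)[OF less_imp_le[OF x(1)[OF n]] x(2)[OF n]] by simp
      finally show "pp_norm_sq P p (W n (n - 1)) \<le> ennreal (exp (- (\<eta> n * \<rho> / 2)) + 0)
          * pp_norm_sq P p (W (n - 1) (n - 1)) + ennreal (D n)"
        by (intro order_trans[OF step[OF n]] add_right_mono mult_right_mono ennreal_leI) auto
    next
      fix n assume n: "n \<in> {2..t}"
      show "exp (- (\<eta> n * \<rho> / 2)) * D (n - 1) \<le> D n"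
        unfolding D_def using p by (intro scale ratio[OF n]) auto
    qed (use t_pos D_nonneg mono in auto)
    then show ?thesis by simp
  qed

  have sums: "(\<Sum>i=1..t. \<eta> i * \<rho>) = (\<Sum>i=1..t. \<eta> i) * \<rho>" "(\<Sum>i=1..t. \<eta> i * \<rho> / 2) = (\<Sum>i=1..t. \<eta> i) * \<rho> / 2"
    by (simp_all add: sum_distrib_right sum_divide_distrib)
  show ?thesis
    using mono[of t] first second unfolding sums D_def by simp
qed

end
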